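(* Let $0<\alpha<1$, let $k\ge1$ be an integer, $\varrho\in[0,1)$, and let $\lambda:[0,\infty)\to[0,\infty)$ be a rate function with $\Lambda(t)=\int_0^t\lambda(u)\,du<\infty$ for every $t>0$. Let $N_{PAk}$ be the P\'olya-Aeppli process of order $k$ with unit intensity and parameter $\varrho$, and let $Y_\alpha$ be an inverse $\alpha$-stable subordinator independent of $N_{PAk}$. For $t\ge0$, $v\ge 0$ let $$p_m^{**}(t,v)=\mathbb{P}\big[N_{PAk}(\Lambda(Y_\alpha(t)+v))-N_{PAk}(\Lambda(v))=m\big],\qquad m=0,1,2,\dots$$ Then, for $t>0$ and $v\ge 0$, these marginal distributions satisfy the fractional differential-difference integral equations $$D_t^\alpha p_0^{**}(t,v)=-\int_0^\infty\lambda(u+v)\,f_0^n(u,v)\,h_\alpha(t,u)\,du,$$ $$D_t^\alpha p_m^{**}(t,v)=\int_0^\infty\lambda(u+v)\Big[-f_m^n(u,v)+\frac{1-\varrho}{1-\varrho^k}\sum_{j=1}^{m\wedge k}\varrho^{j-1}f_{m-j}^n(u,v)\Big]h_\alpha(t,u)\,du,\qquad m=1,2,\dots,$$ with the initial condition $p_m^{**}(0,v)=\delta_{m,0}$, where $$f_m^n(u,v)=\mathbb{P}\big[N_{PAk}(\Lambda(u+v))-N_{PAk}(\Lambda(v))=m\big].$$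
   Context: P\'olya-Aeppli process of order $k$ with unit intensity and parameter $\varrho$: $N_{PAk}(t)=X_1+\dots+X_{N_1(t)}$ (an empty sum being $0$), where $N_1$ is a homogeneous Poisson process with intensity $1$ and $X_1,X_2,\dots$ are i.i.d., independent of $N_1$, with the truncated geometric distribution $$\mathbb{P}[X_i=m]=\frac{1-\varrho}{1-\varrho^k}\varrho^{m-1},\qquad m=1,2,\dots,k,$$ with the convention $0^0=1$. The process $t\mapsto N_{PAk}(\Lambda(t))$ is the non-homogeneous P\'olya-Aeppli process of order $k$ with cumulative rate function $\Lambda$, and $f_m^n(u,v)$ is the distribution of its increment over $(v,u+v]$. Inverse $\alpha$-stable subordinator: let $\{\mathcal{L}_\alpha(t);\,t\ge 0\}$ be the $\alpha$-stable L\'evy subordinator, i.e. the L\'evy process with $\mathbb{E}[e^{-s\mathcal{L}_\alpha(t)}]=e^{-ts^\alpha}$, $s\ge 0$. Then $Y_\alpha(t)=\inf\{u>0:\mathcal{L}_\alpha(u)>t\}$, $t\ge 0$. For $t>0$, $h_\alpha(t,\cdot)$ denotes the probability density of $Y_\alpha(t)$ on $(0,\infty)$. $D_t^\alpha$ is the Caputo fractional derivative in $t$: for $0<\alpha<1$, $D_t^\alpha f(t)=\frac{1}{\Gamma(1-\alpha)}\int_0^t\frac{df(u)}{du}\frac{du}{(t-u)^\alpha}$. Notation: $m\wedge k=\min(m,k)$. *)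

theory Defs
  imports "HOL-Probability.Probability"
begin

section \<open>Processes with stationary independent increments\<close>

text \<open>The library constant \<open>indep_var\<close> requires both variables to have the same value type, so
  independence of two families indexed by different types is stated with the generated sigma-algebras.\<close>

definition generated_events ::
    "'w measure \<Rightarrow> 'b measure \<Rightarrow> 'i set \<Rightarrow> ('i \<Rightarrow> 'w \<Rightarrow> 'b) \<Rightarrow> 'w set set" where
  "generated_events M B I Z =
     sigma_sets (space M) {Z i -` A \<inter> space M | i A. i \<in> I \<and> A \<in> sets B}"

definition indep_increments :: "'w measure \<Rightarrow> (real \<Rightarrow> 'w \<Rightarrow> real) \<Rightarrow> bool" where
  "indep_increments M Z \<longleftrightarrow>
     (\<forall>(\<tau> :: nat \<Rightarrow> real) n. 0 \<le> \<tau> 0 \<and> (\<forall>i<n. \<tau> i \<le> \<tau> (Suc i)) \<longrightarrow>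
        prob_space.indep_vars M (\<lambda>_. borel)
          (\<lambda>i \<omega>. Z (\<tau> (Suc i)) \<omega> - Z (\<tau> i) \<omega>) {..<n})"

definition cadlag :: "(real \<Rightarrow> real) \<Rightarrow> bool" where
  "cadlag x \<longleftrightarrow> (\<forall>t\<ge>0. continuous (at_right t) x) \<and> (\<forall>t>0. \<exists>l. (x \<longlongrightarrow> l) (at_left t))"

definition levy_process :: "'w measure \<Rightarrow> (real \<Rightarrow> 'w \<Rightarrow> real) \<Rightarrow> bool" where
  "levy_process M Z \<longleftrightarrow>
     (\<forall>t\<ge>0. Z t \<in> borel_measurable M) \<and>
     (AE \<omega> in M. Z 0 \<omega> = 0) \<and>
     indep_increments M Z \<and>
     (\<forall>s\<ge>0. \<forall>t\<ge>0. distr M borel (\<lambda>\<omega>. Z (s + t) \<omega> - Z s \<omega>) = distr M borel (Z t)) \<and>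
     (AE \<omega> in M. cadlag (\<lambda>t. Z t \<omega>))"

text \<open>The path properties are required for every \<open>\<omega>\<close> (rather than almost every one), as usual for a
  counting process; the process is going to be evaluated at a random time, and on an incomplete
  probability space the resulting events would otherwise not need to be measurable.\<close>

definition poisson_process :: "'w measure \<Rightarrow> real \<Rightarrow> (real \<Rightarrow> 'w \<Rightarrow> nat) \<Rightarrow> bool" where
  "poisson_process M r N \<longleftrightarrow>
     (\<forall>t\<ge>0. N t \<in> measurable M (count_space UNIV)) \<and>
     (\<forall>\<omega>\<in>space M. N 0 \<omega> = 0 \<and> mono_on {0..} (\<lambda>t. N t \<omega>) \<and>
        (\<forall>t\<ge>0. continuous (at_right t) (\<lambda>s. real (N s \<omega>)))) \<and>
     indep_increments M (\<lambda>t \<omega>. real (N t \<omega>)) \<and>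
     (\<forall>s\<ge>0. \<forall>t\<ge>0. \<forall>n.
        \<P>(\<omega> in M. N (s + t) \<omega> - N s \<omega> = n) = exp (- (r * t)) * (r * t) ^ n / fact n)"

section \<open>The Polya-Aeppli process of order k\<close>

definition truncated_geometric :: "'w measure \<Rightarrow> nat \<Rightarrow> real \<Rightarrow> ('w \<Rightarrow> nat) \<Rightarrow> bool" where
  "truncated_geometric M k \<rho> X \<longleftrightarrow>
     X \<in> measurable M (count_space UNIV) \<and>
     (\<forall>m\<in>{1..k}. \<P>(\<omega> in M. X \<omega> = m) = (1 - \<rho>) / (1 - \<rho> ^ k) * \<rho> ^ (m - 1))"

text \<open>The intensity is normalised to one.\<close>

definition polya_aeppli_process ::
    "'w measure \<Rightarrow> nat \<Rightarrow> real \<Rightarrow> (real \<Rightarrow> 'w \<Rightarrow> nat) \<Rightarrow> bool" where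
  "polya_aeppli_process M k \<rho> N \<longleftrightarrow>
     (\<exists>N1 X. poisson_process M 1 N1 \<and>
        (\<forall>i\<ge>1. truncated_geometric M k \<rho> (X i)) \<and>
        prob_space.indep_vars M (\<lambda>_. count_space UNIV) X {1..} \<and>
        prob_space.indep_set M
          (generated_events M (count_space UNIV) {0..} N1)
          (generated_events M (count_space UNIV) {1..} X) \<and>
        (\<forall>t\<ge>0. \<forall>\<omega>\<in>space M. N t \<omega> = (\<Sum>i = 1..N1 t \<omega>. X i \<omega>)))"

definition cumulative_rate :: "(real \<Rightarrow> real) \<Rightarrow> real \<Rightarrow> real" where
  "cumulative_rate lam t = (LINT u:{0..t}|lborel. lam u)"

text \<open>The quantity \<open>f\<^sub>m\<^sup>n(u,v)\<close>: the distribution of the increment over \<open>(v, u + v]\<close> of the process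
  \<open>N\<close> run with cumulative rate \<open>\<Lambda>\<close>. Increments are taken in the integers to avoid truncated
  subtraction.\<close>

definition increment_prob ::
    "'w measure \<Rightarrow> (real \<Rightarrow> 'w \<Rightarrow> nat) \<Rightarrow> (real \<Rightarrow> real) \<Rightarrow> nat \<Rightarrow> real \<Rightarrow> real \<Rightarrow> real" where
  "increment_prob M N \<Lambda> m u v =
     \<P>(\<omega> in M. int (N (\<Lambda> (u + v)) \<omega>) - int (N (\<Lambda> v) \<omega>) = int m)"

text \<open>The quantity \<open>p\<^sub>m(t,v)\<close> (with two stars) of the process subordinated by \<open>Y\<close>.\<close>

definition subordinated_increment_prob ::
    "'w measure \<Rightarrow> (real \<Rightarrow> 'w \<Rightarrow> nat) \<Rightarrow> (real \<Rightarrow> real) \<Rightarrow> (real \<Rightarrow> 'w \<Rightarrow> real) \<Rightarrow>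
      nat \<Rightarrow> real \<Rightarrow> real \<Rightarrow> real" where
  "subordinated_increment_prob M N \<Lambda> Y m t v =
     \<P>(\<omega> in M. int (N (\<Lambda> (Y t \<omega> + v)) \<omega>) - int (N (\<Lambda> v) \<omega>) = int m)"

section \<open>Inverse stable subordinators\<close>

definition stable_subordinator :: "'w measure \<Rightarrow> real \<Rightarrow> (real \<Rightarrow> 'w \<Rightarrow> real) \<Rightarrow> bool" where
  "stable_subordinator M \<alpha> L \<longleftrightarrow>
     levy_process M L \<and>
     (AE \<omega> in M. mono_on {0..} (\<lambda>t. L t \<omega>)) \<and>
     (\<forall>t\<ge>0. \<forall>s\<ge>0. integrable M (\<lambda>\<omega>. exp (- s * L t \<omega>)) \<and>
        (LINT \<omega>|M. exp (- s * L t \<omega>)) = exp (- t * s powr \<alpha>))"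

definition inverse_stable_subordinator :: "'w measure \<Rightarrow> real \<Rightarrow> (real \<Rightarrow> 'w \<Rightarrow> real) \<Rightarrow> bool" where
  "inverse_stable_subordinator M \<alpha> Y \<longleftrightarrow>
     (\<forall>t\<ge>0. Y t \<in> borel_measurable M) \<and>
     (\<exists>L. stable_subordinator M \<alpha> L \<and>
        (AE \<omega> in M. \<forall>t\<ge>0. Y t \<omega> = Inf {u. 0 < u \<and> t < L u \<omega>}))"

section \<open>The Caputo derivative\<close>

definition caputo_derivative :: "real \<Rightarrow> (real \<Rightarrow> real) \<Rightarrow> real \<Rightarrow> real" where
  "caputo_derivative \<alpha> f t =
     1 / Gamma (1 - \<alpha>) * (LINT u:{0<..<t}|lborel. deriv f u / (t - u) powr \<alpha>)"

text \<open>Well-definedness of the expression above, since \<^const>\<open>deriv\<close> and the integral are total.\<close>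

definition caputo_differentiable :: "real \<Rightarrow> (real \<Rightarrow> real) \<Rightarrow> real \<Rightarrow> bool" where
  "caputo_differentiable \<alpha> f t \<longleftrightarrow>
     (\<forall>u\<in>{0<..<t}. f field_differentiable (at u)) \<and>
     set_integrable lborel {0<..<t} (\<lambda>u. deriv f u / (t - u) powr \<alpha>)"

end

theory Submission
  imports Defs "HOL-Real_Asymp.Real_Asymp"
begin

text \<open>
  Write \<open>A(u) = \<Lambda>(u + v) - \<Lambda>(v)\<close>. Conditioning on the Poisson process shows that the increment of the
  Polya-Aeppli process over a time interval of length \<open>\<tau>\<close> equals \<open>m\<close> with a probability \<open>q\<^sub>m(\<tau>)\<close> that is
  \<open>exp (- \<tau>)\<close> times a polynomial, and that \<open>q\<^sub>m' = \<psi>\<^sub>m\<close>, where \<open>\<psi>\<^sub>m\<close> is the bracket on the right-hand side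
  of the equations (\<open>pa_prob_derivative\<close>). The rate \<open>\<lambda>\<close> is merely locally integrable, so
  \<open>u \<mapsto> q\<^sub>m(A(u))\<close> need not be differentiable; but \<open>A\<close> carries the measure \<open>\<lambda>(u + v) du\<close> to Lebesgue
  measure (\<open>distr_cum\<close>), and this gives \<open>q\<^sub>m(A(y)) = q\<^sub>m(0) + \<integral>\<^sub>0\<^sup>y \<phi>(u) du\<close> with
  \<open>\<phi>(u) = \<lambda>(u + v) \<psi>\<^sub>m(A(u))\<close>, integrable on the half-line. By independence the subordinated probability is
  \<open>q\<^sub>m(0) + \<integral> \<phi>(u) P(Y(t) \<ge> u) du\<close>, and \<open>P(Y(t) \<ge> u) = P(L(u) \<le> t)\<close> for the subordinator \<open>L\<close> inverse to
  \<open>Y\<close> (\<open>subordinated_increment_prob_eq\<close>, \<open>law_of_Y\<close>). The time \<open>t\<close> is now confined to the distribution function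
  of \<open>L(u)\<close>, so the theorem reduces to the statement that its Caputo derivative in \<open>t\<close> is the density
  \<open>h(t,u)\<close> of \<open>Y(t)\<close>, together with bounds that allow this derivative to be taken under the integral
  against an arbitrary integrable \<open>\<phi>\<close> (\<open>caputo_mixture\<close>).

  Both come from one identity for the law \<open>\<mu>\<close> of \<open>L(1)\<close>. Its Laplace transform
  \<open>exp (- s\<^sup>\<alpha>)\<close> has derivative \<open>- \<alpha> s\<^bsup>\<alpha>-1\<^esup> exp (- s\<^sup>\<alpha>)\<close>, and \<open>s\<^bsup>\<alpha>-1\<^esup>\<close> is the Laplace transform of
  \<open>x\<^bsup>-\<alpha>\<^esup> / \<Gamma>(1 - \<alpha>)\<close>; by uniqueness of the Laplace transform
  \<open>x \<mu>(dx) = (\<alpha> / \<Gamma>(1 - \<alpha>)) (\<integral>\<^bsub>y<x\<^esub> (x - y)\<^bsup>-\<alpha>\<^esup> \<mu>(dy)) dx\<close>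
  (\<open>nn_integral_mu\<close>). Hence \<open>\<mu>\<close> has a density \<open>g\<close>, and the identity equates the fractional integral of
  \<open>g\<close> with \<open>x g(x) / \<alpha>\<close>. Since \<open>L(u)\<close> has the law of \<open>u\<^bsup>1/\<alpha>\<^esup> L(1)\<close>, scaling
  turns the first into the fractional integral in \<open>t\<close> of the density of \<open>L(u)\<close>, which is the Caputo derivative of
  \<open>P(L(u) \<le> t)\<close>, and the second into minus the derivative of \<open>P(L(u) \<le> t)\<close> in \<open>u\<close>, which is the density of
  \<open>Y(t)\<close>.

  The analysis lies in bounding \<open>g\<close>. The identity expresses \<open>g\<close> by a convolution of \<open>\<mu>\<close> with a singular
  kernel. Inserting it into itself softens the singularity by \<open>1 - \<alpha>\<close> each time, at the price of a
  factor \<open>1/y\<close>, and all negative moments of \<open>\<mu>\<close> are finite; after finitely many rounds \<open>g\<close> is locally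
  bounded (\<open>weighted_frac_bounded\<close>). Splitting the convolution at \<open>x/2\<close> then gives a self-improving
  estimate \<open>g(x) = O(x\<^bsup>-1-\<alpha>\<^esup>)\<close> (\<open>frac_tail_bound\<close>), which amounts to boundedness of \<open>h(t,\<cdot>)\<close>, and bounded \<open>g\<close>
  makes the convolution continuous (\<open>frac_hoelder\<close>).
\<close>

section \<open>Uniqueness of the Laplace transform\<close>

text \<open>On \<open>[0,1]\<close> the moments are bounded by \<open>1\<close>, so the Taylor polynomials of the characteristic
  function converge to it everywhere; the moments therefore determine the characteristic function.\<close>

lemma real_distribution_eqI_moments:
  fixes M1 M2 :: "real measure"
  assumes "real_distribution M1" "real_distribution M2"
    and AE1: "AE x in M1. 0 \<le> x \<and> x \<le> 1" and AE2: "AE x in M2. 0 \<le> x \<and> x \<le> 1"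
    and moments: "\<And>n::nat. (LINT x|M1. x ^ n) = (LINT x|M2. x ^ n)"
  shows "M1 = M2"
proof (rule Levy_uniqueness[OF assms(1,2)], rule ext)
  interpret M1: real_distribution M1 by fact
  interpret M2: real_distribution M2 by fact
  fix t :: real
  have approx: "norm (char M t - (\<Sum>k\<le>n. ((\<i> * t) ^ k / fact k) * (LINT x|M. x ^ k))) \<le> 2 * \<bar>t\<bar> ^ n / fact n"
    if M: "real_distribution M" and AE: "AE x in M. 0 \<le> x \<and> x \<le> 1" for M n
  proof -
    interpret real_distribution M by fact
    have int: "integrable M (\<lambda>x. x ^ k)" for k :: nat
      by (rule integrable_const_bound[where B=1])
         (auto intro: eventually_mono[OF AE] simp: power_le_one)
    have "norm (char M t - (\<Sum>k\<le>n. ((\<i> * t) ^ k / fact k) * (LINT x|M. x ^ k)))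
        \<le> (2 * \<bar>t\<bar> ^ n / fact n) * (LINT x|M. \<bar>x\<bar> ^ n)"
      by (rule char_approx1) (rule int)
    also have "(LINT x|M. \<bar>x\<bar> ^ n) \<le> (LINT x|M. 1)"
      by (rule integral_mono_AE)
         (use integrable_abs[OF int] in \<open>auto intro!: eventually_mono[OF AE] simp: power_le_one power_abs\<close>)
    finally show ?thesis
      using prob_space[unfolded space_eq_univ] by (simp add: mult_left_mono divide_right_mono mult_left_le)
  qed
  have "norm (char M1 t - char M2 t) \<le> 4 * (\<bar>t\<bar> ^ n / fact n)" for n
  proof -
    define S where "S = (\<Sum>k\<le>n. ((\<i> * t) ^ k / fact k) * (LINT x|M1. x ^ k))"
    have "norm (char M1 t - S) \<le> 2 * \<bar>t\<bar> ^ n / fact n"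
      unfolding S_def by (rule approx[OF assms(1) AE1])
    moreover have "norm (char M2 t - S) \<le> 2 * \<bar>t\<bar> ^ n / fact n"
      unfolding S_def moments by (rule approx[OF assms(2) AE2])
    ultimately show ?thesis
      using norm_triangle_ineq4[of "char M1 t - S" "char M2 t - S"] by simp
  qed
  moreover have "(\<lambda>n. 4 * (\<bar>t\<bar> ^ n / fact n)) \<longlonglongrightarrow> 4 * 0"
    using summable_exp_generic[of "\<bar>t\<bar>"]
    by (intro tendsto_intros) (auto dest!: summable_LIMSEQ_zero simp: divide_inverse mult.commute)
  ultimately have "norm (char M1 t - char M2 t) \<le> 4 * 0"
    by (intro LIMSEQ_le_const) auto
  then show "char M1 t = char M2 t" by simp
qed

text \<open>Under \<open>x \<mapsto> exp (- x)\<close> the values of the Laplace transform at the natural numbers become the moments of a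
  measure on \<open>[0,1]\<close>.\<close>

lemma finite_measure_eqI_laplace:
  fixes M1 M2 :: "real measure"
  assumes "finite_measure M1" "finite_measure M2"
    and sets: "sets M1 = sets borel" "sets M2 = sets borel"
    and AE1: "AE x in M1. 0 \<le> x" and AE2: "AE x in M2. 0 \<le> x"
    and laplace: "\<And>n::nat. (\<integral>\<^sup>+x. ennreal (exp (- (real n * x))) \<partial>M1) = (\<integral>\<^sup>+x. ennreal (exp (- (real n * x))) \<partial>M2)"
  shows "M1 = M2"
proof -
  note [measurable_cong] = sets
  have space: "space M1 = UNIV" "space M2 = UNIV"
    using sets by (auto dest: sets_eq_imp_space_eq)
  define c where "c = measure M1 UNIV"
  interpret M1: finite_measure M1 by fact
  interpret M2: finite_measure M2 by fact
  have em: "emeasure M1 UNIV = ennreal c" "emeasure M2 UNIV = ennreal c"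
    using laplace[of 0] by (simp_all add: space c_def M1.emeasure_eq_measure)
  show ?thesis
  proof (cases "c = 0")
    case True
    then have "emeasure M1 A = 0 \<and> emeasure M2 A = 0" for A
      using em emeasure_space[of M1 A] emeasure_space[of M2 A] by (simp add: space)
    then show ?thesis by (intro measure_eqI) (auto simp: sets)
  next
    case False
    then have c: "c > 0" by (simp add: c_def zero_less_measure_iff)
    \<comment> \<open>Normalised to total mass \<open>1\<close>, since characteristic functions are compared for probability measures.\<close>
    define P where "P M = distr (density M (\<lambda>_. ennreal (1 / c))) borel (\<lambda>x. exp (- x))" for M :: "real measure"
    have P: "real_distribution (P M) \<and> (AE x in P M. 0 \<le> x \<and> x \<le> 1) \<and>
        (\<forall>n. (LINT x|P M. x ^ n) = 1 / c * (enn2real (\<integral>\<^sup>+x. ennreal (exp (- (real n * x))) \<partial>M)))"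
      if [measurable_cong]: "sets M = sets borel" and "emeasure M UNIV = ennreal c" and AE: "AE x in M. 0 \<le> x" for M
    proof -
      have sp: "space M = UNIV" using sets_eq_imp_space_eq[OF that(1)] by simp
      have "prob_space (density M (\<lambda>_. ennreal (1 / c)))"
        by (rule prob_spaceI) (use that c sp in \<open>simp add: emeasure_density ennreal_mult[symmetric]\<close>)
      then have p: "prob_space (P M)" unfolding P_def by (rule prob_space.prob_space_distr) simp
      have ae: "AE x in P M. 0 \<le> x \<and> x \<le> 1"
        unfolding P_def using AE by (simp add: AE_distr_iff AE_density) 
      have "(LINT x|P M. x ^ n) = 1 / c * (enn2real (\<integral>\<^sup>+x. ennreal (exp (- (real n * x))) \<partial>M))" for n
      proof -
        have "(LINT x|P M. x ^ n) = (LINT x|M. 1 / c * exp (- (real n * x)))"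
          unfolding P_def using c
          by (simp add: integral_distr integral_density exp_of_nat_mult[symmetric])
        also have "\<dots> = 1 / c * (LINT x|M. exp (- (real n * x)))"
          by simp
        also have "(LINT x|M. exp (- (real n * x))) = enn2real (\<integral>\<^sup>+x. ennreal (exp (- (real n * x))) \<partial>M)"
          by (rule integral_eq_nn_integral) auto
        finally show ?thesis .
      qed
      with p ae show ?thesis by (auto simp: real_distribution_def real_distribution_axioms_def P_def)
    qed
    have eq: "P M1 = P M2"
      using P[OF sets(1) em(1) AE1] P[OF sets(2) em(2) AE2]
      by (intro real_distribution_eqI_moments) (auto simp: laplace)
    have inv: "emeasure M A = c * emeasure (P M) ((\<lambda>x. exp (- x)) ` A)"
      if [measurable_cong]: "sets M = sets borel" and A[measurable]: "A \<in> sets borel" for M A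
    proof -
      have im: "(\<lambda>x. exp (- x)) ` A = {y. 0 < y \<and> - ln y \<in> A}"
        by (force simp: image_iff)
      have m: "(\<lambda>x. exp (- x)) ` A \<in> sets borel" unfolding im by measurable
      have vi: "(\<lambda>x. exp (- x)) -` (\<lambda>x. exp (- x)) ` A = (A :: real set)" by auto
      have sp: "space M = UNIV" using sets_eq_imp_space_eq[OF that(1)] by simp
      have "emeasure (P M) ((\<lambda>x. exp (- x)) ` A) = ennreal (1 / c) * emeasure M A"
        unfolding P_def using m c
        by (simp add: emeasure_distr vi sp emeasure_density nn_integral_cmult that)
      then show ?thesis
        using c by (simp add: mult.assoc[symmetric] ennreal_mult[symmetric])
    qed
    show ?thesis
      by (rule measure_eqI) (use eq in \<open>auto simp: sets inv\<close>)
  qed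
qed

section \<open>The one-sided stable law\<close>

locale stable_law =
  fixes \<alpha> :: real and \<mu> :: "real measure"
  assumes alpha: "0 < \<alpha>" "\<alpha> < 1"
    and prob_mu: "prob_space \<mu>"
    and sets_mu [measurable_cong]: "sets \<mu> = sets borel"
    and nonneg: "AE x in \<mu>. 0 \<le> x"
    and laplace: "\<And>s. 0 \<le> s \<Longrightarrow> (LINT x|\<mu>. exp (- s * x)) = exp (- (s powr \<alpha>))"
begin

sublocale prob_space \<mu> by (rule prob_mu)

lemma space_mu [simp]: "space \<mu> = UNIV"
  using sets_eq_imp_space_eq[OF sets_mu] by simp

lemma integrable_exp: "0 \<le> s \<Longrightarrow> integrable \<mu> (\<lambda>x. exp (- s * x))"
  by (rule integrable_const_bound[where B=1]) (auto intro!: eventually_mono[OF nonneg])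

lemma nn_laplace:
  assumes "0 \<le> s" shows "(\<integral>\<^sup>+x. ennreal (exp (- s * x)) \<partial>\<mu>) = ennreal (exp (- (s powr \<alpha>)))"
  using integrable_exp[OF assms] laplace[OF assms] by (subst nn_integral_eq_integral) auto

text \<open>An atom at \<open>0\<close> would keep the Laplace transform away from \<open>0\<close> as \<open>s\<close> tends to infinity.\<close>

lemma pos: "AE x in \<mu>. 0 < x"
proof -
  have "prob {0} \<le> exp (- (real n powr \<alpha>))" for n
  proof -
    have "prob {0} = (LINT x|\<mu>. indicator {0} x)" by simp
    also have "\<dots> \<le> (LINT x|\<mu>. exp (- real n * x))"
      by (intro integral_mono integrable_exp integrable_real_indicator) (auto simp: indicator_def sets_mu emeasure_eq_measure)
    finally show ?thesis by (simp add: laplace[of "real n", simplified])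
  qed
  moreover have "(\<lambda>n. exp (- (real n powr \<alpha>))) \<longlonglongrightarrow> 0"
    using alpha by real_asymp
  ultimately have "prob {0} \<le> 0" by (intro LIMSEQ_le_const) auto
  then have "{0} \<in> null_sets \<mu>"
    by (auto simp: null_sets_def emeasure_eq_measure sets_mu ennreal_eq_0_iff)
  from AE_not_in[OF this] nonneg show ?thesis by eventually_elim auto
qed

text \<open>The fast decay of the Laplace transform forces very little mass near \<open>0\<close>. A series over
  integer arguments of the transform dominates the moment: for \<open>n = \<lfloor>1/x\<rfloor>\<close> one has \<open>n x \<le> 1\<close>, so the single term
  \<open>e (n + 1)\<^sup>q exp (- n x)\<close> is at least \<open>x\<^bsup>-q\<^esup>\<close>.\<close>

lemma negative_moment_finite: "(\<integral>\<^sup>+x. ennreal (x powr - real q) \<partial>\<mu>) < \<infinity>"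
proof -
  define a where "a n = exp 1 * (real n + 1) ^ q" for n :: nat
  have a: "a n \<ge> 0" for n by (simp add: a_def)
  have pt: "ennreal (x powr - real q) \<le> (\<Sum>n. ennreal (a n * exp (- real n * x)))" if "0 < x" for x
  proof -
    define n where "n = nat \<lfloor>1 / x\<rfloor>"
    have n: "real n \<le> 1 / x" "1 / x \<le> real n + 1"
      using that by (auto simp: n_def)
    have "x powr - real q = (1 / x) ^ q"
      using that by (simp add: powr_minus_divide powr_realpow power_one_over)
    also have "\<dots> \<le> (real n + 1) ^ q"
      using n that by (intro power_mono) auto
    also have "\<dots> \<le> a n * exp (- real n * x)"
    proof -
      have "real n * x \<le> 1" using n that by (simp add: field_simps)
      then have "1 \<le> exp (1 - real n * x)" by simp
      also have "exp (1 - real n * x) = exp 1 * exp (- real n * x)"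
        by (simp add: exp_diff exp_minus field_simps)
      finally show ?thesis
        unfolding a_def by (simp add: mult_le_cancel_left1 mult.assoc mult.left_commute)
    qed
    finally have "ennreal (x powr - real q) \<le> (\<Sum>n\<in>{n}. ennreal (a n * exp (- real n * x)))"
      by (simp add: ennreal_leI)
    also have "\<dots> \<le> (\<Sum>n. ennreal (a n * exp (- real n * x)))"
      by (rule sum_le_suminf) auto
    finally show ?thesis .
  qed
  have "(\<integral>\<^sup>+x. ennreal (x powr - real q) \<partial>\<mu>) \<le> (\<integral>\<^sup>+x. (\<Sum>n. ennreal (a n * exp (- real n * x))) \<partial>\<mu>)"
    by (rule nn_integral_mono_AE) (use pos in eventually_elim, rule pt)
  also have "\<dots> = (\<Sum>n. \<integral>\<^sup>+x. ennreal (a n * exp (- real n * x)) \<partial>\<mu>)"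
    by (rule nn_integral_suminf) simp
  also have "\<dots> = (\<Sum>n. ennreal (a n * exp (- (real n powr \<alpha>))))"
    using a nn_laplace[of "real n" for n]
    by (simp add: ennreal_mult nn_integral_cmult)
  also have "\<dots> < \<infinity>"
  proof -
    \<comment> \<open>\<open>exp (- y) \<le> y\<^bsup>-j\<^esup>\<close> for large \<open>y\<close>; this \<open>j\<close> leaves two powers of \<open>n\<close> for convergence.\<close>
    obtain j :: nat where j: "real j * \<alpha> \<ge> real (q + 2)"
      using alpha reals_Archimedean3[of \<alpha>] by (meson less_eq_real_def)
    have "((\<lambda>n. (real n powr \<alpha>) ^ j / exp (real n powr \<alpha>)) \<longlongrightarrow> 0) sequentially"
      using alpha by (intro filterlim_compose[OF tendsto_power_div_exp_0]) real_asymp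
    then have ev: "eventually (\<lambda>n. (real n powr \<alpha>) ^ j / exp (real n powr \<alpha>) < 1) sequentially"
      by (rule order_tendstoD) simp
    have "eventually (\<lambda>n. norm (a n * exp (- (real n powr \<alpha>))) \<le> exp 1 * 2 ^ q * (1 / real n ^ 2)) sequentially"
      using ev eventually_ge_at_top[of 1]
    proof eventually_elim
      case (elim n)
      then have n: "real n \<ge> 1" by simp
      have "exp (- (real n powr \<alpha>)) \<le> 1 / (real n powr \<alpha>) ^ j"
        using elim n by (simp add: exp_minus field_simps)
      also have "(real n powr \<alpha>) ^ j = real n powr (real j * \<alpha>)"
        using n by (simp add: powr_powr powr_realpow[symmetric] mult.commute)
      also have "1 / real n powr (real j * \<alpha>) \<le> 1 / real n powr (real (q + 2))"
        using n j by (intro divide_left_mono powr_mono mult_pos_pos) auto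
      also have "real n powr (real (q + 2)) = real n ^ q * real n ^ 2"
        using n by (subst powr_realpow) (auto simp: power_add power2_eq_square)
      finally have 1: "exp (- (real n powr \<alpha>)) \<le> 1 / (real n ^ q * real n ^ 2)" .
      have "(real n + 1) ^ q \<le> (2 * real n) ^ q"
        using n by (intro power_mono) auto
      then have 2: "a n \<le> exp 1 * (2 ^ q * real n ^ q)"
        by (simp add: a_def power_mult_distrib)
      have "a n * exp (- (real n powr \<alpha>)) \<le> exp 1 * (2 ^ q * real n ^ q) * (1 / (real n ^ q * real n ^ 2))"
        using 1 2 a by (intro mult_mono) auto
      also have "\<dots> = exp 1 * 2 ^ q * (1 / real n ^ 2)" using n by (simp add: power2_eq_square)
      finally show ?case using a[of n] by simp
    qed
    then have "summable (\<lambda>n. a n * exp (- (real n powr \<alpha>)))"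
      by (rule summable_comparison_test_ev)
        (intro summable_mult, use inverse_power_summable[of 2, where ?'a=real] in \<open>simp add: divide_inverse\<close>)
    then show ?thesis
      using a by (simp add: suminf_ennreal2)
  qed
  finally show ?thesis .
qed

text \<open>Differentiation of the Laplace transform, by dominated convergence of difference quotients.\<close>

lemma nn_integral_x_exp:
  assumes s: "0 < s"
  shows "(\<integral>\<^sup>+x. ennreal (x * exp (- s * x)) \<partial>\<mu>) = ennreal (\<alpha> * s powr (\<alpha> - 1) * exp (- (s powr \<alpha>)))"
proof -
  define h where "h n = inverse (real (Suc n))" for n
  have h: "h n > 0" for n by (simp add: h_def)
  have h0: "filterlim h (at 0) sequentially"
    unfolding filterlim_at h_def using LIMSEQ_inverse_real_of_nat by auto
  \<comment> \<open>Minus the difference quotient, so that it is nonnegative and at most \<open>x exp (- s x)\<close>.\<close>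
  define D where "D n x = - ((exp (- (s + h n) * x) - exp (- s * x)) / h n)" for n x
  have der: "(\<lambda>n. - ((E (s + h n) - E s) / h n)) \<longlonglongrightarrow> - E'" if "(E has_real_derivative E') (at s)" for E E'
    using filterlim_compose[OF that[unfolded DERIV_def] h0] by (intro tendsto_minus)
  have pt: "(\<lambda>n. D n x) \<longlonglongrightarrow> x * exp (- s * x)" for x
    unfolding D_def
  proof -
    have "((\<lambda>s. exp (- s * x)) has_real_derivative - (x * exp (- s * x))) (at s)"
      by (auto intro!: derivative_eq_intros)
    from der[OF this] show "(\<lambda>n. - ((exp (- (s + h n) * x) - exp (- s * x)) / h n)) \<longlonglongrightarrow> x * exp (- s * x)"
      by simp
  qed
  have D0: "0 \<le> D n x" "D n x \<le> x * exp (- s * x)" "x * exp (- s * x) \<le> 1 / s" if "0 \<le> x" for n x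
  proof -
    have eq: "D n x = exp (- s * x) * ((1 - exp (- (h n * x))) / h n)"
      by (simp add: D_def exp_add[symmetric] algebra_simps diff_divide_distrib)
    show "0 \<le> D n x"
      unfolding eq using h[of n] that by (intro mult_nonneg_nonneg divide_nonneg_nonneg) auto
    have "1 - exp (- (h n * x)) \<le> h n * x" using exp_ge_add_one_self[of "- (h n * x)"] by simp
    then have "(1 - exp (- (h n * x))) / h n \<le> x" using h[of n] by (simp add: field_simps)
    from mult_left_mono[OF this, of "exp (- s * x)"] show "D n x \<le> x * exp (- s * x)"
      unfolding eq by (simp add: mult.commute)
    have "s * x \<le> exp (s * x)" using exp_ge_add_one_self[of "s * x"] by linarith
    then show "x * exp (- s * x) \<le> 1 / s" using s by (simp add: exp_minus field_simps)
  qed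
  have D_abs: "\<bar>D n x\<bar> = D n x" if "0 \<le> x" for n x using D0(1)[OF that] by simp
  have D_measurable [measurable]: "D n \<in> borel_measurable \<mu>" for n
    unfolding D_def by measurable
  have int: "integrable \<mu> (\<lambda>x. x * exp (- s * x))"
    by (rule integrable_const_bound[where B="1/s"]) (use D0(3) in \<open>auto intro!: eventually_mono[OF nonneg]\<close>)
  have "(\<lambda>n. LINT x|\<mu>. D n x) \<longlonglongrightarrow> (LINT x|\<mu>. x * exp (- s * x))"
    by (rule integral_dominated_convergence[OF _ _ int])
       (use D0(1,2) pt in \<open>auto intro!: eventually_mono[OF nonneg] simp del: minus_mult_minus
          intro: D_measurable simp: D_abs\<close>)
  moreover have "(LINT x|\<mu>. D n x) = - ((exp (- ((s + h n) powr \<alpha>)) - exp (- (s powr \<alpha>))) / h n)" for n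
    unfolding D_def using s h[of n] integrable_exp[of "s + h n"] integrable_exp[of s] laplace[of "s + h n"] laplace[of s]
    by (simp add: algebra_simps)
  moreover have "(\<lambda>n. - ((exp (- ((s + h n) powr \<alpha>)) - exp (- (s powr \<alpha>))) / h n))
      \<longlonglongrightarrow> - (- (\<alpha> * s powr (\<alpha> - 1) * exp (- (s powr \<alpha>))))"
    by (rule der[of "\<lambda>s. exp (- (s powr \<alpha>))"]) (use s in \<open>auto intro!: derivative_eq_intros\<close>)
  ultimately have "(LINT x|\<mu>. x * exp (- s * x)) = \<alpha> * s powr (\<alpha> - 1) * exp (- (s powr \<alpha>))"
    by (auto intro: LIMSEQ_unique)
  with int show ?thesis
    by (subst nn_integral_eq_integral) (auto intro!: eventually_mono[OF nonneg])
qed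

text \<open>\<open>\<Gamma>(1 - \<alpha>)\<close> times the Riemann-Liouville fractional integral of order \<open>1 - \<alpha>\<close> of the measure \<open>\<mu>\<close>. The
  value is extended because finiteness is only established later, by \<open>frac_nn_eq_frac\<close>.\<close>

definition frac_nn :: "real \<Rightarrow> ennreal" where
  "frac_nn x = (\<integral>\<^sup>+y. (if 0 < y \<and> y < x then ennreal ((x - y) powr - \<alpha>) else 0) \<partial>\<mu>)"

lemma measurable_frac_nn [measurable]: "frac_nn \<in> borel_measurable borel"
  unfolding frac_nn_def by measurable

lemma frac_nn_eq_0: "x \<le> 0 \<Longrightarrow> frac_nn x = 0"
  unfolding frac_nn_def by (subst nn_integral_0_iff_AE) auto

lemma nn_integral_gamma_kernel:
  assumes s: "0 < s"
  shows "(\<integral>\<^sup>+z. (if 0 < z then ennreal (exp (- s * z) * z powr - \<alpha>) else 0) \<partial>lborel)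
    = ennreal (Gamma (1 - \<alpha>) * s powr (\<alpha> - 1))" (is "?I = _")
proof -
  have "ennreal (Gamma (1 - \<alpha>)) = (\<integral>\<^sup>+t. ennreal (indicator {0..} t * t powr (1 - \<alpha> - 1) / exp t) \<partial>lborel)"
    using alpha by (intro Gamma_conv_nn_integral_real) auto
  also have "\<dots> = ennreal \<bar>s\<bar> * (\<integral>\<^sup>+z. ennreal (indicator {0..} (0 + s * z) * (0 + s * z) powr (1 - \<alpha> - 1) / exp (0 + s * z)) \<partial>lborel)"
    using s by (intro nn_integral_real_affine) auto
  also have "(\<integral>\<^sup>+z. ennreal (indicator {0..} (0 + s * z) * (0 + s * z) powr (1 - \<alpha> - 1) / exp (0 + s * z)) \<partial>lborel)
      = (\<integral>\<^sup>+z. ennreal (s powr - \<alpha>) * (if 0 < z then ennreal (exp (- s * z) * z powr - \<alpha>) else 0) \<partial>lborel)"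
    using s by (intro nn_integral_cong)
      (auto simp: powr_mult ennreal_mult[symmetric] exp_minus divide_inverse mult_ac zero_le_mult_iff indicator_def)
  also have "\<dots> = ennreal (s powr - \<alpha>) * ?I"
    by (rule nn_integral_cmult) auto
  finally have *: "ennreal (Gamma (1 - \<alpha>)) = ennreal (s powr (1 - \<alpha>)) * ?I"
    using s by (simp add: mult.assoc[symmetric] ennreal_mult[symmetric] powr_diff powr_minus divide_inverse)
  have "?I = ennreal (s powr (\<alpha> - 1)) * (ennreal (s powr (1 - \<alpha>)) * ?I)"
    using s by (simp add: mult.assoc[symmetric] ennreal_mult[symmetric] powr_add[symmetric])
  then show ?thesis
    unfolding *[symmetric] using alpha Gamma_real_pos[of "1 - \<alpha>"] by (simp add: ennreal_mult[symmetric] mult.commute)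
qed

lemma nn_integral_exp_frac_nn:
  assumes s: "0 < s"
  shows "(\<integral>\<^sup>+x. ennreal (exp (- s * x)) * frac_nn x \<partial>lborel)
    = ennreal (Gamma (1 - \<alpha>) * s powr (\<alpha> - 1) * exp (- (s powr \<alpha>)))"
proof -
  interpret pair_sigma_finite lborel \<mu> ..
  have "(\<integral>\<^sup>+x. ennreal (exp (- s * x)) * frac_nn x \<partial>lborel)
    = (\<integral>\<^sup>+x. \<integral>\<^sup>+y. ennreal (exp (- s * x)) * (if 0 < y \<and> y < x then ennreal ((x - y) powr - \<alpha>) else 0) \<partial>\<mu> \<partial>lborel)"
    unfolding frac_nn_def by (simp add: nn_integral_cmult)
  also have "\<dots> = (\<integral>\<^sup>+y. \<integral>\<^sup>+x. ennreal (exp (- s * x)) * (if 0 < y \<and> y < x then ennreal ((x - y) powr - \<alpha>) else 0) \<partial>lborel \<partial>\<mu>)"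
    by (rule Fubini'[symmetric]) measurable
  also have "\<dots> = (\<integral>\<^sup>+y. ennreal (exp (- s * y)) * ennreal (Gamma (1 - \<alpha>) * s powr (\<alpha> - 1)) \<partial>\<mu>)"
  proof (rule nn_integral_cong_AE, use pos in eventually_elim)
    fix y :: real assume "0 < y"
    have "(\<integral>\<^sup>+x. ennreal (exp (- s * x)) * (if 0 < y \<and> y < x then ennreal ((x - y) powr - \<alpha>) else 0) \<partial>lborel)
      = ennreal \<bar>1\<bar> * (\<integral>\<^sup>+x. ennreal (exp (- s * (y + 1 * x))) * (if 0 < y \<and> y < y + 1 * x then ennreal ((y + 1 * x - y) powr - \<alpha>) else 0) \<partial>lborel)"
      by (rule nn_integral_real_affine) auto
    also have "\<dots> = (\<integral>\<^sup>+z. ennreal (exp (- s * y)) * (if 0 < z then ennreal (exp (- s * z) * z powr - \<alpha>) else 0) \<partial>lborel)"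
      using \<open>0 < y\<close> by (auto intro!: nn_integral_cong simp: ennreal_mult[symmetric] exp_add[symmetric] exp_diff algebra_simps
        simp flip: exp_add) 
    also have "\<dots> = ennreal (exp (- s * y)) * ennreal (Gamma (1 - \<alpha>) * s powr (\<alpha> - 1))"
      unfolding nn_integral_gamma_kernel[OF s, symmetric] by (rule nn_integral_cmult) auto
    finally show "(\<integral>\<^sup>+x. ennreal (exp (- s * x)) * (if 0 < y \<and> y < x then ennreal ((x - y) powr - \<alpha>) else 0) \<partial>lborel) = \<dots>" .
  qed
  also have "\<dots> = ennreal (exp (- (s powr \<alpha>))) * ennreal (Gamma (1 - \<alpha>) * s powr (\<alpha> - 1))"
    using nn_laplace[of s] s by (simp add: nn_integral_multc)
  finally show ?thesis
    using alpha Gamma_real_pos[of "1 - \<alpha>"] by (simp add: ennreal_mult[symmetric] mult_ac)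
qed

definition norm_const :: real where "norm_const = \<alpha> / Gamma (1 - \<alpha>)"

lemma norm_const_pos: "0 < norm_const"
  using alpha Gamma_real_pos[of "1 - \<alpha>"] by (simp add: norm_const_def)

text \<open>The defining identity of the stable density, \<open>x \<mu>(dx) = norm_const * frac_nn x dx\<close>. Neither side is a
  finite measure, since \<open>\<mu>\<close> has infinite mean; the weight \<open>exp (- x)\<close> makes both finite, and their Laplace
  transforms at \<open>n\<close> are then the ones at \<open>n + 1\<close> computed above.\<close>

lemma nn_integral_mu:
  assumes [measurable]: "f \<in> borel_measurable borel"
  shows "(\<integral>\<^sup>+x. f x \<partial>\<mu>) = (\<integral>\<^sup>+x. f x * (ennreal (norm_const / x) * frac_nn x) \<partial>lborel)"
proof -
  define M1 where "M1 = density \<mu> (\<lambda>x. ennreal (x * exp (- x)))"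
  define M2 where "M2 = density lborel (\<lambda>x. ennreal (norm_const * exp (- x)) * frac_nn x)"
  have Gpos: "Gamma (1 - \<alpha>) > 0" using alpha by (intro Gamma_real_pos) auto
  have L1: "(\<integral>\<^sup>+x. ennreal (exp (- (real n * x))) \<partial>M1)
      = ennreal (\<alpha> * (real n + 1) powr (\<alpha> - 1) * exp (- ((real n + 1) powr \<alpha>)))" for n
  proof -
    have "(\<integral>\<^sup>+x. ennreal (exp (- (real n * x))) \<partial>M1) = (\<integral>\<^sup>+x. ennreal (x * exp (- (real n + 1) * x)) \<partial>\<mu>)"
      unfolding M1_def
      by (subst nn_integral_density)
         (auto intro!: nn_integral_cong_AE eventually_mono[OF nonneg]
           simp: ennreal_mult[symmetric] exp_add[symmetric] algebra_simps)
    then show ?thesis using nn_integral_x_exp[of "real n + 1"] by simp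
  qed
  have L2: "(\<integral>\<^sup>+x. ennreal (exp (- (real n * x))) \<partial>M2)
      = ennreal (\<alpha> * (real n + 1) powr (\<alpha> - 1) * exp (- ((real n + 1) powr \<alpha>)))" for n
  proof -
    have "(\<integral>\<^sup>+x. ennreal (exp (- (real n * x))) \<partial>M2) = (\<integral>\<^sup>+x. ennreal norm_const * (ennreal (exp (- (real n + 1) * x)) * frac_nn x) \<partial>lborel)"
    proof -
      have "ennreal (norm_const * exp (- x)) * frac_nn x * ennreal (exp (- (real n * x)))
          = ennreal norm_const * (ennreal (exp (- (real n + 1) * x)) * frac_nn x)" for x
      proof -
        have "ennreal (exp (- (real n + 1) * x)) = ennreal (exp (- x)) * ennreal (exp (- (real n * x)))"
          by (simp add: ennreal_mult[symmetric] exp_add[symmetric] algebra_simps)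
        moreover have "ennreal (norm_const * exp (- x)) = ennreal norm_const * ennreal (exp (- x))"
          using norm_const_pos by (simp add: ennreal_mult)
        ultimately show ?thesis by (simp only: mult_ac)
      qed
      then show ?thesis
        unfolding M2_def by (subst nn_integral_density) auto
    qed
    also have "\<dots> = ennreal norm_const * (\<integral>\<^sup>+x. ennreal (exp (- (real n + 1) * x)) * frac_nn x \<partial>lborel)"
      by (rule nn_integral_cmult) auto
    also have "\<dots> = ennreal norm_const * ennreal (Gamma (1 - \<alpha>) * (real n + 1) powr (\<alpha> - 1) * exp (- ((real n + 1) powr \<alpha>)))"
      by (subst nn_integral_exp_frac_nn) auto
    finally show ?thesis using Gpos alpha by (simp add: norm_const_def ennreal_mult[symmetric])
  qed
  have "M1 = M2"
  proof (rule finite_measure_eqI_laplace)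
    show "finite_measure M1" by (rule finite_measureI) (use L1[of 0] in \<open>simp add: M1_def\<close>)
    show "finite_measure M2" by (rule finite_measureI) (use L2[of 0] in \<open>simp add: M2_def\<close>)
    show "AE x in M1. 0 \<le> x" unfolding M1_def using nonneg by (auto simp: AE_density elim!: eventually_mono)
    have "0 < ennreal (norm_const * exp (- x)) * frac_nn x \<Longrightarrow> 0 \<le> x" for x
      using frac_nn_eq_0[of x] by (cases "0 \<le> x") auto
    then show "AE x in M2. 0 \<le> x" unfolding M2_def
      by (auto simp: AE_density)
  qed (auto simp: M1_def M2_def sets_mu L1[unfolded M1_def] L2[unfolded M2_def])
  have "(\<integral>\<^sup>+x. f x \<partial>\<mu>) = (\<integral>\<^sup>+x. ennreal (x * exp (- x)) * (f x * ennreal (exp x / x)) \<partial>\<mu>)"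
    by (intro nn_integral_cong_AE, use pos in eventually_elim)
       (simp add: mult.left_commute[of _ "f _"] ennreal_mult[symmetric] exp_minus)
  also have "\<dots> = (\<integral>\<^sup>+x. f x * ennreal (exp x / x) \<partial>M1)"
    unfolding M1_def by (rule nn_integral_density[symmetric]) auto
  also have "\<dots> = (\<integral>\<^sup>+x. (ennreal (norm_const * exp (- x)) * frac_nn x) * (f x * ennreal (exp x / x)) \<partial>lborel)"
    unfolding \<open>M1 = M2\<close> unfolding M2_def by (rule nn_integral_density) auto
  also have "\<dots> = (\<integral>\<^sup>+x. f x * (ennreal (norm_const / x) * frac_nn x) \<partial>lborel)"
  proof (rule nn_integral_cong)
    fix x :: real
    show "ennreal (norm_const * exp (- x)) * frac_nn x * (f x * ennreal (exp x / x)) = f x * (ennreal (norm_const / x) * frac_nn x)"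
    proof (cases "0 < x")
      case True
      have "ennreal (norm_const * exp (- x)) * frac_nn x * (f x * ennreal (exp x / x))
        = f x * ((ennreal (norm_const * exp (- x)) * ennreal (exp x / x)) * frac_nn x)" by (simp add: mult_ac)
      also have "ennreal (norm_const * exp (- x)) * ennreal (exp x / x) = ennreal (norm_const / x)"
        using True norm_const_pos by (simp add: ennreal_mult[symmetric] exp_minus)
      finally show ?thesis .
    qed (simp add: frac_nn_eq_0)
  qed
  finally show ?thesis .
qed

end

section \<open>Bounds for the stable density\<close>

lemma Beta_real_pos: "0 < a \<Longrightarrow> 0 < b \<Longrightarrow> 0 < Beta a (b::real)"
  by (simp add: Beta_def Gamma_real_pos)

text \<open>The Beta integral over \<open>(r, x)\<close>. It makes the composition of two power kernels less singular than either.\<close>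

lemma nn_integral_beta_kernel:
  fixes r x a b :: real
  assumes "a < 1" "b < 1" "r < x"
  shows "(\<integral>\<^sup>+y. (if r < y \<and> y < x then ennreal ((y - r) powr - a * (x - y) powr - b) else 0) \<partial>lborel)
    = ennreal (Beta (1 - a) (1 - b) * (x - r) powr (1 - a - b))"
proof -
  have "((\<lambda>t. t powr (1 - a - 1) * (1 - t) powr (1 - b - 1)) has_integral Beta (1 - a) (1 - b)) {0<..<1}"
    using has_integral_Beta_real[of "1 - a" "1 - b"] assms by (simp add: has_integral_Icc_iff_Ioo)
  note H = nn_integral_has_integral_lebesgue[OF _ this]
  have B: "ennreal (Beta (1 - a) (1 - b)) =
      (\<integral>\<^sup>+t. ennreal (t powr - a * (1 - t) powr - b) * indicator {0<..<1} t \<partial>lborel)"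
    by (subst H[symmetric]) (auto intro!: nn_integral_cong simp: indicator_def)
  have "(\<integral>\<^sup>+y. (if r < y \<and> y < x then ennreal ((y - r) powr - a * (x - y) powr - b) else 0) \<partial>lborel)
    = ennreal \<bar>x - r\<bar> * (\<integral>\<^sup>+t. (if r < r + (x - r) * t \<and> r + (x - r) * t < x
        then ennreal ((r + (x - r) * t - r) powr - a * (x - (r + (x - r) * t)) powr - b) else 0) \<partial>lborel)"
    using assms by (intro nn_integral_real_affine) auto
  also have "(\<integral>\<^sup>+t. (if r < r + (x - r) * t \<and> r + (x - r) * t < x
        then ennreal ((r + (x - r) * t - r) powr - a * (x - (r + (x - r) * t)) powr - b) else 0) \<partial>lborel)
     = (\<integral>\<^sup>+t. ennreal ((x - r) powr (- a - b)) * (ennreal (t powr - a * (1 - t) powr - b) * indicator {0<..<1} t) \<partial>lborel)"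
  proof (rule nn_integral_cong)
    fix t
    have 1: "r + (x - r) * t < x \<longleftrightarrow> t < 1"
    proof -
      have "r + (x - r) * t < x \<longleftrightarrow> (x - r) * t < (x - r) * 1" by auto
      also have "\<dots> \<longleftrightarrow> t < 1" using assms by (subst mult_less_cancel_left_pos) auto
      finally show ?thesis .
    qed
    have 2: "r < r + (x - r) * t \<longleftrightarrow> 0 < t" using assms by (simp add: zero_less_mult_iff)
    have 3: "x - (r + (x - r) * t) = (x - r) * (1 - t)" by (simp add: algebra_simps)
    have 4: "(x - r) powr (- a - b) = (x - r) powr - a * (x - r) powr - b"
      by (simp add: powr_add[symmetric])
    show "(if r < r + (x - r) * t \<and> r + (x - r) * t < x
        then ennreal ((r + (x - r) * t - r) powr - a * (x - (r + (x - r) * t)) powr - b) else 0)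
      = ennreal ((x - r) powr (- a - b)) * (ennreal (t powr - a * (1 - t) powr - b) * indicator {0<..<1} t)"
      unfolding 1 2 3 4 using assms
      by (auto simp: powr_mult ennreal_mult[symmetric] indicator_def mult_ac)
  qed
  also have "\<dots> = ennreal ((x - r) powr (- a - b)) * ennreal (Beta (1 - a) (1 - b))"
    unfolding B by (rule nn_integral_cmult) auto
  finally show ?thesis
    using assms Beta_real_pos[of "1 - a" "1 - b"]
    by (simp add: ennreal_mult[symmetric] mult_ac powr_diff powr_minus divide_simps)
       
qed

context stable_law
begin

text \<open>The quantity that is improved by the bootstrap: the singularity \<open>\<beta>\<close> of the kernel is traded against the
  weight \<open>y\<^bsup>-q\<^esup>\<close>.\<close>

definition weighted_frac :: "nat \<Rightarrow> real \<Rightarrow> real \<Rightarrow> ennreal" where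
  "weighted_frac q \<beta> x = (\<integral>\<^sup>+y. (if 0 < y \<and> y < x then ennreal ((x - y) powr - \<beta> * y powr - real q) else 0) \<partial>\<mu>)"

text \<open>Replace \<open>\<mu>\<close> by its density, which is itself a convolution with a kernel of singularity \<open>\<alpha>\<close>. By Tonelli and
  the Beta integral the two kernels combine to one of singularity \<open>\<alpha> + \<beta> + \<delta> - 1 \<le> \<beta>\<close>, and the factor \<open>1/y\<close> of
  the density, at most \<open>1/r\<close> for \<open>y > r\<close>, raises \<open>q\<close> by one.\<close>

lemma weighted_frac_step:
  assumes \<beta>: "0 \<le> \<beta>" "\<beta> + \<delta> < 1" and \<delta>: "\<delta> \<le> 1 - \<alpha>" and x: "x \<le> X" and X: "0 < X"
  shows "weighted_frac q (\<beta> + \<delta>) x \<le> ennreal (norm_const * Beta (1 - \<alpha>) (1 - (\<beta> + \<delta>)) * X powr (1 - \<alpha> - \<delta>)) * weighted_frac (Suc q) \<beta> x"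
proof -
  interpret pair_sigma_finite lborel \<mu> ..
  have Bpos: "Beta (1 - \<alpha>) (1 - (\<beta> + \<delta>)) > 0"
    using alpha \<beta> by (intro Beta_real_pos) auto
  let ?g = "\<lambda>y. (if 0 < y \<and> y < x then ennreal ((x - y) powr - (\<beta> + \<delta>) * y powr - real q) else 0)"
  let ?h = "\<lambda>y r. ?g y * (ennreal (norm_const / y) * (if 0 < r \<and> r < y then ennreal ((y - r) powr - \<alpha>) else 0))"
  have "weighted_frac q (\<beta> + \<delta>) x = (\<integral>\<^sup>+y. ?g y * (ennreal (norm_const / y) * frac_nn y) \<partial>lborel)"
    unfolding weighted_frac_def by (rule nn_integral_mu) simp
  also have "\<dots> = (\<integral>\<^sup>+y. \<integral>\<^sup>+r. ?h y r \<partial>\<mu> \<partial>lborel)"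
    unfolding frac_nn_def by (simp add: nn_integral_cmult)
  also have "\<dots> = (\<integral>\<^sup>+r. \<integral>\<^sup>+y. ?h y r \<partial>lborel \<partial>\<mu>)"
    by (rule Fubini'[symmetric]) measurable
  also have "\<dots> \<le> (\<integral>\<^sup>+r. ennreal (norm_const * Beta (1 - \<alpha>) (1 - (\<beta> + \<delta>)) * X powr (1 - \<alpha> - \<delta>)) *
      (if 0 < r \<and> r < x then ennreal ((x - r) powr - \<beta> * r powr - real (Suc q)) else 0) \<partial>\<mu>)"
  proof (rule nn_integral_mono)
    fix r
    show "(\<integral>\<^sup>+y. ?h y r \<partial>lborel) \<le> ennreal (norm_const * Beta (1 - \<alpha>) (1 - (\<beta> + \<delta>)) * X powr (1 - \<alpha> - \<delta>)) *
      (if 0 < r \<and> r < x then ennreal ((x - r) powr - \<beta> * r powr - real (Suc q)) else 0)"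
    proof (cases "0 < r \<and> r < x")
      case False
      then have "(\<integral>\<^sup>+y. ?h y r \<partial>lborel) = (\<integral>\<^sup>+(y::real). 0 \<partial>lborel)"
        by (intro nn_integral_cong) auto
      then show ?thesis by (simp only: nn_integral_const mult_zero_left zero_le)
    next
      case True
      have "?h y r \<le> ennreal (norm_const * r powr - real (Suc q)) *
          (if r < y \<and> y < x then ennreal ((y - r) powr - \<alpha> * (x - y) powr - (\<beta> + \<delta>)) else 0)" for y
      proof (cases "r < y \<and> y < x")
        case y: True
        have "y powr - real q / y = y powr - real (Suc q)"
        proof -
          have "- real (Suc q) = - real q - 1" by simp
          then show ?thesis using y True powr_diff[of y "- real q" 1] by (simp only:) simp
        qed
        also have "\<dots> \<le> r powr - real (Suc q)"
          using y True by (intro powr_mono2') auto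
        finally have le: "y powr - real q / y \<le> r powr - real (Suc q)" .
        have "?h y r = ennreal ((norm_const * (y powr - real q / y)) * ((y - r) powr - \<alpha> * (x - y) powr - (\<beta> + \<delta>)))"
          using y True norm_const_pos by (simp add: ennreal_mult[symmetric] mult_ac)
        also have "\<dots> \<le> ennreal ((norm_const * r powr - real (Suc q)) * ((y - r) powr - \<alpha> * (x - y) powr - (\<beta> + \<delta>)))"
          using norm_const_pos le by (intro ennreal_leI mult_right_mono mult_left_mono) auto
        also have "\<dots> = ennreal (norm_const * r powr - real (Suc q)) *
          (if r < y \<and> y < x then ennreal ((y - r) powr - \<alpha> * (x - y) powr - (\<beta> + \<delta>)) else 0)"
          using norm_const_pos y by (simp add: ennreal_mult[symmetric])
        finally show ?thesis .
      qed auto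
      then have "(\<integral>\<^sup>+y. ?h y r \<partial>lborel) \<le> (\<integral>\<^sup>+y. ennreal (norm_const * r powr - real (Suc q)) *
          (if r < y \<and> y < x then ennreal ((y - r) powr - \<alpha> * (x - y) powr - (\<beta> + \<delta>)) else 0) \<partial>lborel)"
        by (rule nn_integral_mono)
      also have "\<dots> = ennreal (norm_const * r powr - real (Suc q)) *
          ennreal (Beta (1 - \<alpha>) (1 - (\<beta> + \<delta>)) * (x - r) powr (1 - \<alpha> - (\<beta> + \<delta>)))"
        using alpha \<beta> True by (subst nn_integral_cmult) (simp_all only: nn_integral_beta_kernel, simp)
      also have "\<dots> \<le> ennreal (norm_const * r powr - real (Suc q)) *
          ennreal (Beta (1 - \<alpha>) (1 - (\<beta> + \<delta>)) * (X powr (1 - \<alpha> - \<delta>) * (x - r) powr - \<beta>))"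
      proof -
        have "(x - r) powr (1 - \<alpha> - (\<beta> + \<delta>)) = (x - r) powr (1 - \<alpha> - \<delta>) * (x - r) powr - \<beta>"
          unfolding powr_add[symmetric] by (rule arg_cong[where f="\<lambda>e. (x - r) powr e"]) simp
        also have "\<dots> \<le> X powr (1 - \<alpha> - \<delta>) * (x - r) powr - \<beta>"
          using True x \<delta> by (intro mult_right_mono powr_mono2) auto
        finally show ?thesis
          using Bpos by (intro mult_left_mono ennreal_leI) auto
      qed
      also have "\<dots> = ennreal (norm_const * Beta (1 - \<alpha>) (1 - (\<beta> + \<delta>)) * X powr (1 - \<alpha> - \<delta>)) *
        (if 0 < r \<and> r < x then ennreal ((x - r) powr - \<beta> * r powr - real (Suc q)) else 0)"
        using True norm_const_pos Bpos by (simp add: ennreal_mult[symmetric] mult_ac)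
      finally show ?thesis .
    qed
  qed
  also have "\<dots> = ennreal (norm_const * Beta (1 - \<alpha>) (1 - (\<beta> + \<delta>)) * X powr (1 - \<alpha> - \<delta>)) * weighted_frac (Suc q) \<beta> x"
    unfolding weighted_frac_def by (rule nn_integral_cmult) auto
  finally show ?thesis .
qed

text \<open>For \<open>\<beta> = 0\<close> this is a negative moment. Finitely many steps of a length \<open>\<delta> \<le> 1 - \<alpha>\<close> that divides
  \<open>\<alpha>\<close> reach \<open>\<beta> = \<alpha>\<close>.\<close>

lemma weighted_frac_bounded: "\<exists>C\<ge>0. \<forall>x\<le>X. weighted_frac q \<alpha> x \<le> ennreal C"
proof -
  obtain n :: nat where n: "\<alpha> \<le> real n * (1 - \<alpha>)"
    using alpha reals_Archimedean3[of "1 - \<alpha>"] by (meson diff_gt_0_iff_gt less_eq_real_def)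
  then have n0: "n > 0" using alpha by (cases n) auto
  define \<delta> where "\<delta> = \<alpha> / real n"
  have \<delta>: "0 < \<delta>" "\<delta> \<le> 1 - \<alpha>" "real n * \<delta> = \<alpha>"
    using n n0 alpha by (auto simp: \<delta>_def field_simps)
  have "\<exists>C\<ge>0. \<forall>x\<le>X. weighted_frac q (real j * \<delta>) x \<le> ennreal C" if "j \<le> n" for j q
    using that
  proof (induction j arbitrary: q)
    case 0
    have "weighted_frac q 0 x \<le> (\<integral>\<^sup>+y. ennreal (y powr - real q) \<partial>\<mu>)" for x
      unfolding weighted_frac_def by (rule nn_integral_mono) auto
    moreover obtain C where "C \<ge> 0" "(\<integral>\<^sup>+y. ennreal (y powr - real q) \<partial>\<mu>) = ennreal C"
      using negative_moment_finite[of q] by (cases "\<integral>\<^sup>+y. ennreal (y powr - real q) \<partial>\<mu>") auto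
    ultimately show ?case by (auto intro!: exI[of _ C])
  next
    case (Suc j)
    then obtain C where C: "C \<ge> 0" "\<And>x. x \<le> X \<Longrightarrow> weighted_frac (Suc q) (real j * \<delta>) x \<le> ennreal C"
      using Suc.IH[of "Suc q"] by auto
    have "real (Suc j) * \<delta> \<le> real n * \<delta>" using Suc.prems \<delta> by (intro mult_right_mono) auto
    then have j: "real j * \<delta> + \<delta> < 1" using \<delta> alpha by (simp add: algebra_simps)
    define D where "D = norm_const * Beta (1 - \<alpha>) (1 - (real j * \<delta> + \<delta>)) * max 1 X powr (1 - \<alpha> - \<delta>)"
    have D: "D \<ge> 0"
      using norm_const_pos Beta_real_pos[of "1 - \<alpha>" "1 - (real j * \<delta> + \<delta>)"] alpha j by (simp add: D_def)
    have "weighted_frac q (real (Suc j) * \<delta>) x \<le> ennreal (D * C)" if "x \<le> X" for x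
    proof -
      have "weighted_frac q (real (Suc j) * \<delta>) x = weighted_frac q (real j * \<delta> + \<delta>) x" by (simp add: algebra_simps)
      also have "\<dots> \<le> ennreal D * weighted_frac (Suc q) (real j * \<delta>) x"
        unfolding D_def using \<delta> j that by (intro weighted_frac_step) auto
      also have "\<dots> \<le> ennreal D * ennreal C"
        using C that by (intro mult_left_mono) auto
      finally show ?thesis using D C by (simp add: ennreal_mult)
    qed
    then show ?case using D C by (intro exI[of _ "D * C"]) auto
  qed
  from this[of n q] show ?thesis using \<delta> by simp
qed

lemma frac_nn_le: "frac_nn x \<le> ennreal x * weighted_frac 1 \<alpha> x"
proof (cases "0 < x")
  case True
  have "frac_nn x \<le> (\<integral>\<^sup>+y. ennreal x * (if 0 < y \<and> y < x then ennreal ((x - y) powr - \<alpha> * y powr - real 1) else 0) \<partial>\<mu>)"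
    unfolding frac_nn_def
  proof (rule nn_integral_mono)
    fix y
    show "(if 0 < y \<and> y < x then ennreal ((x - y) powr - \<alpha>) else 0)
      \<le> ennreal x * (if 0 < y \<and> y < x then ennreal ((x - y) powr - \<alpha> * y powr - real 1) else 0)"
    proof (cases "0 < y \<and> y < x")
      case y: True
      have "(x - y) powr - \<alpha> * 1 \<le> (x - y) powr - \<alpha> * (x / y)"
        using y by (intro mult_left_mono) auto
      then show ?thesis
        using y by (simp add: ennreal_mult[symmetric] powr_minus_divide)
    qed auto
  qed
  also have "\<dots> = ennreal x * weighted_frac 1 \<alpha> x"
    unfolding weighted_frac_def by (rule nn_integral_cmult) auto
  finally show ?thesis .
qed (simp add: frac_nn_eq_0)

text \<open>Finite by \<open>frac_local_bound\<close>; the value at infinity in \<open>enn2real\<close> never occurs.\<close>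

definition frac :: "real \<Rightarrow> real" where "frac x = enn2real (frac_nn x)"

definition dens :: "real \<Rightarrow> real" where "dens x = norm_const / x * frac x"

lemma frac_nonneg: "0 \<le> frac x" by (simp add: frac_def)

lemma frac_eq_0: "x \<le> 0 \<Longrightarrow> frac x = 0" by (simp add: frac_def frac_nn_eq_0)

lemma dens_nonneg: "0 \<le> dens x"
  using frac_nonneg[of x] norm_const_pos frac_eq_0[of x] by (cases "0 < x") (auto simp: dens_def)

lemma dens_eq_0: "x \<le> 0 \<Longrightarrow> dens x = 0" by (simp add: dens_def frac_eq_0)

lemma measurable_frac [measurable]: "frac \<in> borel_measurable borel"
  unfolding frac_def by measurable

lemma measurable_dens [measurable]: "dens \<in> borel_measurable borel"
  unfolding dens_def by measurable

lemma frac_local_bound: "\<exists>C\<ge>0. \<forall>x\<le>X. frac_nn x \<le> ennreal (x * C)"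
proof -
  obtain C where C: "C \<ge> 0" "\<forall>x\<le>X. weighted_frac 1 \<alpha> x \<le> ennreal C" using weighted_frac_bounded by blast
  have "frac_nn x \<le> ennreal (x * C)" if "x \<le> X" for x
  proof (cases "0 < x")
    case True
    have "frac_nn x \<le> ennreal x * weighted_frac 1 \<alpha> x" by (rule frac_nn_le)
    also have "\<dots> \<le> ennreal x * ennreal C" using C that by (intro mult_left_mono) auto
    finally show ?thesis using True C by (simp add: ennreal_mult)
  qed (simp add: frac_nn_eq_0)
  with C(1) show ?thesis by auto
qed

lemma frac_nn_eq_frac: "frac_nn x = ennreal (frac x)"
proof -
  obtain C where "frac_nn x \<le> ennreal (x * C)" using frac_local_bound[of x] by auto
  then have "frac_nn x < \<top>" by (rule le_less_trans) simp
  then show ?thesis by (simp add: frac_def)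
qed

lemma dens_local_bound: "\<exists>C\<ge>0. \<forall>x\<le>X. dens x \<le> C"
proof -
  obtain C where C: "C \<ge> 0" "\<forall>x\<le>X. frac_nn x \<le> ennreal (x * C)" using frac_local_bound by blast
  have "dens x \<le> norm_const * C" if "x \<le> X" for x
  proof (cases "0 < x")
    case True
    have "ennreal (frac x) \<le> ennreal (x * C)" using C that by (simp add: frac_nn_eq_frac)
    then have "frac x \<le> x * C" using C True by (subst (asm) ennreal_le_iff) auto
    then show ?thesis using True norm_const_pos by (simp add: dens_def field_simps)
  qed (use norm_const_pos C in \<open>simp add: dens_eq_0\<close>)
  then show ?thesis using C norm_const_pos by (intro exI[of _ "norm_const * C"]) auto
qed

lemma nn_integral_mu_dens:
  assumes [measurable]: "f \<in> borel_measurable borel"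
  shows "(\<integral>\<^sup>+x. f x \<partial>\<mu>) = (\<integral>\<^sup>+x. f x * ennreal (dens x) \<partial>lborel)"
proof -
  have "ennreal (norm_const / x) * frac_nn x = ennreal (dens x)" for x
    using norm_const_pos frac_nonneg[of x] frac_eq_0[of x]
    by (cases "0 < x") (auto simp: dens_def frac_nn_eq_frac ennreal_mult[symmetric])
  then show ?thesis by (simp add: nn_integral_mu)
qed

lemma nn_integral_power_kernel:
  assumes "r < x"
  shows "(\<integral>\<^sup>+y. (if r < y \<and> y < x then ennreal ((x - y) powr - \<alpha>) else 0) \<partial>lborel)
    = ennreal (Beta 1 (1 - \<alpha>) * (x - r) powr (1 - \<alpha>))"
proof -
  have "(\<integral>\<^sup>+y. (if r < y \<and> y < x then ennreal ((x - y) powr - \<alpha>) else 0) \<partial>lborel)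
    = (\<integral>\<^sup>+y. (if r < y \<and> y < x then ennreal ((y - r) powr - 0 * (x - y) powr - \<alpha>) else 0) \<partial>lborel)"
    by (intro nn_integral_cong) auto
  also have "\<dots> = ennreal (Beta (1 - 0) (1 - \<alpha>) * (x - r) powr (1 - 0 - \<alpha>))"
    using assms alpha by (intro nn_integral_beta_kernel) auto
  finally show ?thesis by simp
qed

definition beta_const :: real where "beta_const = Beta 1 (1 - \<alpha>)"

lemma beta_const_pos: "0 < beta_const" unfolding beta_const_def using alpha by (intro Beta_real_pos) auto

text \<open>The part of the kernel with \<open>y \<le> x/2\<close> is at most \<open>(x/2)\<^bsup>-\<alpha>\<^esup>\<close> and \<open>\<mu>\<close> is a probability measure; on the rest the
  density is at most \<open>S\<close>.\<close>

lemma frac_split_bound: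
  assumes x: "0 < x" and S: "\<And>y. x / 2 < y \<Longrightarrow> y < x \<Longrightarrow> dens y \<le> S" "0 \<le> S"
  shows "frac x \<le> (x / 2) powr - \<alpha> + S * (beta_const * (x / 2) powr (1 - \<alpha>))"
proof -
  let ?f = "\<lambda>y. (if x / 2 < y \<and> y < x then ennreal ((x - y) powr - \<alpha>) else 0)"
  have "frac_nn x \<le> (\<integral>\<^sup>+y. ennreal ((x / 2) powr - \<alpha>) + ?f y \<partial>\<mu>)"
    unfolding frac_nn_def
    by (rule nn_integral_mono) (use alpha in \<open>auto intro!: ennreal_leI powr_mono2'\<close>)
  also have "\<dots> = ennreal ((x / 2) powr - \<alpha>) + (\<integral>\<^sup>+y. ?f y \<partial>\<mu>)"
    using emeasure_space_1 by (subst nn_integral_add) auto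
  also have "(\<integral>\<^sup>+y. ?f y \<partial>\<mu>) = (\<integral>\<^sup>+y. ?f y * ennreal (dens y) \<partial>lborel)"
    by (rule nn_integral_mu_dens) simp
  also have "\<dots> \<le> (\<integral>\<^sup>+y. ?f y * ennreal S \<partial>lborel)"
    by (rule nn_integral_mono) (use S in \<open>auto intro!: mult_left_mono ennreal_leI\<close>)
  also have "\<dots> = ennreal (beta_const * (x - x / 2) powr (1 - \<alpha>)) * ennreal S"
    using x by (subst nn_integral_multc) (simp_all only: nn_integral_power_kernel beta_const_def, simp)
  also have "\<dots> = ennreal (S * (beta_const * (x / 2) powr (1 - \<alpha>)))"
    using beta_const_pos S by (simp add: ennreal_mult[symmetric] mult.commute)
  finally have "frac_nn x \<le> ennreal ((x / 2) powr - \<alpha> + S * (beta_const * (x / 2) powr (1 - \<alpha>)))"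
    using beta_const_pos S by (simp add: ennreal_plus[symmetric] del: ennreal_plus)
  then show ?thesis
    unfolding frac_nn_eq_frac using beta_const_pos S by (subst (asm) ennreal_le_iff) auto
qed

text \<open>Put \<open>G x = x powr (1 + \<alpha>) * dens x\<close>, which is \<open>norm_const\<close> times the quantity to be bounded. Splitting at \<open>x/2\<close> gives
  \<open>G x \<le> norm_const * 2 powr \<alpha> + N * (q * x powr - \<alpha>)\<close> if \<open>G \<le> N\<close> on \<open>(0, x]\<close>. Beyond a fixed \<open>X0\<close> the coefficient of \<open>N\<close> is at most
  \<open>1/2\<close>, so the supremum of \<open>G\<close> over \<open>(0, X]\<close>, which is finite by the local bound, is
  bounded independently of \<open>X\<close>.\<close>

lemma frac_tail_bound: "\<exists>D\<ge>0. \<forall>x>0. x powr \<alpha> * frac x \<le> D"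
proof -
  define G where "G x = x powr (1 + \<alpha>) * dens x" for x
  have G: "G x = norm_const * (x powr \<alpha> * frac x)" if "0 < x" for x
    using that by (simp add: G_def dens_def powr_add)
  define q where "q = norm_const * beta_const * 4 powr \<alpha>"
  have q: "q > 0" using norm_const_pos beta_const_pos by (simp add: q_def)
  have ev: "eventually (\<lambda>x. x > 0 \<and> q * x powr - \<alpha> \<le> 1 / 2) at_top"
  proof -
    have "((\<lambda>x. q * x powr - \<alpha>) \<longlongrightarrow> 0) at_top" using alpha by real_asymp
    then have "eventually (\<lambda>x. q * x powr - \<alpha> < 1 / 2) at_top" by (rule order_tendstoD) simp
    then show ?thesis using eventually_gt_at_top[of 0] by eventually_elim auto
  qed
  obtain X0 where X0: "X0 > 0" "\<And>x. x \<ge> X0 \<Longrightarrow> q * x powr - \<alpha> \<le> 1 / 2"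
    using ev unfolding eventually_at_top_linorder by (metis order_refl)
  have step: "G x \<le> norm_const * 2 powr \<alpha> + N * (q * x powr - \<alpha>)"
    if x: "0 < x" and N: "\<And>y. 0 < y \<Longrightarrow> y \<le> x \<Longrightarrow> G y \<le> N" "0 \<le> N" for x N
  proof -
    have "dens y \<le> N * (x / 2) powr - (1 + \<alpha>)" if y: "x / 2 < y" "y < x" for y
    proof -
      have "y powr (1 + \<alpha>) * y powr - (1 + \<alpha>) = 1"
        using x y by (simp only: powr_add[symmetric]) simp
      then have "dens y = G y * y powr - (1 + \<alpha>)" by (simp add: G_def)
      also have "\<dots> \<le> N * (x / 2) powr - (1 + \<alpha>)"
        using x y N alpha dens_nonneg[of y] by (intro mult_mono powr_mono2') (auto simp: G_def)
      finally show ?thesis .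
    qed
    then have "frac x \<le> (x / 2) powr - \<alpha> + N * (x / 2) powr - (1 + \<alpha>) * (beta_const * (x / 2) powr (1 - \<alpha>))"
      using x N by (intro frac_split_bound) auto
    then have "G x \<le> norm_const * (x powr \<alpha> * ((x / 2) powr - \<alpha> + N * (x / 2) powr - (1 + \<alpha>) * (beta_const * (x / 2) powr (1 - \<alpha>))))"
      unfolding G[OF x] using norm_const_pos by (intro mult_left_mono) auto
    also have "\<dots> = norm_const * (x powr \<alpha> * (x / 2) powr - \<alpha>) + N * (norm_const * beta_const * (x powr \<alpha> * ((x / 2) powr - (1 + \<alpha>) * (x / 2) powr (1 - \<alpha>))))"
      by (simp add: algebra_simps)
    also have "x powr \<alpha> * (x / 2) powr - \<alpha> = 2 powr \<alpha>"
      using x by (simp add: powr_divide powr_minus field_simps)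
    also have "(x / 2) powr - (1 + \<alpha>) * (x / 2) powr (1 - \<alpha>) = (x / 2) powr (- \<alpha> - \<alpha>)"
      by (simp add: powr_add[symmetric])
    also have "x powr \<alpha> * (x / 2) powr (- \<alpha> - \<alpha>) = 4 powr \<alpha> * x powr - \<alpha>"
    proof -
      have "4 powr \<alpha> * 2 powr (- \<alpha> - \<alpha>) = 1"
      proof -
        have "2 powr \<alpha> * 2 powr \<alpha> * 2 powr (- \<alpha> - \<alpha>) = (1::real)"
          by (subst powr_add[symmetric])+ simp
        then show ?thesis using powr_mult[of 2 2 \<alpha>] by simp
      qed
      moreover have "x powr \<alpha> * x powr (- \<alpha> - \<alpha>) = x powr - \<alpha>"
        by (simp add: powr_add[symmetric])
      ultimately show ?thesis using x by (simp add: powr_divide field_simps)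
    qed
    finally show ?thesis by (simp add: q_def mult_ac)
  qed
  obtain C where C: "C \<ge> 0" "\<And>x. x \<le> X0 \<Longrightarrow> dens x \<le> C" using dens_local_bound[of X0] by auto
  define D0 where "D0 = max (X0 powr (1 + \<alpha>) * C) (2 * (norm_const * 2 powr \<alpha>))"
  have D0: "0 \<le> D0" using norm_const_pos by (auto simp: D0_def le_max_iff_disj)
  have bound: "G X \<le> D0" if X: "0 < X" for X
  proof -
    let ?A = "G ` {0<..X}"
    obtain CX where CX: "CX \<ge> 0" "\<And>x. x \<le> X \<Longrightarrow> dens x \<le> CX" using dens_local_bound[of X] by auto
    have bdd: "bdd_above ?A"
    proof (rule bdd_aboveI2)
      fix x assume "x \<in> {0<..X}"
      then show "G x \<le> X powr (1 + \<alpha>) * CX"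
        unfolding G_def using alpha CX dens_nonneg by (intro mult_mono powr_mono2) auto
    qed
    define N where "N = Sup ?A"
    have N: "G y \<le> N" if "0 < y" "y \<le> X" for y
      unfolding N_def using that bdd by (intro cSup_upper) auto
    have G0: "0 \<le> G y" for y using dens_nonneg by (simp add: G_def)
    have N0: "0 \<le> N" using N[of X] G0[of X] X by auto
    have "N \<le> max D0 (norm_const * 2 powr \<alpha> + N / 2)"
      unfolding N_def
    proof (rule cSup_least)
      show "?A \<noteq> {}" using X by auto
      fix z assume "z \<in> ?A"
      then obtain x where x: "0 < x" "x \<le> X" "z = G x" by auto
      show "z \<le> max D0 (norm_const * 2 powr \<alpha> + Sup ?A / 2)"
      proof (cases "x \<le> X0")
        case True
        then have "G x \<le> X0 powr (1 + \<alpha>) * C"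
          unfolding G_def using alpha C dens_nonneg x by (intro mult_mono powr_mono2) auto
        then show ?thesis using x by (simp add: D0_def)
      next
        case False
        have "G x \<le> norm_const * 2 powr \<alpha> + N * (q * x powr - \<alpha>)"
          using x N N0 by (intro step) auto
        also have "N * (q * x powr - \<alpha>) \<le> N * (1 / 2)"
          using X0(2)[of x] False N0 by (intro mult_left_mono) auto
        finally show ?thesis using x by (simp add: N_def)
      qed
    qed
    then have "N \<le> D0"
      by (cases "D0 \<le> norm_const * 2 powr \<alpha> + N / 2") (auto simp: D0_def max_def split: if_splits)
    then show ?thesis using N[of X] X by auto
  qed
  have "x powr \<alpha> * frac x \<le> D0 / norm_const" if "0 < x" for x
    using bound[OF that] norm_const_pos by (simp add: G[OF that] field_simps)
  then show ?thesis using D0 norm_const_pos by (intro exI[of _ "D0 / norm_const"]) auto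
qed

text \<open>Near \<open>0\<close> use the local bound, beyond \<open>1\<close> the tail bound.\<close>

lemma dens_bounded: "\<exists>B\<ge>0. \<forall>x. dens x \<le> B \<and> x * dens x \<le> B"
proof -
  obtain C where C: "C \<ge> 0" "\<And>x. x \<le> 1 \<Longrightarrow> dens x \<le> C" using dens_local_bound[of 1] by auto
  obtain D where D: "D \<ge> 0" "\<And>x. 0 < x \<Longrightarrow> x powr \<alpha> * frac x \<le> D" using frac_tail_bound by auto
  have 1: "dens x \<le> C + norm_const * D \<and> x * dens x \<le> C + norm_const * D" if "x \<le> 1" for x
  proof -
    have "x * dens x \<le> 1 * dens x" using that dens_nonneg by (intro mult_right_mono) auto
    then show ?thesis using C(2)[OF that] D(1) norm_const_pos by (smt (verit) mult_nonneg_nonneg)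
  qed
  have 2: "dens x \<le> C + norm_const * D \<and> x * dens x \<le> C + norm_const * D" if "x \<ge> 1" for x
  proof -
    have "1 * frac x \<le> x powr \<alpha> * frac x" using that alpha frac_nonneg by (intro mult_right_mono ge_one_powr_ge_zero) auto
    then have "frac x \<le> D" using D(2)[of x] that by simp
    then have *: "x * dens x \<le> norm_const * D" using that norm_const_pos by (simp add: dens_def)
    moreover have "1 * dens x \<le> x * dens x" using that dens_nonneg by (intro mult_right_mono) auto
    ultimately show ?thesis using C(1) by auto
  qed
  show ?thesis
    using 1 2 C D norm_const_pos by (intro exI[of _ "C + norm_const * D"]) (auto, (meson linear)+)
qed

end

section \<open>Regularity of the stable density and the inverse density\<close>

context stable_law
begin

definition abel :: "real \<Rightarrow> real \<Rightarrow> real" where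
  "abel x y = (if 0 < y \<and> y < x then (x - y) powr - \<alpha> else 0)"

lemma measurable_abel [measurable]: "abel x \<in> borel_measurable borel"
  unfolding abel_def by measurable

lemma abel_nonneg: "0 \<le> abel x y"
  by (simp add: abel_def)

lemma frac_nn_eq_nn_integral: "frac_nn x = (\<integral>\<^sup>+y. ennreal (abel x y * dens y) \<partial>lborel)"
proof -
  have "frac_nn x = (\<integral>\<^sup>+y. ennreal (abel x y) \<partial>\<mu>)"
    unfolding frac_nn_def abel_def by (intro nn_integral_cong) auto
  also have "\<dots> = (\<integral>\<^sup>+y. ennreal (abel x y) * ennreal (dens y) \<partial>lborel)"
    by (rule nn_integral_mu_dens) measurable
  finally show ?thesis
    by (simp add: ennreal_mult abel_def dens_nonneg)
qed

lemma has_bochner_integral_frac: "has_bochner_integral lborel (\<lambda>y. abel x y * dens y) (frac x)"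
  by (rule has_bochner_integral_nn_integral)
     (auto simp: frac_nn_eq_nn_integral[symmetric] frac_nn_eq_frac frac_nonneg abel_nonneg dens_nonneg)

lemma has_bochner_integral_abel:
  "0 < x \<Longrightarrow> has_bochner_integral lborel (abel x) (beta_const * x powr (1 - \<alpha>))"
  by (rule has_bochner_integral_nn_integral)
     (use nn_integral_power_kernel[of 0 x] beta_const_pos in \<open>auto simp: abel_def beta_const_def if_distrib[of ennreal] cong: if_cong\<close>)

lemma has_bochner_integral_abel_part:
  assumes "x < x'"
  shows "has_bochner_integral lborel (\<lambda>y. if x < y \<and> y < x' then (x' - y) powr - \<alpha> else 0) (beta_const * (x' - x) powr (1 - \<alpha>))"
  by (rule has_bochner_integral_nn_integral)
     (use nn_integral_power_kernel[of x x'] beta_const_pos assms in \<open>auto simp: beta_const_def if_distrib[of ennreal] cong: if_cong\<close>)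

text \<open>For a bounded density only the \<open>L\<^sup>1\<close>-distance of the two kernels matters. The kernel ending at \<open>x\<close> dominates
  the one ending at \<open>x'\<close> on \<open>(0, x)\<close>, so this distance is a difference of two explicit integrals plus the mass on
  \<open>(x, x')\<close>.\<close>

lemma frac_hoelder:
  assumes B: "\<And>y. dens y \<le> B" and x: "0 < x" "x < x'"
  shows "\<bar>frac x' - frac x\<bar> \<le> B * (beta_const * (x powr (1 - \<alpha>) - x' powr (1 - \<alpha>) + 2 * (x' - x) powr (1 - \<alpha>)))"
proof -
  have B0: "0 \<le> B" using B[of 0] dens_nonneg[of 0] by linarith
  define P where "P y = (if x < y \<and> y < x' then (x' - y) powr - \<alpha> else 0)" for y
  have hb: "has_bochner_integral lborel (\<lambda>y. B * (abel x y - abel x' y + 2 * P y))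
      (B * (beta_const * x powr (1 - \<alpha>) - beta_const * x' powr (1 - \<alpha>) + 2 * (beta_const * (x' - x) powr (1 - \<alpha>))))"
    using has_bochner_integral_abel[of x] has_bochner_integral_abel[of x'] has_bochner_integral_abel_part[of x x'] x
    unfolding P_def by (intro has_bochner_integral_mult_right has_bochner_integral_add has_bochner_integral_diff) auto
  have hk: "has_bochner_integral lborel (\<lambda>y. abel x' y * dens y - abel x y * dens y) (frac x' - frac x)"
    by (intro has_bochner_integral_diff has_bochner_integral_frac)
  have le: "\<bar>abel x' y - abel x y\<bar> \<le> abel x y - abel x' y + 2 * P y" if "y \<noteq> x" for y
  proof -
    have "(x' - y) powr - \<alpha> \<le> (x - y) powr - \<alpha>" if "y < x"
      using that x alpha by (intro powr_mono2') auto
    then show ?thesis using x that by (auto simp: abel_def P_def)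
  qed
  have "\<bar>frac x' - frac x\<bar> = \<bar>LINT y|lborel. abel x' y * dens y - abel x y * dens y\<bar>"
    using hk by (simp add: has_bochner_integral_iff)
  also have "\<dots> \<le> (LINT y|lborel. \<bar>abel x' y * dens y - abel x y * dens y\<bar>)"
    by (rule integral_abs_bound)
  also have "\<dots> \<le> (LINT y|lborel. B * (abel x y - abel x' y + 2 * P y))"
  proof (rule integral_mono_AE)
    show "integrable lborel (\<lambda>y. \<bar>abel x' y * dens y - abel x y * dens y\<bar>)"
      using hk by (auto simp: has_bochner_integral_iff)
    show "integrable lborel (\<lambda>y. B * (abel x y - abel x' y + 2 * P y))"
      using hb by (simp only: has_bochner_integral_iff)
    show "AE y in lborel. \<bar>abel x' y * dens y - abel x y * dens y\<bar> \<le> B * (abel x y - abel x' y + 2 * P y)"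
      using AE_lborel_singleton[of x]
    proof eventually_elim
      case (elim y)
      have "abel x' y * dens y - abel x y * dens y = dens y * (abel x' y - abel x y)" by (simp add: algebra_simps)
      then have "\<bar>abel x' y * dens y - abel x y * dens y\<bar> = dens y * \<bar>abel x' y - abel x y\<bar>"
        by (simp only: abs_mult abs_of_nonneg[OF dens_nonneg])
      also have "\<dots> \<le> B * (abel x y - abel x' y + 2 * P y)"
        using le[OF elim] B B0 by (intro mult_mono) auto
      finally show ?case .
    qed
  qed
  also have "\<dots> = B * (beta_const * x powr (1 - \<alpha>) - beta_const * x' powr (1 - \<alpha>) + 2 * (beta_const * (x' - x) powr (1 - \<alpha>)))"
    using hb by (simp only: has_bochner_integral_iff)
  finally show ?thesis by (simp add: algebra_simps)
qed

lemma continuous_on_frac: "continuous_on {0<..} frac"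
proof (rule continuous_at_imp_continuous_on, rule ballI)
  fix x :: real assume "x \<in> {0<..}"
  then have x: "0 < x" by simp
  obtain B where B: "\<And>y. dens y \<le> B" "0 \<le> B" using dens_bounded by auto
  let ?w = "\<lambda>y. B * (beta_const * (\<bar>x powr (1 - \<alpha>) - y powr (1 - \<alpha>)\<bar> + 2 * \<bar>y - x\<bar> powr (1 - \<alpha>)))"
  have "\<bar>frac y - frac x\<bar> \<le> ?w y" if y: "0 < y" for y
  proof (cases y x rule: linorder_cases)
    case less
    have "\<bar>frac y - frac x\<bar> \<le> B * (beta_const * (y powr (1 - \<alpha>) - x powr (1 - \<alpha>) + 2 * (x - y) powr (1 - \<alpha>)))"
      using frac_hoelder[OF B(1) y less] by (simp add: abs_minus_commute)
    also have "\<dots> \<le> ?w y"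
      using less B beta_const_pos by (intro mult_left_mono) (auto simp: abs_minus_commute)
    finally show ?thesis .
  next
    case greater
    have "\<bar>frac y - frac x\<bar> \<le> B * (beta_const * (x powr (1 - \<alpha>) - y powr (1 - \<alpha>) + 2 * (y - x) powr (1 - \<alpha>)))"
      by (rule frac_hoelder[OF B(1) x greater])
    also have "\<dots> \<le> ?w y"
      using greater B beta_const_pos by (intro mult_left_mono) auto
    finally show ?thesis .
  qed (use B beta_const_pos in auto)
  then have ev: "eventually (\<lambda>y. norm (frac y - frac x) \<le> ?w y) (at x)"
    using x by (intro eventually_mono[OF eventually_at_in_open'[of "{0<..}" x]]) auto
  have "(?w \<longlongrightarrow> B * (beta_const * (\<bar>x powr (1 - \<alpha>) - x powr (1 - \<alpha>)\<bar> + 2 * \<bar>x - x\<bar> powr (1 - \<alpha>)))) (at x)"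
    using x alpha by (intro tendsto_intros tendsto_powr2) auto
  then have "(?w \<longlongrightarrow> 0) (at x)" by simp
  from Lim_null_comparison[OF ev this] show "isCont frac x"
    by (simp add: isCont_def LIM_zero_iff)
qed

lemma continuous_on_dens: "continuous_on {0<..} dens"
  unfolding dens_def by (intro continuous_intros continuous_on_frac) auto

definition cdf :: "real \<Rightarrow> real" where "cdf x = measure \<mu> {..x}"

lemma cdf_has_derivative:
  assumes x: "0 < x"
  shows "(cdf has_real_derivative dens x) (at x)"
proof -
  define a e where "a = x / 2" and "e = 2 * x"
  have ax: "0 < a" "a < x" "x < e" using x by (auto simp: a_def e_def)
  have cont: "continuous_on {a..e} dens"
    by (rule continuous_on_subset[OF continuous_on_dens]) (use ax in auto)
  have diff: "cdf y = cdf a + integral {a..y} dens" if y: "y \<in> {a..e}" for y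
  proof -
    have int: "(dens has_integral integral {a..y} dens) {a..y}"
      using y by (intro integrable_integral integrable_continuous_real continuous_on_subset[OF cont]) auto
    have I0: "0 \<le> integral {a..y} dens" using int by (rule has_integral_nonneg) (simp add: dens_nonneg)
    have "measure \<mu> {a<..y} = integral {a..y} dens"
    proof -
      have "emeasure \<mu> {a<..y} = (\<integral>\<^sup>+z. indicator {a<..y} z \<partial>\<mu>)"
        by (simp add: sets_mu)
      also have "\<dots> = (\<integral>\<^sup>+z. indicator {a<..y} z * ennreal (dens z) \<partial>lborel)"
        by (rule nn_integral_mu_dens) simp
      also have "\<dots> = (\<integral>\<^sup>+z. ennreal (indicator {a..y} z * dens z) \<partial>lborel)"
        by (rule nn_integral_cong_AE, use AE_lborel_singleton[of a] in eventually_elim) (auto simp: indicator_def)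
      also have "\<dots> = ennreal (integral {a..y} dens)"
        by (rule nn_integral_has_integral_lebesgue[OF _ int]) (rule dens_nonneg)
      finally show ?thesis using I0 by (simp add: measure_def)
    qed
    moreover have "cdf y = cdf a + measure \<mu> {a<..y}"
      unfolding cdf_def using y by (subst finite_measure_Union[symmetric]) (auto simp: sets_mu intro!: arg_cong[where f="measure \<mu>"])
    ultimately show ?thesis by simp
  qed
  have "((\<lambda>y. integral {a..y} dens) has_real_derivative dens x) (at x within {a..e})"
    using cont ax by (intro integral_has_real_derivative) auto
  then have "((\<lambda>y. cdf a + integral {a..y} dens) has_real_derivative dens x) (at x within {a..e})"
    by (auto intro!: derivative_eq_intros)
  then have "(cdf has_real_derivative dens x) (at x within {a..e})"
    by (rule has_field_derivative_transform_within[where d=1]) (use ax in \<open>simp_all only: diff\<close>, auto)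
  then show ?thesis using ax by (simp add: at_within_Icc_at)
qed

text \<open>The fractional integral in time of the density of \<open>L(u)\<close>, reduced to that of \<open>L(1)\<close> by
  the substitution \<open>s = u\<^bsup>1/\<alpha>\<^esup> y\<close>.\<close>

lemma nn_integral_fractional_integral_scaled:
  assumes u: "0 < u"
  shows "(\<integral>\<^sup>+s. ennreal (abel t s * (u powr (- 1 / \<alpha>) * dens (s * u powr (- 1 / \<alpha>)))) \<partial>lborel)
    = ennreal (frac (t * u powr (- 1 / \<alpha>)) / u)"
proof -
  define v where "v = u powr (1 / \<alpha>)"
  have v: "0 < v" "u powr (- 1 / \<alpha>) = inverse v" "v powr \<alpha> = u"
    using u alpha by (auto simp: v_def powr_minus powr_powr minus_divide_left[symmetric])
  have "(\<integral>\<^sup>+s. ennreal (abel t s * (inverse v * dens (s * inverse v))) \<partial>lborel)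
    = ennreal \<bar>v\<bar> * (\<integral>\<^sup>+y. ennreal (abel t (0 + v * y) * (inverse v * dens ((0 + v * y) * inverse v))) \<partial>lborel)"
    using v by (intro nn_integral_real_affine) auto
  also have "\<dots> = (\<integral>\<^sup>+y. ennreal v * ennreal (abel t (0 + v * y) * (inverse v * dens ((0 + v * y) * inverse v))) \<partial>lborel)"
    using v by (subst nn_integral_cmult) auto
  also have "\<dots> = (\<integral>\<^sup>+y. ennreal (inverse u) * ennreal (abel (t * inverse v) y * dens y) \<partial>lborel)"
  proof (rule nn_integral_cong)
    fix y :: real
    have "abel t (v * y) = inverse u * abel (t * inverse v) y"
    proof -
      have 1: "0 < v * y \<longleftrightarrow> 0 < y" using v by (simp add: zero_less_mult_iff)
      have 2: "v * y < t \<longleftrightarrow> y < t * inverse v" using v by (simp add: field_simps)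
      have 3: "t - v * y = v * (t * inverse v - y)" using v by (simp add: field_simps)
      have 4: "v powr - \<alpha> = inverse u" using v by (simp add: powr_minus)
      show ?thesis
        unfolding abel_def 1 2
      proof (cases "0 < y \<and> y < t * inverse v")
        case True
        then have "(t - v * y) powr - \<alpha> = v powr - \<alpha> * (t * inverse v - y) powr - \<alpha>"
          unfolding 3 using v by (intro powr_mult)
        then show "(if 0 < y \<and> y < t * inverse v then (t - v * y) powr - \<alpha> else 0)
           = inverse u * (if 0 < y \<and> y < t * inverse v then (t * inverse v - y) powr - \<alpha> else 0)"
          using True 4 by simp
      qed auto
    qed
    then have 1: "abel t (0 + v * y) = inverse u * abel (t * inverse v) y" by simp
    have 2: "(0 + v * y) * inverse v = y" using v by simp
    show "ennreal v * ennreal (abel t (0 + v * y) * (inverse v * dens ((0 + v * y) * inverse v)))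
      = ennreal (inverse u) * ennreal (abel (t * inverse v) y * dens y)"
      unfolding 1 2 using v u dens_nonneg[of y] abel_nonneg[of _ y] by (simp add: ennreal_mult[symmetric])
  qed
  also have "\<dots> = ennreal (inverse u) * frac_nn (t * inverse v)"
    unfolding frac_nn_eq_nn_integral by (rule nn_integral_cmult) measurable
  also have "\<dots> = ennreal (frac (t * inverse v) / u)"
    using u frac_nonneg by (simp add: frac_nn_eq_frac ennreal_mult[symmetric] divide_inverse mult.commute)
  finally show ?thesis using v by simp
qed

text \<open>The density of \<open>Y(t)\<close> at \<open>u\<close>. The formula is the scaled form of the fractional integral in \<open>t\<close> of the density of \<open>L(u)\<close>;
  that it is also minus the \<open>u\<close>-derivative of \<open>P(L(u) \<le> t)\<close> is \<open>cdf_space_derivative\<close>.\<close>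

definition inverse_dens :: "real \<Rightarrow> real \<Rightarrow> real" where
  "inverse_dens t u = frac (t * u powr (- 1 / \<alpha>)) / (Gamma (1 - \<alpha>) * u)"

lemma Gamma_pos: "0 < Gamma (1 - \<alpha>)" using alpha by (intro Gamma_real_pos) auto

lemma measurable_inverse_dens [measurable]: "inverse_dens t \<in> borel_measurable borel"
  unfolding inverse_dens_def by measurable

lemma inverse_dens_nonneg: "0 < u \<Longrightarrow> 0 \<le> inverse_dens t u"
  unfolding inverse_dens_def using Gamma_pos frac_nonneg by simp

text \<open>With \<open>x = t u\<^bsup>-1/\<alpha>\<^esup>\<close> one has \<open>1/u = x\<^sup>\<alpha> t\<^bsup>-\<alpha>\<^esup>\<close>, so that the tail bound at \<open>x\<close> applies for every \<open>u\<close>.\<close>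

lemma inverse_dens_bounded:
  assumes t: "0 < t" shows "\<exists>C\<ge>0. \<forall>u>0. inverse_dens t u \<le> C"
proof -
  obtain D where D: "D \<ge> 0" "\<And>x. 0 < x \<Longrightarrow> x powr \<alpha> * frac x \<le> D" using frac_tail_bound by auto
  have "inverse_dens t u \<le> D * t powr - \<alpha> / Gamma (1 - \<alpha>)" if u: "0 < u" for u
  proof -
    define x where "x = t * u powr (- 1 / \<alpha>)"
    have x: "0 < x" using t u by (simp add: x_def)
    have "(u powr (- 1 / \<alpha>)) powr \<alpha> = inverse u"
      using u alpha unfolding powr_powr by (simp add: powr_minus)
    then have "x powr \<alpha> = t powr \<alpha> * inverse u"
      using t u unfolding x_def by (subst powr_mult) auto
    then have "u = t powr \<alpha> / x powr \<alpha>" using t u x by (simp add: field_simps)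
    then have "frac x / u = frac x / (t powr \<alpha> / x powr \<alpha>)" by (rule arg_cong)
    also have "\<dots> = x powr \<alpha> * frac x * t powr - \<alpha>" using x t by (simp add: powr_minus field_simps)
    also have "\<dots> \<le> D * t powr - \<alpha>" using D(2)[OF x] by (intro mult_right_mono) auto
    finally show ?thesis
      unfolding inverse_dens_def x_def[symmetric] using Gamma_pos u
      by (simp add: field_simps)
  qed
  then show ?thesis using D Gamma_pos by (intro exI[of _ "D * t powr - \<alpha> / Gamma (1 - \<alpha>)"]) auto
qed

text \<open>The density of \<open>L(u)\<close> at \<open>t\<close>.\<close>

definition time_dens :: "real \<Rightarrow> real \<Rightarrow> real" where
  "time_dens u t = u powr (- 1 / \<alpha>) * dens (t * u powr (- 1 / \<alpha>))"

lemma cdf_time_derivative: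
  assumes "0 < t" "0 < u"
  shows "((\<lambda>t. cdf (t * u powr (- 1 / \<alpha>))) has_real_derivative time_dens u t) (at t)"
proof -
  have "((\<lambda>t. t * u powr (- 1 / \<alpha>)) has_real_derivative u powr (- 1 / \<alpha>)) (at t)"
    by (auto intro!: derivative_eq_intros)
  then have "((\<lambda>t. cdf (t * u powr (- 1 / \<alpha>))) has_real_derivative
      dens (t * u powr (- 1 / \<alpha>)) * u powr (- 1 / \<alpha>)) (at t)"
    using assms by (intro DERIV_chain2[OF cdf_has_derivative]) auto
  then show ?thesis by (simp only: time_dens_def mult.commute)
qed

text \<open>This is where the identity for \<open>\<mu>\<close> enters: differentiating in \<open>u\<close> produces \<open>x * dens x / (\<alpha> * u)\<close> with
  \<open>x = t u\<^bsup>-1/\<alpha>\<^esup>\<close>, which the identity turns into \<open>frac x / (\<Gamma>(1 - \<alpha>) u)\<close>.\<close>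

lemma cdf_space_derivative:
  assumes "0 < t" "0 < u"
  shows "((\<lambda>u. - cdf (t * u powr (- 1 / \<alpha>))) has_real_derivative inverse_dens t u) (at u)"
proof -
  define x where "x = t * u powr (- 1 / \<alpha>)"
  have "((\<lambda>u. t * u powr (- 1 / \<alpha>)) has_real_derivative t * ((- 1 / \<alpha>) * u powr (- 1 / \<alpha> - 1))) (at u)"
    using assms by (auto intro!: derivative_eq_intros)
  then have "((\<lambda>u. - cdf (t * u powr (- 1 / \<alpha>))) has_real_derivative
      - (dens x * (t * ((- 1 / \<alpha>) * u powr (- 1 / \<alpha> - 1))))) (at u)"
    unfolding x_def using assms by (intro DERIV_minus DERIV_chain2[OF cdf_has_derivative]) auto
  also have "- (dens x * (t * ((- 1 / \<alpha>) * u powr (- 1 / \<alpha> - 1)))) = inverse_dens t u"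
  proof -
    have "t * u powr (- 1 / \<alpha> - 1) = x / u"
      using assms by (simp add: x_def powr_diff)
    then have "- (dens x * (t * ((- 1 / \<alpha>) * u powr (- 1 / \<alpha> - 1)))) = dens x * (x / u) / \<alpha>"
      by (simp add: field_simps)
    also have "\<dots> = inverse_dens t u"
      unfolding inverse_dens_def x_def[symmetric] dens_def norm_const_def using assms alpha by (simp add: x_def)
    finally show ?thesis .
  qed
  finally show ?thesis .
qed

lemma cdf_tendsto_0:
  assumes "0 < t"
  shows "((\<lambda>u. - cdf (t * u powr (- 1 / \<alpha>))) \<longlongrightarrow> 0) at_top"
proof -
  obtain B where B: "B \<ge> 0" "\<And>x. dens x \<le> B" using dens_bounded by auto
  have "cdf x \<le> B * x" if "0 \<le> x" for x
  proof -
    have "emeasure \<mu> {..x} = (\<integral>\<^sup>+z. indicator {..x} z \<partial>\<mu>)" by (simp add: sets_mu)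
    also have "\<dots> = (\<integral>\<^sup>+z. indicator {..x} z * ennreal (dens z) \<partial>lborel)"
      by (rule nn_integral_mu_dens) simp
    also have "\<dots> \<le> (\<integral>\<^sup>+z. ennreal B * indicator {0..x} z \<partial>lborel)"
      using B dens_eq_0 by (intro nn_integral_mono) (auto simp: indicator_def ennreal_leI)
    also have "\<dots> = ennreal (B * x)" using that B by (simp add: nn_integral_cmult ennreal_mult)
    finally show ?thesis using B that by (simp add: cdf_def emeasure_eq_measure)
  qed
  then have "norm (- cdf (t * u powr (- 1 / \<alpha>))) \<le> B * (t * u powr (- 1 / \<alpha>))" for u
    using assms by (simp add: cdf_def)
  then have "eventually (\<lambda>u. norm (- cdf (t * u powr (- 1 / \<alpha>))) \<le> B * (t * u powr (- 1 / \<alpha>))) at_top"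
    by (intro always_eventually allI)
  moreover have "((\<lambda>u. B * (t * u powr (- 1 / \<alpha>))) \<longlongrightarrow> 0) at_top"
  proof -
    have "((\<lambda>u. u powr (- 1 / \<alpha>)) \<longlongrightarrow> 0) at_top"
      using alpha by (intro tendsto_neg_powr filterlim_ident) auto
    then have "((\<lambda>u. B * (t * u powr (- 1 / \<alpha>))) \<longlongrightarrow> B * (t * 0)) at_top"
      by (intro tendsto_intros)
    then show ?thesis by simp
  qed
  ultimately show ?thesis
    by (rule Lim_null_comparison)
qed

lemma nn_integral_inverse_dens:
  assumes "0 < t" "0 < a"
  shows "(\<integral>\<^sup>+u. ennreal (inverse_dens t u) * indicator {a..} u \<partial>lborel) = ennreal (cdf (t * a powr (- 1 / \<alpha>)))"
proof -
  have "(\<integral>\<^sup>+u. ennreal (inverse_dens t u) * indicator {a..} u \<partial>lborel) = ennreal (0 - (- cdf (t * a powr (- 1 / \<alpha>))))"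
  proof (rule nn_integral_FTC_atLeast)
    show "inverse_dens t \<in> borel_measurable borel" by simp
    show "((\<lambda>u. - cdf (t * u powr (- 1 / \<alpha>))) has_real_derivative inverse_dens t x) (at x)" if "a \<le> x" for x
      using assms that by (intro cdf_space_derivative) auto
    show "0 \<le> inverse_dens t x" if "a \<le> x" for x using assms that by (intro inverse_dens_nonneg) auto
    show "((\<lambda>u. - cdf (t * u powr (- 1 / \<alpha>))) \<longlongrightarrow> 0) at_top"
      using assms by (intro cdf_tendsto_0)
  qed
  then show ?thesis by simp
qed

end

section \<open>The Polya-Aeppli distribution of order k\<close>

lemma set_integrable_sum:
  fixes f :: "'i \<Rightarrow> 'a \<Rightarrow> real"
  assumes "\<And>i. i \<in> I \<Longrightarrow> set_integrable M A (f i)"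
  shows "set_integrable M A (\<lambda>x. \<Sum>i\<in>I. f i x)"
  using assms unfolding set_integrable_def by (simp add: sum_distrib_left)

text \<open>The measurable space behind \<open>generated_events\<close>, on which measurability can be proved
  automatically.\<close>

definition generated_algebra ::
    "'w measure \<Rightarrow> 'b measure \<Rightarrow> 'i set \<Rightarrow> ('i \<Rightarrow> 'w \<Rightarrow> 'b) \<Rightarrow> 'w measure" where
  "generated_algebra M B I Z = sigma (space M) {Z i -` A \<inter> space M | i A. i \<in> I \<and> A \<in> sets B}"

lemma space_generated_algebra [simp]: "space (generated_algebra M B I Z) = space M"
  by (simp add: generated_algebra_def space_measure_of_conv)

lemma sets_generated_algebra: "sets (generated_algebra M B I Z) = generated_events M B I Z"
  unfolding generated_algebra_def generated_events_def by (rule sets_measure_of) auto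

lemma measurable_generated_algebra:
  assumes "i \<in> I" "space B = UNIV"
  shows "Z i \<in> measurable (generated_algebra M B I Z) B"
  using assms by (intro measurableI)
    (auto simp: sets_generated_algebra generated_events_def intro!: sigma_sets.Basic)

lemma (in prob_space) prob_sums_of_nat_partition:
  fixes Z :: "'a \<Rightarrow> nat"
  assumes Z [measurable]: "Z \<in> measurable M (count_space UNIV)" and E: "E \<in> events"
  shows "(\<lambda>n. prob (E \<inter> {w\<in>space M. Z w = n})) sums prob E"
proof -
  have "(\<lambda>n. prob (E \<inter> {w\<in>space M. Z w = n})) sums prob (\<Union>n. E \<inter> {w\<in>space M. Z w = n})"
    by (rule finite_measure_UNION) (use E in \<open>auto simp: disjoint_family_on_def\<close>)
  also have "(\<Union>n. E \<inter> {w\<in>space M. Z w = n}) = E"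
    using sets.sets_into_space[OF E] by auto
  finally show ?thesis .
qed

context
  fixes k :: nat and \<rho> :: real
begin

definition geom_weight :: "nat \<Rightarrow> real" where
  "geom_weight j = (1 - \<rho>) / (1 - \<rho> ^ k) * \<rho> ^ (j - 1)"

text \<open>\<open>geom_conv n m\<close> is the probability that \<open>n\<close> independent truncated geometric variables have sum \<open>m\<close>.\<close>

primrec geom_conv :: "nat \<Rightarrow> nat \<Rightarrow> real" where
  "geom_conv 0 m = (if m = 0 then 1 else 0)"
| "geom_conv (Suc n) m = (\<Sum>j = 1..min m k. geom_weight j * geom_conv n (m - j))"

text \<open>Since all jumps are at least \<open>1\<close>, no more than \<open>m\<close> of them can add up to \<open>m\<close>, and the compound Poisson
  series is finite.\<close>

definition pa_poly :: "nat \<Rightarrow> real \<Rightarrow> real" where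
  "pa_poly m \<tau> = (\<Sum>n\<le>m. \<tau> ^ n / fact n * geom_conv n m)"

definition pa_prob :: "nat \<Rightarrow> real \<Rightarrow> real" where
  "pa_prob m \<tau> = exp (- \<tau>) * pa_poly m \<tau>"

definition pa_deriv :: "nat \<Rightarrow> real \<Rightarrow> real" where
  "pa_deriv m \<tau> = - pa_prob m \<tau> + (\<Sum>j = 1..min m k. geom_weight j * pa_prob (m - j) \<tau>)"

lemma geom_conv_eq_0: "m < n \<Longrightarrow> geom_conv n m = 0"
proof (induction n arbitrary: m)
  case (Suc n)
  have "geom_weight j * geom_conv n (m - j) = 0" if "j \<in> {1..min m k}" for j
    using that Suc.prems by (subst Suc.IH) auto
  then show ?case unfolding geom_conv.simps by (rule sum.neutral[rule_format])
qed simp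

text \<open>Differentiation shifts the number \<open>n\<close> of jumps by one, and the recursion of \<open>geom_conv\<close> splits off one
  jump of size \<open>j\<close>.\<close>

lemma pa_poly_derivative:
  "(pa_poly m has_real_derivative (\<Sum>j = 1..min m k. geom_weight j * pa_poly (m - j) \<tau>)) (at \<tau>)"
proof -
  have "(pa_poly m has_real_derivative (\<Sum>n\<le>m. (real n * \<tau> ^ (n - 1)) / fact n * geom_conv n m)) (at \<tau>)"
    unfolding pa_poly_def by (auto intro!: derivative_eq_intros sum.cong)
  also have "(\<Sum>n\<le>m. (real n * \<tau> ^ (n - 1)) / fact n * geom_conv n m) = (\<Sum>n<m. \<tau> ^ n / fact n * geom_conv (Suc n) m)"
  proof -
    have "(\<Sum>n\<le>m. (real n * \<tau> ^ (n - 1)) / fact n * geom_conv n m)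
      = (\<Sum>n<Suc m. (real n * \<tau> ^ (n - 1)) / fact n * geom_conv n m)"
      by (simp only: lessThan_Suc_atMost)
    also have "\<dots> = (\<Sum>n<m. (real (Suc n) * \<tau> ^ n) / fact (Suc n) * geom_conv (Suc n) m)"
      by (subst sum.lessThan_Suc_shift) simp
    also have "\<dots> = (\<Sum>n<m. \<tau> ^ n / fact n * geom_conv (Suc n) m)"
      by (intro sum.cong refl) (simp add: divide_simps del: geom_conv.simps of_nat_Suc)
    finally show ?thesis .
  qed
  also have "\<dots> = (\<Sum>j = 1..min m k. geom_weight j * (\<Sum>n<m. \<tau> ^ n / fact n * geom_conv n (m - j)))"
    by (simp add: sum_distrib_left mult_ac del: One_nat_def) (rule sum.swap)
  also have "\<dots> = (\<Sum>j = 1..min m k. geom_weight j * pa_poly (m - j) \<tau>)"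
  proof (intro sum.cong refl arg_cong[where f="\<lambda>z. geom_weight _ * z"])
    fix j assume j: "j \<in> {1..min m k}"
    show "(\<Sum>n<m. \<tau> ^ n / fact n * geom_conv n (m - j)) = pa_poly (m - j) \<tau>"
      unfolding pa_poly_def by (rule sum.mono_neutral_right) (use j geom_conv_eq_0[of "m - j"] in auto)
  qed
  finally show ?thesis .
qed

lemma pa_prob_derivative: "(pa_prob m has_real_derivative pa_deriv m \<tau>) (at \<tau>)"
proof -
  have "((\<lambda>\<tau>. exp (- \<tau>) * pa_poly m \<tau>) has_real_derivative
      - exp (- \<tau>) * pa_poly m \<tau> + exp (- \<tau>) * (\<Sum>j = 1..min m k. geom_weight j * pa_poly (m - j) \<tau>)) (at \<tau>)"
    by (auto intro!: derivative_eq_intros pa_poly_derivative)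
  moreover have "- exp (- \<tau>) * pa_poly m \<tau> + exp (- \<tau>) * (\<Sum>j = 1..min m k. geom_weight j * pa_poly (m - j) \<tau>)
      = pa_deriv m \<tau>"
    by (simp add: pa_deriv_def pa_prob_def sum_distrib_left mult_ac del: One_nat_def)
  moreover have "pa_prob m = (\<lambda>\<tau>. exp (- \<tau>) * pa_poly m \<tau>)" by (simp add: pa_prob_def fun_eq_iff)
  ultimately show ?thesis by simp
qed

lemma continuous_on_pa_prob: "continuous_on S (pa_prob m)"
  unfolding pa_prob_def pa_poly_def by (intro continuous_intros) auto

lemma continuous_on_pa_deriv: "continuous_on S (pa_deriv m)"
  unfolding pa_deriv_def by (intro continuous_intros continuous_on_pa_prob)

lemma set_integrable_pa_prob: "set_integrable lborel {0..} (pa_prob m)"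
proof -
  have "set_integrable lborel {0..} (\<lambda>\<tau>::real. \<tau> ^ n * exp (- \<tau>))" for n
  proof -
    have "(\<integral>\<^sup>+\<tau>. ennreal (indicator {0..} \<tau> * (\<tau> ^ n * exp (- \<tau>))) \<partial>lborel) < \<infinity>"
    proof -
      have "(\<integral>\<^sup>+\<tau>. ennreal (indicator {0..} \<tau> * (\<tau> ^ n * exp (- \<tau>))) \<partial>lborel) = ennreal (Gamma (real n + 1))"
        unfolding Gamma_conv_nn_integral_real[of "real n + 1", simplified]
        by (intro nn_integral_cong_AE, use AE_lborel_singleton[of 0] in eventually_elim)
           (auto simp: indicator_def powr_realpow exp_minus divide_inverse)
      then show ?thesis by simp
    qed
    note fin = this
    have "integrable lborel (\<lambda>\<tau>::real. indicator {0..} \<tau> * (\<tau> ^ n * exp (- \<tau>)))"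
      by (rule integrableI_nonneg[OF _ _ fin]) (auto simp: indicator_def)
    then show ?thesis
      unfolding set_integrable_def by simp
  qed
  then have "set_integrable lborel {0..} (\<lambda>\<tau>. \<Sum>n\<le>m. (geom_conv n m / fact n) * (\<tau> ^ n * exp (- \<tau>)))"
    by (intro set_integrable_sum set_integrable_mult_right) auto
  then show ?thesis
    unfolding pa_prob_def pa_poly_def by (simp add: sum_distrib_left mult_ac)
qed

lemma set_integrable_pa_deriv: "set_integrable lborel {0..} (pa_deriv m)"
  unfolding pa_deriv_def
  by (intro set_integral_add set_integrable_sum set_integrable_mult_right set_integrable_pa_prob
      set_integrable_mult_right[of "-1", simplified])

end

text \<open>The prescribed probabilities on \<open>{1..k}\<close> add up to \<open>1\<close>, which leaves no mass for other values.\<close>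

lemma (in prob_space) prob_truncated_geometric:
  assumes k: "1 \<le> k" and \<rho>: "0 \<le> \<rho>" "\<rho> < 1" and X: "truncated_geometric M k \<rho> X"
  shows "prob {w\<in>space M. X w = j} = (if j \<in> {1..k} then geom_weight k \<rho> j else 0)"
proof -
  have [measurable]: "X \<in> measurable M (count_space UNIV)" using X by (simp add: truncated_geometric_def)
  have in_range: "prob {w\<in>space M. X w = j} = geom_weight k \<rho> j" if "j \<in> {1..k}" for j
    using X that by (simp add: truncated_geometric_def geom_weight_def)
  \<comment> \<open>Otherwise the quotients in the weights would have the default value \<open>0\<close>.\<close>
  have "\<rho> ^ k \<noteq> 1" using power_decreasing[of 1 k \<rho>] k \<rho> by simp
  have "(\<Sum>j\<in>{1..k}. \<rho> ^ (j - 1)) = (\<Sum>j<k. \<rho> ^ j)"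
    by (rule sum.reindex_bij_witness[of _ Suc "\<lambda>j. j - 1"]) auto
  also have "\<dots> = (1 - \<rho> ^ k) / (1 - \<rho>)" using \<rho> by (simp add: sum_gp_strict)
  finally have "(\<Sum>j\<in>{1..k}. geom_weight k \<rho> j) = 1"
    unfolding geom_weight_def sum_distrib_left[symmetric] using \<rho> \<open>\<rho> ^ k \<noteq> 1\<close> by simp
  also have "(\<Sum>j\<in>{1..k}. geom_weight k \<rho> j) = (\<Sum>j\<in>{1..k}. prob {w\<in>space M. X w = j})"
    by (intro sum.cong) (simp_all add: in_range)
  also have "\<dots> = prob (\<Union>j\<in>{1..k}. {w\<in>space M. X w = j})"
    by (rule finite_measure_finite_Union[symmetric]) (auto simp: disjoint_family_on_def)
  finally have 1: "prob (\<Union>j\<in>{1..k}. {w\<in>space M. X w = j}) = 1" by simp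
  have "prob {w\<in>space M. X w = j} = 0" if "j \<notin> {1..k}"
  proof -
    have "prob {w\<in>space M. X w = j} + prob (\<Union>j\<in>{1..k}. {w\<in>space M. X w = j})
      = prob ({w\<in>space M. X w = j} \<union> (\<Union>j\<in>{1..k}. {w\<in>space M. X w = j}))"
      by (rule finite_measure_Union[symmetric]) (use that in auto)
    also have "\<dots> \<le> 1" by (rule prob_le_1)
    finally show ?thesis using 1 measure_nonneg[of M "{w\<in>space M. X w = j}"] by linarith
  qed
  with in_range show ?thesis by auto
qed

lemma (in prob_space) prob_sum_truncated_geometric:
  assumes k: "1 \<le> k" and \<rho>: "0 \<le> \<rho>" "\<rho> < 1"
    and X: "\<And>i. i \<ge> 1 \<Longrightarrow> truncated_geometric M k \<rho> (X i)"
    and indep: "indep_vars (\<lambda>_. count_space UNIV) X {1..}"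
  shows "prob {w\<in>space M. (\<Sum>i\<in>{Suc a..a + n}. X i w) = m} = geom_conv k \<rho> n m"
proof (induction n arbitrary: m)
  case 0
  then show ?case by (simp add: prob_space)
next
  case (Suc n)
  let ?S = "\<lambda>w. \<Sum>i\<in>{Suc a..a + n}. X i w" and ?Z = "X (Suc (a + n))"
  have Xm: "X i \<in> measurable M (count_space UNIV)" if "i \<ge> 1" for i
    using X[OF that] by (simp add: truncated_geometric_def)
  have S [measurable]: "?S \<in> measurable M (count_space UNIV)"
    by (rule measurable_sum_nat) (use Xm in auto)
  have Z [measurable]: "?Z \<in> measurable M (count_space UNIV)" using Xm by simp
  have "indep_vars (\<lambda>_. borel) (\<lambda>i. (real :: nat \<Rightarrow> real) \<circ> X i) {1..}"
    by (rule indep_vars_compose[OF indep]) simp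
  then have "indep_vars (\<lambda>_. borel) (\<lambda>i w. real (X i w)) (insert (Suc (a + n)) {Suc a..a + n})"
    unfolding comp_def by (rule indep_vars_subset) auto
  then have iv: "indep_var borel (\<lambda>w. real (?Z w)) borel (\<lambda>w. \<Sum>i\<in>{Suc a..a + n}. real (X i w))"
    by (intro indep_vars_sum) auto
  have prod: "prob {w\<in>space M. ?Z w = j \<and> ?S w = l} = prob {w\<in>space M. ?Z w = j} * prob {w\<in>space M. ?S w = l}" for j l
  proof -
    have "prob ((\<lambda>w. (real (?Z w), \<Sum>i\<in>{Suc a..a + n}. real (X i w))) -` ({real j} \<times> {real l}) \<inter> space M)
      = prob ((\<lambda>w. real (?Z w)) -` {real j} \<inter> space M) * prob ((\<lambda>w. \<Sum>i\<in>{Suc a..a + n}. real (X i w)) -` {real l} \<inter> space M)"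
      by (rule indep_varD[OF iv]) auto
    then show ?thesis
      by (simp add: vimage_def Int_def conj_commute of_nat_sum[symmetric] del: of_nat_sum)
  qed
  have "{w\<in>space M. (\<Sum>i\<in>{Suc a..a + Suc n}. X i w) = m}
      = (\<Union>j\<in>{0..m}. {w\<in>space M. ?Z w = j \<and> ?S w = m - j})"
    by auto
  then have "prob {w\<in>space M. (\<Sum>i\<in>{Suc a..a + Suc n}. X i w) = m}
      = prob (\<Union>j\<in>{0..m}. {w\<in>space M. ?Z w = j \<and> ?S w = m - j})"
    by simp
  also have "\<dots> = (\<Sum>j\<in>{0..m}. prob {w\<in>space M. ?Z w = j \<and> ?S w = m - j})"
    by (rule finite_measure_finite_Union) (auto simp: disjoint_family_on_def)
  also have "\<dots> = (\<Sum>j\<in>{0..m}. (if j \<in> {1..k} then geom_weight k \<rho> j else 0) * geom_conv k \<rho> n (m - j))"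
    unfolding prod Suc.IH using prob_truncated_geometric[OF k \<rho> X] by simp
  also have "\<dots> = (\<Sum>j = 1..min m k. geom_weight k \<rho> j * geom_conv k \<rho> n (m - j))"
    by (intro sum.mono_neutral_cong_right) auto
  finally show ?case by simp
qed

text \<open>On the event that \<open>N1\<close> has \<open>j\<close> jumps up to \<open>a\<close> and \<open>n\<close> jumps in \<open>(a, b]\<close>, the increment is the sum of
  \<open>X\<^bsub>j+1\<^esub>, \<dots>, X\<^bsub>j+n\<^esub>\<close>, which is independent of that event and whose law is the same for all \<open>j\<close>. Summing
  over \<open>j\<close> leaves the law of the Poisson increment alone.\<close>

lemma (in prob_space) polya_aeppli_increment_prob:
  assumes k: "1 \<le> k" and \<rho>: "0 \<le> \<rho>" "\<rho> < 1"
    and N: "polya_aeppli_process M k \<rho> N" and ab: "0 \<le> a" "a \<le> b"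
  shows "prob {w\<in>space M. int (N b w) - int (N a w) = int m} = pa_prob k \<rho> m (b - a)"
proof -
  obtain N1 X where N1: "poisson_process M 1 N1"
    and X: "\<And>i. i \<ge> 1 \<Longrightarrow> truncated_geometric M k \<rho> (X i)"
    and indepX: "indep_vars (\<lambda>_. count_space UNIV) X {1..}"
    and indep: "indep_set (generated_events M (count_space UNIV) {0..} N1) (generated_events M (count_space UNIV) {1..} X)"
    and N_eq: "\<And>t w. 0 \<le> t \<Longrightarrow> w \<in> space M \<Longrightarrow> N t w = (\<Sum>i = 1..N1 t w. X i w)"
    using N unfolding polya_aeppli_process_def by blast
  have Xm [measurable]: "X i \<in> measurable M (count_space UNIV)" if "i \<ge> 1" for i
    using X[OF that] by (simp add: truncated_geometric_def)
  have N1m [measurable]: "N1 a \<in> measurable M (count_space UNIV)" "N1 b \<in> measurable M (count_space UNIV)"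
    using N1 ab by (auto simp: poisson_process_def)
  have le: "N1 a w \<le> N1 b w" if "w \<in> space M" for w
    using N1 ab that by (auto simp: poisson_process_def mono_on_def)
  have N_diff: "int (N b w) - int (N a w) = int (\<Sum>i\<in>{Suc (N1 a w)..N1 b w}. X i w)" if "w \<in> space M" for w
  proof -
    have "{1..N1 b w} = {1..N1 a w} \<union> {Suc (N1 a w)..N1 b w}" using le[OF that] by auto
    then have "(\<Sum>i = 1..N1 b w. X i w) = (\<Sum>i = 1..N1 a w. X i w) + (\<Sum>i\<in>{Suc (N1 a w)..N1 b w}. X i w)"
      by (simp add: sum.union_disjoint del: One_nat_def)
    then show ?thesis using ab that by (simp add: N_eq)
  qed
  define E where "E = {w\<in>space M. int (N b w) - int (N a w) = int m}"
  define D where "D w = N1 b w - N1 a w" for w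
  have D [measurable]: "D \<in> measurable M (count_space UNIV)" unfolding D_def by measurable
  let ?S = "\<lambda>n j. {w\<in>space M. (\<Sum>i\<in>{Suc j..j + n}. X i w) = m}"
  let ?A = "\<lambda>n j. {w\<in>space M. D w = n} \<inter> {w\<in>space M. N1 a w = j}"
  have piece: "E \<inter> ?A n j = ?A n j \<inter> ?S n j" for n j
  proof -
    have "int (N b w) - int (N a w) = int m \<longleftrightarrow> (\<Sum>i\<in>{Suc j..j + n}. X i w) = m"
      if "w \<in> space M" "D w = n" "N1 a w = j" for w
    proof -
      have "N1 b w = j + n" using le[OF that(1)] that by (simp add: D_def)
      then show ?thesis using N_diff[OF that(1)] that by (simp del: of_nat_sum)
    qed
    then show ?thesis unfolding E_def by auto
  qed
  have Sm: "?S n j \<in> generated_events M (count_space UNIV) {1..} X" for n j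
  proof -
    let ?G = "generated_algebra M (count_space UNIV) {1..} X"
    have "(\<lambda>w. \<Sum>i\<in>{Suc j..j + n}. X i w) \<in> measurable ?G (count_space UNIV)"
      by (rule measurable_sum_nat) (auto intro!: measurable_generated_algebra)
    then have "(\<lambda>w. \<Sum>i\<in>{Suc j..j + n}. X i w) -` {m} \<inter> space ?G \<in> sets ?G"
      by (rule measurable_sets) simp
    then show ?thesis by (simp add: sets_generated_algebra vimage_def Int_def conj_commute)
  qed
  have Am: "?A n j \<in> generated_events M (count_space UNIV) {0..} N1" for n j
  proof -
    let ?G = "generated_algebra M (count_space UNIV) {0..} N1"
    have [measurable]: "N1 a \<in> measurable ?G (count_space UNIV)" "N1 b \<in> measurable ?G (count_space UNIV)"
      using ab by (auto intro!: measurable_generated_algebra)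
    have "{w\<in>space ?G. D w = n \<and> N1 a w = j} \<in> sets ?G"
      unfolding D_def by measurable
    also have "{w\<in>space ?G. D w = n \<and> N1 a w = j} = ?A n j" by auto
    finally show ?thesis by (simp add: sets_generated_algebra)
  qed
  have EA: "E \<inter> ?A n j \<in> events" "prob (E \<inter> ?A n j) = prob (?A n j) * geom_conv k \<rho> n m" for n j
  proof -
    have "prob (?A n j \<inter> ?S n j) = prob (?A n j) * prob (?S n j)"
      by (rule indep_setD[OF indep Am Sm])
    also have "prob (?S n j) = geom_conv k \<rho> n m"
      by (rule prob_sum_truncated_geometric[OF k \<rho> X indepX])
    finally show "prob (E \<inter> ?A n j) = prob (?A n j) * geom_conv k \<rho> n m"
      unfolding piece .
    have "?A n j \<in> events" "?S n j \<in> events"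
      using Am Sm indep unfolding indep_set_def indep_sets_def by (auto split: bool.splits)
    then show "E \<inter> ?A n j \<in> events" unfolding piece by (rule sets.Int)
  qed
  have "E = (\<Union>n j. E \<inter> ?A n j)" by (auto simp: E_def)
  also have "\<dots> \<in> events"
    by (intro sets.countable_nat_UN image_subsetI) (rule EA(1))
  finally have E: "E \<in> events" .
  have ED: "prob (E \<inter> {w\<in>space M. D w = n}) = exp (- (b - a)) * ((b - a) ^ n / fact n * geom_conv k \<rho> n m)" for n
  proof -
    have "(\<lambda>j. prob (E \<inter> {w\<in>space M. D w = n} \<inter> {w\<in>space M. N1 a w = j})) sums prob (E \<inter> {w\<in>space M. D w = n})"
      by (rule prob_sums_of_nat_partition) (use E in auto)
    then have "(\<lambda>j. prob (?A n j) * geom_conv k \<rho> n m) sums prob (E \<inter> {w\<in>space M. D w = n})"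
      by (simp only: Int_assoc EA(2))
    moreover have "(\<lambda>j. prob (?A n j) * geom_conv k \<rho> n m) sums (prob {w\<in>space M. D w = n} * geom_conv k \<rho> n m)"
      by (intro sums_mult2 prob_sums_of_nat_partition) auto
    ultimately have "prob (E \<inter> {w\<in>space M. D w = n}) = prob {w\<in>space M. D w = n} * geom_conv k \<rho> n m"
      by (rule sums_unique2)
    also have "prob {w\<in>space M. D w = n} = exp (- (b - a)) * (b - a) ^ n / fact n"
    proof -
      have "\<forall>s\<ge>0. \<forall>t\<ge>0. \<forall>n. prob {w\<in>space M. N1 (s + t) w - N1 s w = n} = exp (- (1 * t)) * (1 * t) ^ n / fact n"
        using N1 unfolding poisson_process_def by blast
      from this[rule_format, of a "b - a" n] ab show ?thesis by (simp add: D_def)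
    qed
    finally show ?thesis by simp
  qed
  have "(\<lambda>n. exp (- (b - a)) * ((b - a) ^ n / fact n * geom_conv k \<rho> n m)) sums prob E"
    using prob_sums_of_nat_partition[OF D E] by (simp only: ED)
  moreover have "(\<lambda>n. exp (- (b - a)) * ((b - a) ^ n / fact n * geom_conv k \<rho> n m)) sums
      (\<Sum>n\<le>m. exp (- (b - a)) * ((b - a) ^ n / fact n * geom_conv k \<rho> n m))"
    by (rule sums_finite) (auto simp: geom_conv_eq_0)
  ultimately have "prob E = (\<Sum>n\<le>m. exp (- (b - a)) * ((b - a) ^ n / fact n * geom_conv k \<rho> n m))"
    by (rule sums_unique2)
  then show ?thesis
    unfolding E_def pa_prob_def pa_poly_def by (simp add: sum_distrib_left)
qed

section \<open>Integration along the cumulative rate\<close>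

locale rate_function =
  fixes l :: "real \<Rightarrow> real"
  assumes nonneg: "\<And>u. 0 \<le> u \<Longrightarrow> 0 \<le> l u"
    and integrable: "\<And>t. 0 < t \<Longrightarrow> set_integrable lborel {0..t} l"
begin

abbreviation cum :: "real \<Rightarrow> real" where "cum \<equiv> cumulative_rate l"

lemma integrable_subset: "S \<subseteq> {0..t} \<Longrightarrow> S \<in> sets borel \<Longrightarrow> set_integrable lborel S l"
  by (rule set_integrable_subset[OF integrable[of "max t 1"]], simp, simp, erule order_trans) auto

lemma cum_nonpos: "u \<le> 0 \<Longrightarrow> cum u = 0"
proof -
  assume u: "u \<le> 0"
  show ?thesis
    unfolding cumulative_rate_def set_lebesgue_integral_def
    by (rule integral_eq_zero_AE, use AE_lborel_singleton[of 0] in eventually_elim)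
       (use u in \<open>auto simp: indicator_def\<close>)
qed

lemma cum_diff:
  assumes "0 \<le> a" "a \<le> b"
  shows "cum b = cum a + (LINT w:{a<..b}|lborel. l w)" "0 \<le> (LINT w:{a<..b}|lborel. l w)"
proof -
  have "{0..b} = {0..a} \<union> {a<..b}" using assms by auto
  then have "cum b = (LINT w:{0..a} \<union> {a<..b}|lborel. l w)" by (simp add: cumulative_rate_def)
  also have "\<dots> = cum a + (LINT w:{a<..b}|lborel. l w)"
    unfolding cumulative_rate_def using assms
    by (intro set_integral_Un integrable_subset[of _ b]) auto
  finally show "cum b = cum a + (LINT w:{a<..b}|lborel. l w)" .
  show "0 \<le> (LINT w:{a<..b}|lborel. l w)"
    unfolding set_lebesgue_integral_def
    by (rule Bochner_Integration.integral_nonneg) (use assms nonneg in \<open>auto simp: indicator_def\<close>)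
qed

lemma mono_cum: "mono cum"
proof (rule monoI)
  fix a b :: real assume ab: "a \<le> b"
  show "cum a \<le> cum b"
  proof (cases "0 \<le> a")
    case True
    then show ?thesis using cum_diff[of a b] ab by simp
  next
    case False
    then show ?thesis using cum_diff[of 0 b] cum_nonpos[of 0] cum_nonpos[of a] cum_nonpos[of b] by (cases "0 \<le> b") auto
  qed
qed

lemma cum_nonneg: "0 \<le> cum u"
  using monoD[OF mono_cum, of "min 0 u" u] cum_nonpos[of "min 0 u"] by simp

lemma measurable_cum [measurable]: "cum \<in> borel_measurable borel"
  by (rule borel_measurable_mono[OF mono_cum])

lemma continuous_on_cum: "continuous_on {0..T} cum"
proof -
  have "l integrable_on {0..T}"
    using set_borel_integral_eq_integral(1)[OF integrable_subset[of "{0..T}" T]] by simp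
  then have "continuous_on {0..T} (\<lambda>x. integral {0..x} l)"
    by (rule indefinite_integral_continuous_1)
  moreover have "cum x = integral {0..x} l" for x
    unfolding cumulative_rate_def using set_borel_integral_eq_integral(2)[OF integrable_subset[of "{0..x}" x]] by simp
  ultimately show ?thesis by simp
qed

lemma right_continuous_cum: "(cum \<longlongrightarrow> cum x) (at_right x)"
proof (cases "0 \<le> x")
  case True
  have "continuous (at x within {0..x+1}) cum"
    using continuous_on_cum[of "x + 1"] True by (auto simp: continuous_on_eq_continuous_within)
  then have "(cum \<longlongrightarrow> cum x) (at x within {0..x+1})" by (simp add: continuous_within)
  then have "(cum \<longlongrightarrow> cum x) (at x within {x..x+1})" by (rule tendsto_within_subset) (use True in auto)
  then show ?thesis by (simp add: at_within_Icc_at_right)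
next
  case False
  then have "eventually (\<lambda>y. cum y = cum x) (at_right x)"
    using eventually_at_right_real[of x 0] by (auto elim!: eventually_mono simp: cum_nonpos)
  then show ?thesis by (rule tendsto_eventually)
qed

text \<open>A continuous nondecreasing function transports its own Stieltjes measure to Lebesgue measure. It replaces
  the chain rule, which fails where \<open>cum\<close> is not differentiable. On half-lines \<open>{x<..}\<close> it
  follows from the intermediate value theorem, applied at the last point \<open>w0\<close> with \<open>cum w0 \<le> x\<close>.\<close>

lemma distr_cum:
  assumes U: "0 \<le> U"
  shows "distr (density lborel (\<lambda>w. ennreal (indicator {0..U} w * l w))) borel cum
    = density lborel (indicator {0..cum U})" (is "distr ?\<nu> _ _ = ?\<kappa>")
proof (rule measure_eqI_lessThan)
  have l_meas [measurable]: "(\<lambda>w. indicator {0..U} w * l w) \<in> borel_measurable borel"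
    using integrable_subset[of "{0..U}" U] by (auto simp: set_integrable_def)
  have \<nu>: "emeasure ?\<nu> {a<..b} = ennreal (cum b - cum a)" if ab: "0 \<le> a" "a \<le> b" "b \<le> U" for a b
  proof -
    have "emeasure ?\<nu> {a<..b} = (\<integral>\<^sup>+w. ennreal (indicator {0..U} w * l w) * indicator {a<..b} w \<partial>lborel)"
      by (rule emeasure_density) auto
    also have "\<dots> = (\<integral>\<^sup>+w. ennreal (indicator {a<..b} w * l w) \<partial>lborel)"
      by (rule nn_integral_cong) (use ab in \<open>auto simp: indicator_def\<close>)
    also have "\<dots> = ennreal (LINT w|lborel. indicator {a<..b} w * l w)"
    proof (rule nn_integral_eq_integral)
      have "set_integrable lborel {a<..b} l" using ab by (intro integrable_subset[of _ b]) auto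
      then show "integrable lborel (\<lambda>w. indicator {a<..b} w * l w)" by (simp add: set_integrable_def)
      show "AE w in lborel. 0 \<le> indicator {a<..b} w * l w"
        using ab nonneg by (intro AE_I2) (auto simp: indicator_def)
    qed
    also have "\<dots> = ennreal (cum b - cum a)"
      using cum_diff[OF ab(1,2)] by (simp add: set_lebesgue_integral_def)
    finally show ?thesis .
  qed
  have \<kappa>: "emeasure ?\<kappa> {x<..} = emeasure lborel ({0..cum U} \<inter> {x<..})" for x
    by (simp add: emeasure_density indicator_inter_arith[symmetric])
  show "emeasure (distr ?\<nu> borel cum) {x<..} = emeasure ?\<kappa> {x<..}" for x
  proof -
    have "emeasure (distr ?\<nu> borel cum) {x<..} = emeasure ?\<nu> (cum -` {x<..})"
      by (simp add: emeasure_distr)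
    also have "\<dots> = (\<integral>\<^sup>+w. ennreal (indicator {0..U} w * l w) * indicator (cum -` {x<..}) w \<partial>lborel)"
      using measurable_sets[OF measurable_cum, of "{x<..}"] by (intro emeasure_density) auto
    also have "\<dots> = emeasure ?\<kappa> {x<..}"
    proof (cases "0 \<le> x \<and> x < cum U")
      case True
      let ?S = "{0..U} \<inter> cum -` {..x}"
      have "closed ?S"
        by (rule continuous_closed_preimage[OF continuous_on_cum]) auto
      then have "compact ?S" by (intro compact_Int_closed[of "{0..U}" ?S, simplified Int_absorb2] | simp add: compact_eq_bounded_closed bounded_Int)+
      moreover have "0 \<in> ?S" using U True cum_nonpos[of 0] by simp
      ultimately obtain w0 where w0: "w0 \<in> ?S" "\<And>w. w \<in> ?S \<Longrightarrow> w \<le> w0"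
        using compact_attains_sup[of ?S] by blast
      obtain w1 where w1: "0 \<le> w1" "w1 \<le> U" "cum w1 = x"
        using IVT'[of cum 0 x U] True U continuous_on_cum[of U] cum_nonpos[of 0] by auto
      have "cum w0 = x"
        using w0(1) w0(2)[of w1] w1 monoD[OF mono_cum, of w1 w0] by auto
      have "(\<integral>\<^sup>+w. ennreal (indicator {0..U} w * l w) * indicator (cum -` {x<..}) w \<partial>lborel)
          = (\<integral>\<^sup>+w. ennreal (indicator {0..U} w * l w) * indicator {w0<..U} w \<partial>lborel)"
      proof (rule nn_integral_cong)
        fix w :: real
        show "ennreal (indicator {0..U} w * l w) * indicator (cum -` {x<..}) w
          = ennreal (indicator {0..U} w * l w) * indicator {w0<..U} w"
        proof (cases "w \<in> {0..U}")
          case w: True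
          have "x < cum w \<longleftrightarrow> w0 < w"
            using w w0(2)[of w] monoD[OF mono_cum, of w w0] \<open>cum w0 = x\<close> by force
          then show ?thesis using w by (auto simp: indicator_def)
        qed simp
      qed
      also have "\<dots> = emeasure ?\<nu> {w0<..U}" by (rule emeasure_density[symmetric]) auto
      also have "\<dots> = ennreal (cum U - x)" using w0(1) \<nu>[of w0 U] \<open>cum w0 = x\<close> by auto
      also have "\<dots> = emeasure ?\<kappa> {x<..}"
      proof -
        have "{0..cum U} \<inter> {x<..} = {x<..cum U}" using True by auto
        then show ?thesis using True by (simp add: \<kappa>)
      qed
      finally show ?thesis .
    next
      case False
      then consider "x < 0" | "cum U \<le> x" by linarith
      then show ?thesis
      proof cases
        case 1
        have eq: "ennreal (indicator {0..U} w * l w) * indicator (cum -` {x<..}) w = ennreal (indicator {0..U} w * l w) * indicator {0..U} w" for w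
          using 1 cum_nonneg[of w] by (auto simp: indicator_def)
        have "(\<integral>\<^sup>+w. ennreal (indicator {0..U} w * l w) * indicator (cum -` {x<..}) w \<partial>lborel)
          = (\<integral>\<^sup>+w. ennreal (indicator {0..U} w * l w) * indicator {0<..U} w \<partial>lborel)"
          unfolding eq
          by (intro nn_integral_cong_AE, use AE_lborel_singleton[of 0] in eventually_elim) (auto simp: indicator_def)
        also have "\<dots> = emeasure ?\<nu> {0<..U}" by (rule emeasure_density[symmetric]) auto
        also have "\<dots> = ennreal (cum U)" using \<nu>[of 0 U] U cum_nonpos[of 0] by simp
        also have "{0..cum U} \<inter> {x<..} = {0..cum U}" using 1 by auto
        then have "ennreal (cum U) = emeasure ?\<kappa> {x<..}" using cum_nonneg by (simp add: \<kappa>)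
        finally show ?thesis .
      next
        case 2
        have eq: "ennreal (indicator {0..U} w * l w) * indicator (cum -` {x<..}) w = 0" for w
          using 2 monoD[OF mono_cum, of w U] by (auto simp: indicator_def)
        have "{0..cum U} \<inter> {x<..} = {}" using 2 by auto
        then show ?thesis unfolding eq by (simp add: \<kappa>)
      qed
    qed
    finally show ?thesis .
  qed
  have "emeasure ?\<kappa> {x<..} \<le> emeasure lborel {0..cum U}" for x
    unfolding \<kappa> by (rule emeasure_mono) auto
  then have "emeasure ?\<kappa> {x<..} < \<infinity>" for x
    by (rule le_less_trans) (simp add: cum_nonneg)
  then show "emeasure (distr ?\<nu> borel cum) {x<..} < \<infinity>" for x
    using \<open>\<And>x. emeasure (distr ?\<nu> borel cum) {x<..} = emeasure ?\<kappa> {x<..}\<close> by simp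
qed auto

lemma time_change_integral:
  fixes q \<psi> :: "real \<Rightarrow> real"
  assumes U: "0 \<le> U" and \<psi>: "continuous_on UNIV \<psi>"
    and q: "\<And>\<tau>. (q has_real_derivative \<psi> \<tau>) (at \<tau>)"
  shows "(LINT w:{0..U}|lborel. l w * \<psi> (cum w)) = q (cum U) - q 0"
proof -
  have [measurable]: "(\<lambda>w. indicator {0..U} w * l w) \<in> borel_measurable borel"
    using integrable_subset[of "{0..U}" U] by (auto simp: set_integrable_def)
  have [measurable]: "\<psi> \<in> borel_measurable borel" by (rule borel_measurable_continuous_onI[OF \<psi>])
  let ?\<nu> = "density lborel (\<lambda>w. ennreal (indicator {0..U} w * l w))"
  have "(LINT w|?\<nu>. \<psi> (cum w)) = (LINT w|lborel. (indicator {0..U} w * l w) *\<^sub>R \<psi> (cum w))"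
  proof (rule integral_density)
    show "(\<lambda>w. \<psi> (cum w)) \<in> borel_measurable lborel" by measurable
    show "(\<lambda>w. indicator {0..U} w * l w) \<in> borel_measurable lborel" by measurable
    show "AE w in lborel. 0 \<le> indicator {0..U} w * l w"
      using nonneg by (intro AE_I2) (auto simp: indicator_def)
  qed
  then have "(LINT w:{0..U}|lborel. l w * \<psi> (cum w)) = (LINT w|?\<nu>. \<psi> (cum w))"
    unfolding set_lebesgue_integral_def by (simp add: mult.assoc)
  also have "\<dots> = (LINT \<tau>|distr ?\<nu> borel cum. \<psi> \<tau>)" by (rule integral_distr[symmetric]) auto
  also have "\<dots> = (LINT \<tau>|density lborel (\<lambda>\<tau>. ennreal (indicator {0..cum U} \<tau>)). \<psi> \<tau>)"
    unfolding distr_cum[OF U] by (simp add: ennreal_indicator)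
  also have "\<dots> = (LINT \<tau>|lborel. indicator {0..cum U} \<tau> *\<^sub>R \<psi> \<tau>)"
    by (subst integral_density) auto
  also have "\<dots> = q (cum U) - q 0"
    by (rule integral_FTC_Icc) 
       (use cum_nonneg q \<psi> in \<open>auto simp: has_real_derivative_iff_has_vector_derivative[symmetric] intro: has_field_derivative_at_within continuous_on_subset\<close>)
  finally show ?thesis .
qed

text \<open>Transport over \<open>[0, n]\<close> bounds the integral by the one of \<open>\<bar>\<psi>\<bar>\<close> over the half-line, uniformly in \<open>n\<close>.\<close>

lemma time_change_integrable:
  fixes \<psi> :: "real \<Rightarrow> real"
  assumes \<psi>: "continuous_on UNIV \<psi>" and int: "set_integrable lborel {0..} \<psi>"
  shows "set_integrable lborel {0..} (\<lambda>w. l w * \<psi> (cum w))"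
proof -
  have l_meas [measurable]: "(\<lambda>w. indicator {0..real n} w * l w) \<in> borel_measurable borel" for n
    using integrable_subset[of "{0..real n}" "real n"] by (auto simp: set_integrable_def)
  have "(\<lambda>w. indicator {0..} w * l w) \<in> borel_measurable borel"
  proof (rule borel_measurable_LIMSEQ_real[OF _ l_meas])
    fix w :: real
    have "eventually (\<lambda>n. indicator {0..real n} w * l w = indicator {0..} w * l w) sequentially"
      using eventually_ge_at_top[of "nat \<lceil>w\<rceil>"] by eventually_elim (auto simp: indicator_def)
    then show "(\<lambda>n. indicator {0..real n} w * l w) \<longlonglongrightarrow> indicator {0..} w * l w"
      by (rule tendsto_eventually)
  qed
  moreover have [measurable]: "\<psi> \<in> borel_measurable borel" by (rule borel_measurable_continuous_onI[OF \<psi>])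
  ultimately have meas: "(\<lambda>w. (indicator {0..} w * l w) * \<psi> (cum w)) \<in> borel_measurable borel"
    by measurable
  define b where "b n w = ennreal (indicator {0..real n} w * l w) * ennreal \<bar>\<psi> (cum w)\<bar>" for n w
  define C where "C = (\<integral>\<^sup>+\<tau>. ennreal (indicator {0..} \<tau> * \<bar>\<psi> \<tau>\<bar>) \<partial>lborel)"
  have "C = (\<integral>\<^sup>+\<tau>. ennreal (norm (indicator {0..} \<tau> *\<^sub>R \<psi> \<tau>)) \<partial>lborel)"
    unfolding C_def by (simp add: abs_mult)
  then have C: "C < \<infinity>"
    using int unfolding set_integrable_def integrable_iff_bounded by simp
  have b_le: "(\<integral>\<^sup>+w. b n w \<partial>lborel) \<le> C" for n
  proof -
    let ?\<nu> = "density lborel (\<lambda>w. ennreal (indicator {0..real n} w * l w))"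
    have "(\<integral>\<^sup>+w. b n w \<partial>lborel) = (\<integral>\<^sup>+w. ennreal \<bar>\<psi> (cum w)\<bar> \<partial>?\<nu>)"
      unfolding b_def by (rule nn_integral_density[symmetric]) auto
    also have "\<dots> = (\<integral>\<^sup>+\<tau>. ennreal \<bar>\<psi> \<tau>\<bar> \<partial>distr ?\<nu> borel cum)" by (rule nn_integral_distr[symmetric]) auto
    also have "\<dots> = (\<integral>\<^sup>+\<tau>. indicator {0..cum (real n)} \<tau> * ennreal \<bar>\<psi> \<tau>\<bar> \<partial>lborel)"
      by (subst distr_cum) (auto simp: nn_integral_density)
    also have "\<dots> \<le> C"
      unfolding C_def by (rule nn_integral_mono) (auto simp: indicator_def)
    finally show ?thesis .
  qed
  have "(\<integral>\<^sup>+w. ennreal (norm ((indicator {0..} w * l w) * \<psi> (cum w))) \<partial>lborel) = (\<integral>\<^sup>+w. (SUP n. b n w) \<partial>lborel)"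
  proof (rule nn_integral_cong)
    fix w :: real
    have "(SUP n. b n w) = ennreal (norm ((indicator {0..} w * l w) * \<psi> (cum w)))" (is "_ = ?r")
    proof (rule antisym)
      show "(SUP n. b n w) \<le> ?r"
        by (rule SUP_least) (use nonneg[of w] in \<open>auto simp: b_def indicator_def ennreal_mult[symmetric] abs_mult\<close>)
      have "?r \<le> b (nat \<lceil>w\<rceil>) w"
        using nonneg[of w] by (auto simp: b_def indicator_def ennreal_mult[symmetric] abs_mult)
      also have "\<dots> \<le> (SUP n. b n w)" by (rule SUP_upper) simp
      finally show "?r \<le> (SUP n. b n w)" .
    qed
    then show "ennreal (norm ((indicator {0..} w * l w) * \<psi> (cum w))) = (SUP n. b n w)" ..
  qed
  also have "\<dots> = (SUP n. \<integral>\<^sup>+w. b n w \<partial>lborel)"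
  proof (rule nn_integral_monotone_convergence_SUP)
    show "incseq b"
      by (rule incseq_SucI, rule le_funI) (use nonneg in \<open>auto simp: b_def indicator_def intro!: mult_right_mono\<close>)
    show "b n \<in> borel_measurable lborel" for n unfolding b_def by measurable
  qed
  also have "\<dots> \<le> C" by (rule SUP_least) (rule b_le)
  finally have "integrable lborel (\<lambda>w. (indicator {0..} w * l w) * \<psi> (cum w))"
    using C meas by (intro integrableI_bounded) auto
  then show ?thesis unfolding set_integrable_def by (simp add: mult.assoc)
qed

end

text \<open>Passing to the shifted rate reduces increments over \<open>(v, u + v]\<close> to the case \<open>v = 0\<close>.\<close>

lemma rate_function_shift:
  fixes lam :: "real \<Rightarrow> real"
  assumes lam: "rate_function lam" and v: "0 \<le> v"
  shows "rate_function (\<lambda>u. lam (u + v))"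
    and "0 \<le> u \<Longrightarrow> cumulative_rate (\<lambda>u. lam (u + v)) u = cumulative_rate lam (u + v) - cumulative_rate lam v"
proof -
  interpret rate_function lam by fact
  have eq: "(\<lambda>x. indicator {v..t + v} (v + 1 * x) *\<^sub>R lam (v + 1 * x)) = (\<lambda>x. indicator {0..t} x *\<^sub>R lam (x + v))" for t
    by (auto simp: indicator_def add.commute)
  have "set_integrable lborel {v..t + v} lam" if "0 < t" for t
    using v that by (intro integrable_subset[of _ "t + v"]) auto
  from lborel_integrable_real_affine[OF this[unfolded set_integrable_def], of _ 1 v]
  have int: "set_integrable lborel {0..t} (\<lambda>x. lam (x + v))" if "0 < t" for t
    using that unfolding eq set_integrable_def by simp
  show "rate_function (\<lambda>u. lam (u + v))"
    by unfold_locales (use v nonneg int in auto)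
  assume u: "0 \<le> u"
  have "(LINT x|lborel. indicator {v..u + v} x *\<^sub>R lam x) = (LINT x|lborel. indicator {0..u} x *\<^sub>R lam (x + v))"
    unfolding eq[symmetric] by (subst lborel_integral_real_affine[of 1 _ v]) auto
  moreover have "(LINT x|lborel. indicator {v..u + v} x *\<^sub>R lam x) = (LINT x|lborel. indicator {v<..u + v} x *\<^sub>R lam x)"
  proof (rule integral_cong_AE)
    show "(\<lambda>x. indicator {v..u + v} x *\<^sub>R lam x) \<in> borel_measurable lborel"
      using v integrable_subset[of "{v..u+v}" "u+v"] by (auto simp: set_integrable_def)
    show "(\<lambda>x. indicator {v<..u + v} x *\<^sub>R lam x) \<in> borel_measurable lborel"
    proof -
      have "{v<..u + v} \<subseteq> {0..u + v}" using v by (intro subsetI) auto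
      then show ?thesis using integrable_subset[of "{v<..u+v}" "u+v"] by (auto simp: set_integrable_def)
    qed
    show "AE x in lborel. indicator {v..u + v} x *\<^sub>R lam x = indicator {v<..u + v} x *\<^sub>R lam x"
      using AE_lborel_singleton[of v] by eventually_elim (auto simp: indicator_def)
  qed
  ultimately show "cumulative_rate (\<lambda>u. lam (u + v)) u = cumulative_rate lam (u + v) - cumulative_rate lam v"
    using cum_diff(1)[of v "u + v"] u v
    by (simp add: cumulative_rate_def set_lebesgue_integral_def)
qed

section \<open>Caputo derivatives of mixtures of stable laws\<close>

context stable_law
begin

lemma cdf_bounds: "0 \<le> cdf x" "cdf x \<le> 1" by (simp_all add: cdf_def)

lemma measurable_cdf [measurable]: "cdf \<in> borel_measurable borel"
  by (rule borel_measurable_mono)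
     (auto simp: cdf_def sets_mu intro!: monoI finite_measure_mono)

lemma measurable_time_dens [measurable]: "time_dens u \<in> borel_measurable borel"
  unfolding time_dens_def by measurable

lemma time_dens_nonneg: "0 \<le> time_dens u t" by (simp add: time_dens_def dens_nonneg)

text \<open>The estimate is uniform in \<open>u\<close> because \<open>t * time_dens u t = x * dens x\<close> with \<open>x = t u\<^bsup>-1/\<alpha>\<^esup>\<close>.\<close>

lemma time_dens_bounded: "\<exists>B\<ge>0. \<forall>u t. 0 < t \<longrightarrow> time_dens u t \<le> B / t"
proof -
  obtain B where B: "B \<ge> 0" "\<And>x. x * dens x \<le> B" using dens_bounded by auto
  have "time_dens u t \<le> B / t" if "0 < t" for u t
    using B(2)[of "t * u powr (- 1 / \<alpha>)"] that by (simp add: time_dens_def field_simps)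
  with B(1) show ?thesis by auto
qed

text \<open>Near \<open>t\<close> the difference quotients are dominated by \<open>2 B / t\<close> times \<open>\<bar>\<phi>\<bar>\<close>, by the mean value theorem.\<close>

lemma mixture_derivative:
  assumes \<phi>: "set_integrable lborel {0<..} \<phi>" and t: "0 < t"
  shows "((\<lambda>t. LINT u:{0<..}|lborel. \<phi> u * cdf (t * u powr (- 1 / \<alpha>))) has_real_derivative
    (LINT u:{0<..}|lborel. \<phi> u * time_dens u t)) (at t)"
proof -
  define W where "W u = indicator {0<..} u * \<phi> u" for u :: real
  have W: "integrable lborel W" using \<phi> by (simp add: W_def[abs_def] set_integrable_def)
  then have [measurable]: "W \<in> borel_measurable borel" by auto
  have W0: "W u = 0" if "u \<le> 0" for u using that by (simp add: W_def)
  obtain B where B: "B \<ge> 0" "\<And>u t. 0 < t \<Longrightarrow> time_dens u t \<le> B / t" using time_dens_bounded by auto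
  have eq: "(LINT u:{0<..}|lborel. \<phi> u * f u) = (LINT u|lborel. W u * f u)" for f
    by (simp add: set_lebesgue_integral_def W_def mult.assoc)
  let ?F = "\<lambda>s u. cdf (s * u powr (- 1 / \<alpha>))"
  have int: "integrable lborel (\<lambda>u. W u * ?F s u)" for s
    by (rule Bochner_Integration.integrable_bound[OF W])
       (use cdf_bounds in \<open>auto simp: abs_mult mult_left_le\<close>)
  show ?thesis
    unfolding eq DERIV_def tendsto_at_iff_sequentially comp_def
  proof (intro allI impI)
    fix X :: "nat \<Rightarrow> real" assume X: "\<forall>i. X i \<in> UNIV - {0}" "X \<longlonglongrightarrow> 0"
    have "eventually (\<lambda>n. \<bar>X n\<bar> < t / 2) sequentially"
      using X(2) t by (auto dest!: tendstoD[where e="t/2"] simp: dist_real_def)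
    then obtain n0 where n0: "\<And>n. n \<ge> n0 \<Longrightarrow> \<bar>X n\<bar> < t / 2" by (auto simp: eventually_sequentially)
    \<comment> \<open>From \<open>n0\<close> on the increments stay below \<open>t/2\<close>, where the derivative in \<open>t\<close> is at most \<open>2 B / t\<close>.\<close>
    define Z where "Z n = X (n + n0)" for n
    have Z: "Z n \<noteq> 0" "\<bar>Z n\<bar> < t / 2" for n using X(1) n0 by (auto simp: Z_def)
    have Z0: "filterlim Z (at 0) sequentially"
      unfolding filterlim_at using Z(1) LIMSEQ_ignore_initial_segment[OF X(2), of n0] by (auto simp: Z_def[abs_def])
    have bound: "\<bar>(?F (t + Z n) u - ?F t u) / Z n\<bar> \<le> 2 * B / t" if u: "0 < u" for n u
    proof -
      have "norm (?F (t + Z n) u - ?F t u) \<le> (2 * B / t) * norm (t + Z n - t)"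
      proof (rule field_differentiable_bound)
        show "convex {t/2..3*t/2}" by simp
        fix s assume s: "s \<in> {t/2..3*t/2}"
        show "((\<lambda>s. ?F s u) has_field_derivative time_dens u s) (at s within {t/2..3*t/2})"
          by (rule has_field_derivative_at_within, rule cdf_time_derivative) (use s t u in auto)
        have "time_dens u s \<le> B / s" using B(2)[of s u] s t by simp
        also have "\<dots> \<le> B / (t / 2)" using B s t by (intro divide_left_mono mult_pos_pos) auto
        finally show "norm (time_dens u s) \<le> 2 * B / t" using time_dens_nonneg[of u s] by (simp add: mult.commute)
      next
        show "t + Z n \<in> {t/2..3*t/2}" using Z(2)[of n] by (auto simp: abs_if split: if_splits)
        show "t \<in> {t/2..3*t/2}" using t by auto
      qed
      then show ?thesis using Z(1)[of n] by (simp add: abs_divide field_simps)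
    qed
    have "(\<lambda>n. LINT u|lborel. W u * ((?F (t + Z n) u - ?F t u) / Z n)) \<longlonglongrightarrow> (LINT u|lborel. W u * time_dens u t)"
    proof (rule integral_dominated_convergence[where w="\<lambda>u. \<bar>W u\<bar> * (2 * B / t)"])
      show "integrable lborel (\<lambda>u. \<bar>W u\<bar> * (2 * B / t))" using W by auto
      show "(\<lambda>u. W u * time_dens u t) \<in> borel_measurable lborel" unfolding time_dens_def by measurable
      show "AE u in lborel. norm (W u * ((?F (t + Z n) u - ?F t u) / Z n)) \<le> \<bar>W u\<bar> * (2 * B / t)" for n
      proof (rule AE_I2)
        fix u :: real
        show "norm (W u * ((?F (t + Z n) u - ?F t u) / Z n)) \<le> \<bar>W u\<bar> * (2 * B / t)"
        proof (cases "0 < u")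
          case True
          show ?thesis
            unfolding real_norm_def abs_mult by (intro mult_left_mono bound True) auto
        qed (simp add: W0)
      qed
      show "AE u in lborel. (\<lambda>n. W u * ((?F (t + Z n) u - ?F t u) / Z n)) \<longlonglongrightarrow> W u * time_dens u t"
      proof (rule AE_I2)
        fix u :: real
        show "(\<lambda>n. W u * ((?F (t + Z n) u - ?F t u) / Z n)) \<longlonglongrightarrow> W u * time_dens u t"
        proof (cases "0 < u")
          case True
          show ?thesis
            by (rule tendsto_mult_left, rule filterlim_compose[OF cdf_time_derivative[OF t True, unfolded DERIV_def] Z0])
        qed (simp add: W0)
      qed
    qed measurable
    moreover have "(LINT u|lborel. W u * ((?F (t + Z n) u - ?F t u) / Z n))
        = ((LINT u|lborel. W u * ?F (t + Z n) u) - (LINT u|lborel. W u * ?F t u)) / Z n" for n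
      using int[of "t + Z n"] int[of t] by (simp add: right_diff_distrib)
    ultimately have "(\<lambda>n. ((LINT u|lborel. W u * ?F (t + Z n) u) - (LINT u|lborel. W u * ?F t u)) / Z n)
        \<longlonglongrightarrow> (LINT u|lborel. W u * time_dens u t)"
      by (simp only:)
    then show "(\<lambda>n. ((LINT u|lborel. W u * ?F (t + X n) u) - (LINT u|lborel. W u * ?F t u)) / X n)
        \<longlonglongrightarrow> (LINT u|lborel. W u * time_dens u t)"
      unfolding Z_def by (rule LIMSEQ_offset)
  qed
qed

lemma set_integrable_mixture_inverse_dens:
  assumes \<phi>: "set_integrable lborel {0<..} \<phi>" and t: "0 < t"
  shows "set_integrable lborel {0<..} (\<lambda>u. \<phi> u * inverse_dens t u)"
proof -
  obtain C where C: "C \<ge> 0" "\<And>u. 0 < u \<Longrightarrow> inverse_dens t u \<le> C" using inverse_dens_bounded[OF t] by auto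
  have [measurable]: "(\<lambda>u. indicator {0<..} u * \<phi> u) \<in> borel_measurable borel"
    using \<phi> by (auto simp: set_integrable_def)
  have "integrable lborel (\<lambda>u. (indicator {0<..} u * \<phi> u) * inverse_dens t u)"
  proof (rule Bochner_Integration.integrable_bound)
    show "integrable lborel (\<lambda>u. (indicator {0<..} u * \<phi> u) * C)"
      using \<phi> by (auto simp: set_integrable_def)
    show "AE u in lborel. norm ((indicator {0<..} u * \<phi> u) * inverse_dens t u) \<le> norm ((indicator {0<..} u * \<phi> u) * C)"
      using C inverse_dens_nonneg by (intro AE_I2) (auto simp: indicator_def abs_mult intro!: mult_left_mono)
  qed measurable
  then show ?thesis by (simp add: set_integrable_def mult.assoc)
qed

text \<open>After differentiation under the integral the Caputo derivative is a double integral of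
  \<open>(t - s)\<^bsup>-\<alpha>\<^esup> \<phi>(u) time_dens u s\<close>. Integrating over \<open>s\<close> first gives \<open>\<Gamma>(1 - \<alpha>) \<phi>(u) inverse_dens t u\<close>; as
  \<open>inverse_dens t\<close> is bounded and \<open>\<phi>\<close> is integrable, Fubini applies.\<close>

lemma caputo_mixture:
  assumes \<phi>: "set_integrable lborel {0<..} \<phi>" and t: "0 < t"
    and P: "\<And>s. 0 < s \<Longrightarrow> P s = q0 + (LINT u:{0<..}|lborel. \<phi> u * cdf (s * u powr (- 1 / \<alpha>)))"
  shows "caputo_differentiable \<alpha> P t"
    and "caputo_derivative \<alpha> P t = (LINT u:{0<..}|lborel. \<phi> u * inverse_dens t u)"
proof -
  have der: "(P has_real_derivative (LINT u:{0<..}|lborel. \<phi> u * time_dens u s)) (at s)" if s: "0 < s" for s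
  proof (rule has_field_derivative_transform_within_open[where S="{0<..}"])
    show "((\<lambda>s. q0 + (LINT u:{0<..}|lborel. \<phi> u * cdf (s * u powr (- 1 / \<alpha>)))) has_real_derivative
        (LINT u:{0<..}|lborel. \<phi> u * time_dens u s)) (at s)"
      using mixture_derivative[OF \<phi> s] by (auto intro!: derivative_eq_intros)
  qed (use s P in auto)
  define W where "W u = indicator {0<..} u * \<phi> u" for u :: real
  have W: "integrable lborel W" using \<phi> by (simp add: W_def[abs_def] set_integrable_def)
  then have [measurable]: "W \<in> borel_measurable borel" by auto
  define J where "J u s = abel t s * (W u * time_dens u s)" for u s
  have abel_eq: "abel t = (\<lambda>s. if 0 < s \<and> s < t then (t - s) powr - \<alpha> else 0)" by (simp add: abel_def fun_eq_iff)
  have [measurable]: "case_prod J \<in> borel_measurable (lborel \<Otimes>\<^sub>M lborel)"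
    unfolding J_def abel_eq time_dens_def by measurable
  have inner: "(\<integral>\<^sup>+s. ennreal (abel t s * time_dens u s) \<partial>lborel) = ennreal (Gamma (1 - \<alpha>) * inverse_dens t u)" if "0 < u" for u
    unfolding time_dens_def nn_integral_fractional_integral_scaled[OF that] inverse_dens_def using that Gamma_pos by simp
  have inner_int: "integrable lborel (\<lambda>s. abel t s * time_dens u s)" "(LINT s|lborel. abel t s * time_dens u s) = Gamma (1 - \<alpha>) * inverse_dens t u" if "0 < u" for u
  proof -
    have "has_bochner_integral lborel (\<lambda>s. abel t s * time_dens u s) (Gamma (1 - \<alpha>) * inverse_dens t u)"
      by (rule has_bochner_integral_nn_integral)
         (use that Gamma_pos inverse_dens_nonneg abel_nonneg time_dens_nonneg in \<open>auto simp: inner\<close>)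
    then show "integrable lborel (\<lambda>s. abel t s * time_dens u s)" "(LINT s|lborel. abel t s * time_dens u s) = Gamma (1 - \<alpha>) * inverse_dens t u"
      by (auto simp: has_bochner_integral_iff)
  qed
  have J_inner: "(LINT s|lborel. J u s) = Gamma (1 - \<alpha>) * (indicator {0<..} u * (\<phi> u * inverse_dens t u))" for u
  proof (cases "0 < u")
    case True
    have "(LINT s|lborel. J u s) = (LINT s|lborel. W u * (abel t s * time_dens u s))"
      by (simp add: J_def mult_ac)
    then show ?thesis using True by (simp add: inner_int W_def mult_ac)
  qed (simp add: J_def W_def)
  have "integrable (lborel \<Otimes>\<^sub>M lborel) (case_prod J)"
  proof (rule integrableI_bounded)
    have "(\<integral>\<^sup>+z. ennreal (norm (case_prod J z)) \<partial>(lborel \<Otimes>\<^sub>M lborel)) = (\<integral>\<^sup>+u. \<integral>\<^sup>+s. ennreal (norm (J u s)) \<partial>lborel \<partial>lborel)"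
      by (subst lborel.nn_integral_fst[symmetric]) auto
    also have "\<dots> = (\<integral>\<^sup>+u. ennreal (norm (Gamma (1 - \<alpha>) * (indicator {0<..} u * (\<phi> u * inverse_dens t u)))) \<partial>lborel)"
    proof (rule nn_integral_cong)
      fix u :: real
      show "(\<integral>\<^sup>+s. ennreal (norm (J u s)) \<partial>lborel) = ennreal (norm (Gamma (1 - \<alpha>) * (indicator {0<..} u * (\<phi> u * inverse_dens t u))))"
      proof (cases "0 < u")
        case True
        have "(\<integral>\<^sup>+s. ennreal (norm (J u s)) \<partial>lborel) = (\<integral>\<^sup>+s. ennreal \<bar>W u\<bar> * ennreal (abel t s * time_dens u s) \<partial>lborel)"
          by (intro nn_integral_cong)
             (simp add: J_def abs_mult abel_nonneg time_dens_nonneg ennreal_mult[symmetric] mult_ac)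
        also have "\<dots> = ennreal \<bar>W u\<bar> * ennreal (Gamma (1 - \<alpha>) * inverse_dens t u)"
          unfolding inner[OF True, symmetric] by (rule nn_integral_cmult) measurable
        also have "\<dots> = ennreal (norm (Gamma (1 - \<alpha>) * (indicator {0<..} u * (\<phi> u * inverse_dens t u))))"
          using True inverse_dens_nonneg[OF True, of t] Gamma_pos
          by (simp add: ennreal_mult[symmetric] W_def abs_mult mult_ac)
        finally show ?thesis .
      qed (simp add: J_def W_def)
    qed
    also have "\<dots> < \<infinity>"
    proof -
      have "integrable lborel (\<lambda>u. Gamma (1 - \<alpha>) * (indicator {0<..} u * (\<phi> u * inverse_dens t u)))"
        using set_integrable_mixture_inverse_dens[OF \<phi> t] by (simp add: set_integrable_def)
      then show ?thesis unfolding integrable_iff_bounded by simp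
    qed
    finally show "(\<integral>\<^sup>+z. ennreal (norm (case_prod J z)) \<partial>(lborel \<Otimes>\<^sub>M lborel)) < \<infinity>" .
  qed measurable
  note J_int = this
  have J_outer: "(LINT u|lborel. J u s) = indicator {0<..<t} s * (deriv P s / (t - s) powr \<alpha>)" for s
  proof (cases "0 < s \<and> s < t")
    case True
    have "(LINT u|lborel. J u s) = abel t s * (LINT u|lborel. W u * time_dens u s)" by (simp add: J_def)
    also have "(LINT u|lborel. W u * time_dens u s) = deriv P s"
      using DERIV_imp_deriv[OF der[of s]] True
      by (simp add: set_lebesgue_integral_def W_def mult.assoc)
    finally show ?thesis using True by (simp add: abel_def powr_minus divide_inverse)
  qed (auto simp: J_def abel_def)
  have "integrable lborel (\<lambda>s. LINT u|lborel. J u s)"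
    by (rule lborel_pair.integrable_snd[OF J_int])
  then have si: "set_integrable lborel {0<..<t} (\<lambda>u. deriv P u / (t - u) powr \<alpha>)"
    unfolding J_outer set_integrable_def by simp
  show "caputo_differentiable \<alpha> P t"
    unfolding caputo_differentiable_def using si der by (auto simp: field_differentiable_def) blast
  have "(LINT s|lborel. LINT u|lborel. J u s) = (LINT u|lborel. LINT s|lborel. J u s)"
    by (rule lborel_pair.Fubini_integral[OF J_int])
  then have "(LINT u:{0<..<t}|lborel. deriv P u / (t - u) powr \<alpha>) = Gamma (1 - \<alpha>) * (LINT u:{0<..}|lborel. \<phi> u * inverse_dens t u)"
    unfolding J_outer J_inner by (simp add: set_lebesgue_integral_def)
  then show "caputo_derivative \<alpha> P t = (LINT u:{0<..}|lborel. \<phi> u * inverse_dens t u)"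
    unfolding caputo_derivative_def using Gamma_pos by simp
qed

end

section \<open>Evaluation at a random time and the inverse subordinator\<close>

text \<open>The first multiple of \<open>1/(n + 1)\<close> strictly above \<open>x\<close>. Strictness makes it approach \<open>x\<close> from the
  right, where the paths are continuous.\<close>

definition grid_above :: "nat \<Rightarrow> real \<Rightarrow> real" where
  "grid_above n x = (of_int \<lfloor>(real n + 1) * x\<rfloor> + 1) / (real n + 1)"

lemma grid_above_tendsto: "filterlim (\<lambda>n. grid_above n x) (at_right x) sequentially"
proof -
  have gt: "x < grid_above n x" for n
    unfolding grid_above_def by (subst pos_less_divide_eq) (simp_all add: mult.commute)
  have le: "grid_above n x \<le> x + 1 / (real n + 1)" for n
  proof -
    have "(of_int \<lfloor>(real n + 1) * x\<rfloor> + 1) / (real n + 1) \<le> ((real n + 1) * x + 1) / (real n + 1)"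
      by (intro divide_right_mono) auto
    then show ?thesis by (simp add: grid_above_def add_divide_distrib)
  qed
  have "(\<lambda>n. grid_above n x) \<longlonglongrightarrow> x"
  proof (rule tendsto_sandwich[OF _ _ tendsto_const])
    have "(\<lambda>n. x + 1 / (real n + 1)) \<longlonglongrightarrow> x + 0"
      using LIMSEQ_inverse_real_of_nat by (intro tendsto_intros) (simp add: divide_inverse add.commute)
    then show "(\<lambda>n. x + 1 / (real n + 1)) \<longlonglongrightarrow> x" by simp
  qed (use gt le in \<open>auto intro!: always_eventually less_imp_le\<close>)
  then show ?thesis
    unfolding filterlim_at using gt by (auto intro!: always_eventually simp: less_imp_neq[THEN not_sym])
qed

lemma measurable_at_grid:
  fixes Q :: "real \<Rightarrow> 'w \<Rightarrow> int"
  assumes [measurable]: "V \<in> borel_measurable M" "\<And>s. Q s \<in> measurable M (count_space UNIV)"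
  shows "{w\<in>space M. Q (grid_above n (V w)) w = m} \<in> sets M"
proof -
  have "{w\<in>space M. Q (grid_above n (V w)) w = m}
    = {w\<in>space M. \<exists>j::int. \<lfloor>(real n + 1) * V w\<rfloor> = j \<and> Q ((of_int j + 1) / (real n + 1)) w = m}"
    by (auto simp: grid_above_def)
  also have "\<dots> \<in> sets M" by measurable
  finally show ?thesis .
qed

lemma eventually_at_grid:
  assumes "eventually (\<lambda>r. Q r w = Q s w) (at_right s)"
  shows "eventually (\<lambda>n. Q (grid_above n s) w = Q s w) sequentially"
  using assms grid_above_tendsto[of s] unfolding filterlim_iff by blast

text \<open>An integer-valued right-continuous path takes its value at \<open>V\<close> already at nearby grid points to
  the right, and at these the random time has countably many values.\<close>

lemma measurable_at_random_time:
  fixes Q :: "real \<Rightarrow> 'w \<Rightarrow> int"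
  assumes V: "V \<in> borel_measurable M" and Q: "\<And>s. Q s \<in> measurable M (count_space UNIV)"
    and rc: "\<And>w s. w \<in> space M \<Longrightarrow> eventually (\<lambda>r. Q r w = Q s w) (at_right s)"
  shows "{w\<in>space M. Q (V w) w = m} \<in> sets M"
proof -
  have [measurable]: "Measurable.pred M (\<lambda>w. Q (grid_above n (V w)) w = m)" for n
    using measurable_at_grid[OF V Q] by (simp add: pred_def)
  have "Q (V w) w = m \<longleftrightarrow> (\<exists>n0. \<forall>n\<ge>n0. Q (grid_above n (V w)) w = m)" if "w \<in> space M" for w
  proof -
    have ev: "eventually (\<lambda>n. Q (grid_above n (V w)) w = Q (V w) w) sequentially"
      by (rule eventually_at_grid[of Q, OF rc[OF that]])
    show ?thesis
      unfolding eventually_sequentially[symmetric]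
    proof
      assume "Q (V w) w = m"
      then show "eventually (\<lambda>n. Q (grid_above n (V w)) w = m) sequentially" using ev by simp
    next
      assume "eventually (\<lambda>n. Q (grid_above n (V w)) w = m) sequentially"
      with ev have "eventually (\<lambda>n. Q (V w) w = m) sequentially" by eventually_elim simp
      then show "Q (V w) w = m" by simp
    qed
  qed
  then have "{w\<in>space M. Q (V w) w = m} = {w\<in>space M. \<exists>n0. \<forall>n\<ge>n0. Q (grid_above n (V w)) w = m}"
    by auto
  also have "\<dots> \<in> sets M" by measurable
  finally show ?thesis .
qed

text \<open>Disintegration over an independent random time without a product space: for a time
  on a grid it is a countable sum, and both sides pass to the limit along refining grids.\<close>

lemma (in prob_space) prob_at_random_time:
  fixes Q :: "real \<Rightarrow> 'a \<Rightarrow> int" and V :: "'a \<Rightarrow> real"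
  assumes V [measurable]: "V \<in> borel_measurable M" and Q [measurable]: "\<And>s. Q s \<in> measurable M (count_space UNIV)"
    and rc: "\<And>w s. w \<in> space M \<Longrightarrow> eventually (\<lambda>r. Q r w = Q s w) (at_right s)"
    and V_pos: "AE w in M. 0 < V w"
    and indep: "\<And>s B. B \<in> sets borel \<Longrightarrow>
      prob ({w\<in>space M. Q s w = m} \<inter> (V -` B \<inter> space M)) = prob {w\<in>space M. Q s w = m} * prob (V -` B \<inter> space M)"
  shows "(\<lambda>w. prob {w'\<in>space M. Q (V w) w' = m}) \<in> borel_measurable M"
    and "prob {w\<in>space M. Q (V w) w = m} = (LINT w|M. prob {w'\<in>space M. Q (V w) w' = m})"
proof -
  define f where "f s = prob {w\<in>space M. Q s w = m}" for s
  define E where "E n = {w\<in>space M. Q (grid_above n (V w)) w = m}" for n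
  have E [measurable]: "E n \<in> events" for n unfolding E_def by (rule measurable_at_grid) measurable
  have EV [measurable]: "{w\<in>space M. Q (V w) w = m} \<in> events"
    by (rule measurable_at_random_time[OF V Q rc])
  have f_rc: "(\<lambda>n. f (grid_above n s)) \<longlonglongrightarrow> f s" for s
  proof -
    have "(\<lambda>n. LINT w|M. indicator {w\<in>space M. Q (grid_above n s) w = m} w :: real)
      \<longlonglongrightarrow> (LINT w|M. indicator {w\<in>space M. Q s w = m} w)"
    proof (rule integral_dominated_convergence[where w="\<lambda>_. 1"])
      show "AE w in M. (\<lambda>n. indicator {w\<in>space M. Q (grid_above n s) w = m} w :: real)
          \<longlonglongrightarrow> indicator {w\<in>space M. Q s w = m} w"
      proof (rule AE_I2)
        fix w assume "w \<in> space M"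
        from eventually_at_grid[of Q, OF rc[OF this, of s]]
        show "(\<lambda>n. indicator {w\<in>space M. Q (grid_above n s) w = m} w :: real)
          \<longlonglongrightarrow> indicator {w\<in>space M. Q s w = m} w"
          by (intro tendsto_eventually) (auto elim!: eventually_mono simp: indicator_def)
      qed
    qed (auto simp: indicator_def)
    then show ?thesis by (simp add: f_def)
  qed
  have f01: "0 \<le> f s" "f s \<le> 1" for s by (simp_all add: f_def)
  have f_grid [measurable]: "(\<lambda>w. f (grid_above n (V w))) \<in> borel_measurable M" for n
  proof -
    have "(\<lambda>j::int. f ((of_int j + 1) / (real n + 1))) \<in> measurable (count_space UNIV) borel" by simp
    then show ?thesis unfolding grid_above_def by measurable
  qed
  have f_V [measurable]: "(\<lambda>w. f (V w)) \<in> borel_measurable M"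
    by (rule borel_measurable_LIMSEQ_real[OF f_rc f_grid])
  then show "(\<lambda>w. prob {w'\<in>space M. Q (V w) w' = m}) \<in> borel_measurable M"
    by (simp only: f_def)
  have step: "prob (E n) = (LINT w|M. f (grid_above n (V w)))" for n
  proof -
    define Z where "Z w = nat \<lfloor>(real n + 1) * V w\<rfloor>" for w
    define r where "r j = (real j + 1) / (real n + 1)" for j :: nat
    have Z [measurable]: "Z \<in> measurable M (count_space UNIV)" unfolding Z_def by measurable
    have r: "AE w in M. grid_above n (V w) = r (Z w)"
      using V_pos
    proof eventually_elim
      case (elim w)
      then have "0 \<le> \<lfloor>(real n + 1) * V w\<rfloor>" by simp
      then show ?case unfolding grid_above_def r_def Z_def by simp
    qed
    have pj: "prob (E n \<inter> {w\<in>space M. Z w = j}) = f (r j) * prob {w\<in>space M. Z w = j}" for j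
    proof -
      have "prob (E n \<inter> {w\<in>space M. Z w = j}) = prob ({w\<in>space M. Q (r j) w = m} \<inter> {w\<in>space M. Z w = j})"
      proof (rule finite_measure_eq_AE)
        show "AE w in M. w \<in> E n \<inter> {w\<in>space M. Z w = j}
            \<longleftrightarrow> w \<in> {w\<in>space M. Q (r j) w = m} \<inter> {w\<in>space M. Z w = j}"
          using r by eventually_elim (auto simp: E_def)
      qed measurable
      moreover have ZV: "{w\<in>space M. Z w = j} = V -` {x. nat \<lfloor>(real n + 1) * x\<rfloor> = j} \<inter> space M"
        by (auto simp: Z_def)
      moreover have "prob ({w\<in>space M. Q (r j) w = m} \<inter> (V -` {x. nat \<lfloor>(real n + 1) * x\<rfloor> = j} \<inter> space M))
        = f (r j) * prob (V -` {x. nat \<lfloor>(real n + 1) * x\<rfloor> = j} \<inter> space M)"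
        unfolding f_def by (rule indep) measurable
      ultimately show ?thesis by simp
    qed
    have sums: "(\<lambda>j. f (r j) * prob {w\<in>space M. Z w = j}) sums prob (E n)"
      using prob_sums_of_nat_partition[OF Z E, of n] by (simp only: pj)
    have "(\<integral>\<^sup>+w. ennreal (f (r (Z w))) \<partial>M)
      = (\<integral>\<^sup>+w. (\<Sum>j. ennreal (f (r j)) * indicator {w\<in>space M. Z w = j} w) \<partial>M)"
    proof (rule nn_integral_cong)
      fix w assume "w \<in> space M"
      then have "(\<lambda>j. ennreal (f (r j)) * indicator {w\<in>space M. Z w = j} w)
          = (\<lambda>j. if j = Z w then ennreal (f (r j)) else 0)" by (auto simp: fun_eq_iff)
      then show "ennreal (f (r (Z w))) = (\<Sum>j. ennreal (f (r j)) * indicator {w\<in>space M. Z w = j} w)"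
        using sums_unique[OF sums_single[of "Z w" "\<lambda>j. ennreal (f (r j))"]] by simp
    qed
    also have "\<dots> = (\<Sum>j. \<integral>\<^sup>+w. ennreal (f (r j)) * indicator {w\<in>space M. Z w = j} w \<partial>M)"
      by (rule nn_integral_suminf) measurable
    also have "\<dots> = (\<Sum>j. ennreal (f (r j) * prob {w\<in>space M. Z w = j}))"
      using f01 by (simp add: nn_integral_cmult emeasure_eq_measure ennreal_mult)
    also have "\<dots> = ennreal (prob (E n))"
      using sums f01 by (subst suminf_ennreal2) (auto simp: sums_iff)
    finally have nn: "(\<integral>\<^sup>+w. ennreal (f (r (Z w))) \<partial>M) = ennreal (prob (E n))" .
    have "(LINT w|M. f (grid_above n (V w))) = enn2real (\<integral>\<^sup>+w. ennreal (f (grid_above n (V w))) \<partial>M)"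
      using f01 by (intro integral_eq_nn_integral) auto
    also have "(\<integral>\<^sup>+w. ennreal (f (grid_above n (V w))) \<partial>M) = (\<integral>\<^sup>+w. ennreal (f (r (Z w))) \<partial>M)"
      by (rule nn_integral_cong_AE, use r in eventually_elim) simp
    finally show ?thesis by (simp add: nn)
  qed
  have "(\<lambda>n. LINT w|M. indicator (E n) w :: real) \<longlonglongrightarrow> (LINT w|M. indicator {w\<in>space M. Q (V w) w = m} w)"
  proof (rule integral_dominated_convergence[where w="\<lambda>_. 1"])
    show "AE w in M. (\<lambda>n. indicator (E n) w :: real) \<longlonglongrightarrow> indicator {w\<in>space M. Q (V w) w = m} w"
    proof (rule AE_I2)
      fix w assume "w \<in> space M"
      from eventually_at_grid[of Q, OF rc[OF this], of "V w"]
      show "(\<lambda>n. indicator (E n) w :: real) \<longlonglongrightarrow> indicator {w\<in>space M. Q (V w) w = m} w"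
        by (intro tendsto_eventually) (auto elim!: eventually_mono simp: indicator_def E_def)
    qed
  qed (auto simp: indicator_def)
  then have "(\<lambda>n. prob (E n)) \<longlonglongrightarrow> prob {w\<in>space M. Q (V w) w = m}" by simp
  moreover have "(\<lambda>n. LINT w|M. f (grid_above n (V w))) \<longlonglongrightarrow> (LINT w|M. f (V w))"
    by (rule integral_dominated_convergence[where w="\<lambda>_. 1"]) (use f01 f_rc in auto)
  ultimately show "prob {w\<in>space M. Q (V w) w = m} = (LINT w|M. prob {w'\<in>space M. Q (V w) w' = m})"
    unfolding step f_def by (rule LIMSEQ_unique)
qed

lemma (in prob_space) integral_up_to_random_time:
  fixes V :: "'a \<Rightarrow> real" and W :: "real \<Rightarrow> real"
  assumes V [measurable]: "V \<in> borel_measurable M" and W: "integrable lborel W"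
  shows "(LINT w|M. LINT u|lborel. indicator {..V w} u * W u) = (LINT u|lborel. W u * prob {w\<in>space M. u \<le> V w})"
proof -
  interpret P: pair_sigma_finite M lborel ..
  have [measurable]: "W \<in> borel_measurable borel" using W by auto
  let ?J = "\<lambda>w u. (if u \<le> V w then 1 else 0) * W u"
  have J: "integrable (M \<Otimes>\<^sub>M lborel) (case_prod ?J)"
  proof (rule integrableI_bounded)
    have "(\<integral>\<^sup>+z. ennreal (norm (case_prod ?J z)) \<partial>(M \<Otimes>\<^sub>M lborel)) = (\<integral>\<^sup>+w. \<integral>\<^sup>+u. ennreal (norm (?J w u)) \<partial>lborel \<partial>M)"
      by (subst lborel.nn_integral_fst[symmetric]) auto
    also have "\<dots> \<le> (\<integral>\<^sup>+w. \<integral>\<^sup>+u. ennreal (norm (W u)) \<partial>lborel \<partial>M)"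
      by (intro nn_integral_mono) auto
    also have "\<dots> = (\<integral>\<^sup>+u. ennreal (norm (W u)) \<partial>lborel)" by (simp add: emeasure_space_1)
    also have "\<dots> < \<infinity>" using W by (simp add: integrable_iff_bounded)
    finally show "(\<integral>\<^sup>+z. ennreal (norm (case_prod ?J z)) \<partial>(M \<Otimes>\<^sub>M lborel)) < \<infinity>" .
  qed measurable
  have "(LINT w|M. LINT u|lborel. indicator {..V w} u * W u) = (LINT w|M. LINT u|lborel. ?J w u)"
    by (intro Bochner_Integration.integral_cong) (auto simp: indicator_def)
  also have "\<dots> = (LINT u|lborel. LINT w|M. ?J w u)" by (rule P.Fubini_integral[OF J, symmetric])
  also have "\<dots> = (LINT u|lborel. W u * prob {w\<in>space M. u \<le> V w})"
  proof (rule Bochner_Integration.integral_cong[OF refl])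
    fix u :: real
    have "(LINT w|M. ?J w u) = (LINT w|M. W u * indicator {w\<in>space M. u \<le> V w} w)"
      by (intro Bochner_Integration.integral_cong) auto
    then show "(LINT w|M. ?J w u) = W u * prob {w\<in>space M. u \<le> V w}" by simp
  qed
  finally show ?thesis .
qed

text \<open>Self-similarity follows from the Laplace transforms.\<close>

lemma (in prob_space) stable_law_of_subordinator:
  assumes \<alpha>: "0 < \<alpha>" "\<alpha> < 1" and L: "stable_subordinator M \<alpha> L"
  shows "stable_law \<alpha> (distr M borel (L 1))"
    and "0 < u \<Longrightarrow> prob {w\<in>space M. L u w \<le> t} = measure (distr M borel (L 1)) {..t * u powr (- 1 / \<alpha>)}"
proof -
  have Lm [measurable]: "L t \<in> borel_measurable M" if "0 \<le> t" for t
    using L that by (simp add: stable_subordinator_def levy_process_def)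
  have Lpos: "AE w in M. \<forall>t\<ge>0. 0 \<le> L t w"
  proof -
    have "AE w in M. L 0 w = 0" "AE w in M. mono_on {0..} (\<lambda>t. L t w)"
      using L by (auto simp: stable_subordinator_def levy_process_def)
    then show ?thesis
    proof eventually_elim
      case (elim w)
      show ?case
      proof (intro allI impI)
        fix t :: real assume "0 \<le> t"
        then show "0 \<le> L t w" using mono_onD[OF elim(2), of 0 t] elim(1) by simp
      qed
    qed
  qed
  have Lpos': "AE w in M. 0 \<le> L t w" if "0 \<le> t" for t
    using Lpos by eventually_elim (use that in blast)
  have Llap: "integrable M (\<lambda>w. exp (- s * L t w))" "(LINT w|M. exp (- s * L t w)) = exp (- t * s powr \<alpha>)"
    if "0 \<le> t" "0 \<le> s" for t s
    using L that by (auto simp: stable_subordinator_def)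
  show law: "stable_law \<alpha> (distr M borel (L 1))"
  proof (rule stable_law.intro)
    show "prob_space (distr M borel (L 1))" by (rule prob_space_distr) simp
    show "AE x in distr M borel (L 1). 0 \<le> x"
      using Lpos'[of 1] by (simp add: AE_distr_iff)
    show "(LINT x|distr M borel (L 1). exp (- s * x)) = exp (- (s powr \<alpha>))" if "0 \<le> s" for s
      using Llap(2)[of 1 s] that by (simp add: integral_distr)
  qed (use \<alpha> in auto)
  interpret S: stable_law \<alpha> "distr M borel (L 1)" by (rule law)
  assume u: "0 < u"
  define v where "v = u powr (1 / \<alpha>)"
  have v: "0 < v" "v powr \<alpha> = u" using u \<alpha> by (auto simp: v_def powr_powr)
  have "distr M borel (L u) = distr M borel (\<lambda>w. v * L 1 w)"
  proof (rule finite_measure_eqI_laplace)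
    show "finite_measure (distr M borel (L u))" "finite_measure (distr M borel (\<lambda>w. v * L 1 w))"
      using u by (auto intro!: prob_space.finite_measure prob_space_distr)
    show "AE x in distr M borel (L u). 0 \<le> x"
      using Lpos'[of u] u by (simp add: AE_distr_iff)
    show "AE x in distr M borel (\<lambda>w. v * L 1 w). 0 \<le> x"
      using Lpos'[of 1] v by (simp add: AE_distr_iff zero_le_mult_iff)
    fix n :: nat
    have "(\<integral>\<^sup>+x. ennreal (exp (- (real n * x))) \<partial>distr M borel (L u)) = ennreal (exp (- u * real n powr \<alpha>))"
      using Llap[of u "real n"] u by (simp add: nn_integral_distr nn_integral_eq_integral)
    moreover have "(\<integral>\<^sup>+x. ennreal (exp (- (real n * x))) \<partial>distr M borel (\<lambda>w. v * L 1 w)) = ennreal (exp (- 1 * (real n * v) powr \<alpha>))"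
      using Llap[of 1 "real n * v"] v by (simp add: nn_integral_distr nn_integral_eq_integral mult.assoc)
    moreover have "(real n * v) powr \<alpha> = u * real n powr \<alpha>" using v by (simp add: powr_mult)
    ultimately show "(\<integral>\<^sup>+x. ennreal (exp (- (real n * x))) \<partial>distr M borel (L u))
      = (\<integral>\<^sup>+x. ennreal (exp (- (real n * x))) \<partial>distr M borel (\<lambda>w. v * L 1 w))" by simp
  qed auto
  then have "measure (distr M borel (L u)) {..t} = measure (distr M borel (\<lambda>w. v * L 1 w)) {..t}" by simp
  moreover have "v * x \<le> t \<longleftrightarrow> x \<le> t * u powr (- 1 / \<alpha>)" for x
  proof -
    have "u powr (- 1 / \<alpha>) = inverse v" by (simp add: v_def powr_minus[symmetric])
    then show ?thesis using v by (simp only:) (simp add: field_simps)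
  qed
  ultimately show "prob {w\<in>space M. L u w \<le> t} = measure (distr M borel (L 1)) {..t * u powr (- 1 / \<alpha>)}"
    using u by (simp add: measure_distr vimage_def Int_def conj_commute)
qed

text \<open>Both implications rest on the monotonicity of \<open>L\<close>. For the second the set defining the
  infimum has to be nonempty, that is, \<open>L\<close> must exceed \<open>t\<close> eventually: by Markov's inequality
  \<open>P(L(n) \<le> t) \<le> exp (t - n)\<close>.\<close>

lemma (in prob_space) inverse_subordinator_bounds:
  assumes \<alpha>: "0 < \<alpha>" "\<alpha> < 1" and L: "stable_subordinator M \<alpha> L" and t: "0 \<le> t"
    and Y: "AE w in M. Y w = Inf {u. 0 < u \<and> t < L u w}" and u: "0 < u"
  shows "AE w in M. (u < Y w \<longrightarrow> L u w \<le> t) \<and> (L u w \<le> t \<longrightarrow> u \<le> Y w)"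
proof -
  have Lm [measurable]: "L t \<in> borel_measurable M" if "0 \<le> t" for t
    using L that by (simp add: stable_subordinator_def levy_process_def)
  have mono: "AE w in M. mono_on {0..} (\<lambda>t. L t w)"
    using L by (auto simp: stable_subordinator_def)
  have unb: "AE w in M. \<exists>n. t < L (real (Suc n)) w"
  proof -
    have "prob {w\<in>space M. \<forall>n. L (real (Suc n)) w \<le> t} \<le> exp t * exp (- real (Suc n))" for n
    proof -
      have int: "integrable M (\<lambda>w. exp (- 1 * L (real (Suc n)) w))"
         "(LINT w|M. exp (- 1 * L (real (Suc n)) w)) = exp (- real (Suc n) * 1 powr \<alpha>)"
        using L[unfolded stable_subordinator_def, THEN conjunct2, THEN conjunct2, rule_format, of "real (Suc n)" 1] by auto
      have "prob {w\<in>space M. \<forall>n. L (real (Suc n)) w \<le> t} = (LINT w|M. indicator {w\<in>space M. \<forall>n. L (real (Suc n)) w \<le> t} w)"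
        by simp
      also have "\<dots> \<le> (LINT w|M. exp t * exp (- 1 * L (real (Suc n)) w))"
      proof (rule integral_mono)
        show "integrable M (indicat_real {w\<in>space M. \<forall>n. L (real (Suc n)) w \<le> t})"
          by (intro integrable_real_indicator) (auto simp: emeasure_eq_measure)
        show "integrable M (\<lambda>w. exp t * exp (- 1 * L (real (Suc n)) w))"
          using int by (intro integrable_mult_right)
        show "indicat_real {w\<in>space M. \<forall>n. L (real (Suc n)) w \<le> t} w \<le> exp t * exp (- 1 * L (real (Suc n)) w)" for w
          by (auto simp: indicator_def exp_add[symmetric] simp del: of_nat_Suc)
      qed
      also have "\<dots> = exp t * exp (- real (Suc n))" using int by simp
      finally show ?thesis .
    qed
    note le = this
    have "(\<lambda>n. exp t * exp (- real (Suc n))) \<longlonglongrightarrow> 0" by real_asymp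
    then have "prob {w\<in>space M. \<forall>n. L (real (Suc n)) w \<le> t} \<le> 0"
      by (rule LIMSEQ_le_const) (use le in blast)
    then have "{w\<in>space M. \<forall>n. L (real (Suc n)) w \<le> t} \<in> null_sets M"
      by (auto simp: null_sets_def emeasure_eq_measure ennreal_eq_0_iff)
    from AE_not_in[OF this] show ?thesis by (auto elim!: eventually_mono simp: not_le)
  qed
  show "AE w in M. (u < Y w \<longrightarrow> L u w \<le> t) \<and> (L u w \<le> t \<longrightarrow> u \<le> Y w)"
    using mono unb Y
  proof eventually_elim
    case (elim w)
    let ?S = "{u. 0 < u \<and> t < L u w}"
    have bdd: "bdd_below ?S" by (rule bdd_belowI[of _ 0]) auto
    obtain n where "t < L (real (Suc n)) w" using elim(2) by blast
    then have "real (Suc n) \<in> ?S" by (simp del: of_nat_Suc)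
    then have ne: "?S \<noteq> {}" by blast
    show ?case
    proof (intro conjI impI)
      assume "u < Y w"
      then have "u \<notin> ?S" using cInf_lower[OF _ bdd, of u] elim(3) by auto
      then show "L u w \<le> t" using u by auto
    next
      assume "L u w \<le> t"
      then have "u \<le> x" if "x \<in> ?S" for x
        using elim(1) that u by (auto simp: mono_on_def) (meson less_le_not_le linorder_linear order_trans less_imp_le)
      then show "u \<le> Y w" unfolding elim(3) using ne by (intro cInf_greatest) auto
    qed
  qed
qed

text \<open>The subordinator is positive at each time \<open>1/(n + 1)\<close>, because its law has no atom at \<open>0\<close>.\<close>

lemma (in prob_space) inverse_subordinator_at_0:
  assumes \<alpha>: "0 < \<alpha>" "\<alpha> < 1" and L: "stable_subordinator M \<alpha> L"
    and Y: "AE w in M. Y w = Inf {u. 0 < u \<and> 0 < L u w}"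
  shows "AE w in M. Y w = 0"
proof -
  interpret S: stable_law \<alpha> "distr M borel (L 1)" by (rule stable_law_of_subordinator(1)[OF \<alpha> L])
  have [measurable]: "L t \<in> borel_measurable M" if "0 \<le> t" for t
    using L that by (simp add: stable_subordinator_def levy_process_def)
  have "measure (distr M borel (L 1)) {..0} = 0"
  proof -
    have "AE x in distr M borel (L 1). x \<notin> {..0}" using S.pos by eventually_elim auto
    then show ?thesis by (subst S.prob_eq_0) auto
  qed
  then have "prob {w\<in>space M. L u w \<le> 0} = 0" if "0 < u" for u
    using stable_law_of_subordinator(2)[OF \<alpha> L that, of 0] by simp
  then have "AE w in M. \<not> L (inverse (real (Suc n))) w \<le> 0" for n
  proof -
    have "{w\<in>space M. L (inverse (real (Suc n))) w \<le> 0} \<in> events" by measurable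
    from prob_eq_0[OF this] \<open>\<And>u. 0 < u \<Longrightarrow> prob {w\<in>space M. L u w \<le> 0} = 0\<close>
    have "AE w in M. w \<notin> {w\<in>space M. L (inverse (real (Suc n))) w \<le> 0}" by simp
    with AE_space show ?thesis by eventually_elim auto
  qed
  then have "AE w in M. \<forall>n. \<not> L (inverse (real (Suc n))) w \<le> 0" by (simp add: AE_all_countable)
  with Y show ?thesis
  proof eventually_elim
    case (elim w)
    let ?S = "{u. 0 < u \<and> 0 < L u w}"
    have mem: "inverse (real (Suc n)) \<in> ?S" for n using elim(2) by (auto simp: not_le simp del: of_nat_Suc)
    have "bdd_below ?S" by (rule bdd_belowI[of _ 0]) auto
    then have "Inf ?S \<le> inverse (real (Suc n))" for n by (rule cInf_lower[OF mem])
    then have "Inf ?S \<le> 0" by (intro LIMSEQ_le_const[OF LIMSEQ_inverse_real_of_nat]) auto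
    moreover have "0 \<le> Inf ?S"
    proof (rule cInf_greatest)
      show "?S \<noteq> {}" using mem[of 0] by blast
    qed auto
    ultimately show ?case using elim(1) by simp
  qed
qed

section \<open>The subordinated Polya-Aeppli process\<close>

lemma (in prob_space) measurable_of_generated_events:
  assumes sub: "generated_events M B I Z \<subseteq> events" and i: "i \<in> I" and B: "space B = UNIV"
  shows "Z i \<in> measurable M B"
proof (rule measurableI)
  fix A assume "A \<in> sets B"
  then have "Z i -` A \<inter> space M \<in> generated_events M B I Z"
    using i unfolding generated_events_def by (intro sigma_sets.Basic) auto
  then show "Z i -` A \<inter> space M \<in> events" using sub by auto
qed (simp add: B)

text \<open>A right-continuous counting path is constant on a short interval to the right. The
  interval is half-open, so that it also covers the points where the cumulative rate stays constant.\<close>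

lemma polya_aeppli_right_continuous:
  assumes N: "polya_aeppli_process M k \<rho> N" and w: "w \<in> space M" and t: "0 \<le> t"
  shows "\<exists>e>0. \<forall>s. t \<le> s \<longrightarrow> s < t + e \<longrightarrow> N s w = N t w"
proof -
  obtain N1 X where N1: "poisson_process M 1 N1"
    and N_eq: "\<forall>t\<ge>0. \<forall>w\<in>space M. N t w = (\<Sum>i = 1..N1 t w. X i w)"
    using N unfolding polya_aeppli_process_def by blast
  have "continuous (at_right t) (\<lambda>s. real (N1 s w))"
    using N1 w t unfolding poisson_process_def by blast
  then have "((\<lambda>s. real (N1 s w)) \<longlongrightarrow> real (N1 t w)) (at_right t)"
    by (simp add: continuous_within)
  then have "eventually (\<lambda>s. dist (real (N1 s w)) (real (N1 t w)) < 1) (at_right t)"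
    by (rule tendstoD) simp
  then have "eventually (\<lambda>s. N1 s w = N1 t w) (at_right t)"
  proof eventually_elim
    case (elim s)
    then have "real (N1 s w) < real (Suc (N1 t w))" "real (N1 t w) < real (Suc (N1 s w))"
      unfolding dist_real_def by linarith+
    then show ?case unfolding of_nat_less_iff by linarith
  qed
  then obtain b where b: "b > t" "\<And>s. t < s \<Longrightarrow> s < b \<Longrightarrow> N1 s w = N1 t w"
    unfolding eventually_at_right_field by blast
  have eq: "N s w = N t w" if "t \<le> s" "s < b" for s
    using b(2)[of s] that t w N_eq by (cases "s = t") auto
  show ?thesis
  proof (intro exI[of _ "b - t"] conjI allI impI)
    fix s assume "t \<le> s" "s < t + (b - t)"
    then show "N s w = N t w" by (intro eq) auto
  qed (use b(1) in simp)
qed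

text \<open>The density in \<open>u\<close> of \<open>pa_prob m (A u)\<close>, where \<open>A\<close> is the cumulative rate from \<open>v\<close> on.\<close>

definition pa_increment_rate :: "nat \<Rightarrow> real \<Rightarrow> (real \<Rightarrow> real) \<Rightarrow> real \<Rightarrow> nat \<Rightarrow> real \<Rightarrow> real" where
  "pa_increment_rate k \<rho> lam v m u = lam (u + v) * pa_deriv k \<rho> m (cumulative_rate (\<lambda>u. lam (u + v)) u)"

context
  fixes M :: "'w measure"
    and \<alpha> \<rho> :: real and k :: nat
    and lam :: "real \<Rightarrow> real"
    and N :: "real \<Rightarrow> 'w \<Rightarrow> nat"
    and Y :: "real \<Rightarrow> 'w \<Rightarrow> real"
    and h :: "real \<Rightarrow> real \<Rightarrow> real"
  assumes M: "prob_space M"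
    and \<alpha>: "0 < \<alpha>" "\<alpha> < 1"
    and k: "1 \<le> k"
    and \<rho>: "0 \<le> \<rho>" "\<rho> < 1"
    and lam: "rate_function lam"
    and N: "polya_aeppli_process M k \<rho> N"
    and Y: "inverse_stable_subordinator M \<alpha> Y"
    and indep: "prob_space.indep_set M
           (generated_events M (count_space UNIV) {0..} N)
           (generated_events M borel {0..} Y)"
    and h_ge_0: "\<forall>t>0. \<forall>u>0. 0 \<le> h t u"
    and h_is_density: "\<forall>t>0. distributed M lborel (Y t) (\<lambda>u. ennreal (indicator {0<..} u * h t u))"
begin

interpretation prob_space M by (rule M)

lemma h_nonneg: "0 < t \<Longrightarrow> 0 < u \<Longrightarrow> 0 \<le> h t u"
  by (rule h_ge_0[rule_format])

lemma h: "0 < t \<Longrightarrow> distributed M lborel (Y t) (\<lambda>u. ennreal (indicator {0<..} u * h t u))"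
  by (rule h_is_density[rule_format])

interpretation R: rate_function lam by (rule lam)

abbreviation "f \<equiv> increment_prob M N (cumulative_rate lam)"

abbreviation "p \<equiv> subordinated_increment_prob M N (cumulative_rate lam) Y"

lemma generated_events_N: "generated_events M (count_space UNIV) {0..} N \<subseteq> events"
  using indep unfolding indep_set_def indep_sets_def by (auto split: bool.splits)

lemma measurable_N: "0 \<le> t \<Longrightarrow> N t \<in> measurable M (count_space UNIV)"
  by (rule measurable_of_generated_events[OF generated_events_N]) auto

lemma measurable_Y: "0 \<le> t \<Longrightarrow> Y t \<in> borel_measurable M"
  using Y by (simp add: inverse_stable_subordinator_def)

definition increment :: "real \<Rightarrow> real \<Rightarrow> 'w \<Rightarrow> int" where
  "increment v u w = int (N (cumulative_rate lam (u + v)) w) - int (N (cumulative_rate lam v) w)"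

lemma measurable_increment: "increment v u \<in> measurable M (count_space UNIV)"
  unfolding increment_def using measurable_N[OF R.cum_nonneg[of "u + v"]] measurable_N[OF R.cum_nonneg[of v]]
  by measurable

lemma right_continuous_increment:
  assumes w: "w \<in> space M" shows "eventually (\<lambda>r. increment v r w = increment v s w) (at_right s)"
proof -
  let ?L = "cumulative_rate lam"
  obtain e where e: "e > 0" "\<And>r. ?L (s + v) \<le> r \<Longrightarrow> r < ?L (s + v) + e \<Longrightarrow> N r w = N (?L (s + v)) w"
    using polya_aeppli_right_continuous[OF N w R.cum_nonneg[of "s + v"]] by auto
  have "filterlim (\<lambda>r. r + v) (at_right (s + v)) (at_right s)"
    by (auto simp: filterlim_at_right_to_0[of _ _ s] filterlim_at eventually_at_filter add.assoc intro!: tendsto_eq_intros)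
  then have "((\<lambda>r. ?L (r + v)) \<longlongrightarrow> ?L (s + v)) (at_right s)"
    by (rule filterlim_compose[OF R.right_continuous_cum])
  then have "eventually (\<lambda>r. ?L (r + v) < ?L (s + v) + e) (at_right s)"
    by (rule order_tendstoD) (use e in simp)
  moreover have "eventually (\<lambda>r. s < r) (at_right s)" by (rule eventually_at_right_less)
  ultimately show ?thesis
  proof eventually_elim
    case (elim r)
    then have "?L (s + v) \<le> ?L (r + v)" by (intro monoD[OF R.mono_cum]) auto
    then show ?case using e(2)[of "?L (r + v)"] elim by (simp add: increment_def)
  qed
qed

lemma increment_event_generated: "{w\<in>space M. increment v s w = m} \<in> generated_events M (count_space UNIV) {0..} N"
proof -
  let ?G = "generated_algebra M (count_space UNIV) {0..} N"
  have [measurable]: "N (cumulative_rate lam (s + v)) \<in> measurable ?G (count_space UNIV)"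
    "N (cumulative_rate lam v) \<in> measurable ?G (count_space UNIV)"
    using R.cum_nonneg by (auto intro!: measurable_generated_algebra)
  have "{w\<in>space ?G. increment v s w = m} \<in> sets ?G" unfolding increment_def by measurable
  then show ?thesis by (simp add: sets_generated_algebra)
qed

lemma increment_indep:
  assumes "0 \<le> t" "B \<in> sets borel"
  shows "prob ({w\<in>space M. increment v s w = m} \<inter> (Y t -` B \<inter> space M)) = prob {w\<in>space M. increment v s w = m} * prob (Y t -` B \<inter> space M)"
proof (rule indep_setD[OF indep increment_event_generated])
  show "Y t -` B \<inter> space M \<in> generated_events M borel {0..} Y"
    using assms unfolding generated_events_def by (intro sigma_sets.Basic) auto
qed

lemma Y_pos: assumes t: "0 < t" shows "AE w in M. 0 < Y t w"
proof -
  have "distr M lborel (Y t) = density lborel (\<lambda>u. ennreal (indicator {0<..} u * h t u))"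
    using h[OF t] by (simp add: distributed_def)
  moreover have "AE u in density lborel (\<lambda>u. ennreal (indicator {0<..} u * h t u)). 0 < u"
    using distributed_borel_measurable[OF h[OF t]] by (subst AE_density) (auto simp: indicator_def)
  ultimately have "AE u in distr M lborel (Y t). 0 < u" by (simp only:)
  then show ?thesis using measurable_Y[of t] t by (subst (asm) AE_distr_iff) auto
qed

text \<open>The events \<open>u < Y(t)\<close>, \<open>L(u) \<le> t\<close> and \<open>u \<le> Y(t)\<close> are nested up to null sets, and the outer two have the same
  probability as \<open>Y(t)\<close> has a density. Hence the law of \<open>Y(t)\<close> is the one with density \<open>inverse_dens\<close>, and \<open>h\<close> agrees
  with it almost everywhere.\<close>

lemma law_of_Y:
  obtains \<mu> where "stable_law \<alpha> \<mu>"
    and "\<And>t u. 0 < t \<Longrightarrow> 0 < u \<Longrightarrow> prob {w\<in>space M. u \<le> Y t w} = stable_law.cdf \<mu> (t * u powr (- 1 / \<alpha>))"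
    and "\<And>t. 0 < t \<Longrightarrow> AE u in lborel. 0 < u \<longrightarrow> h t u = stable_law.inverse_dens \<alpha> \<mu> t u"
    and "AE w in M. Y 0 w = 0"
proof -
  obtain L where L: "stable_subordinator M \<alpha> L"
    and YL: "AE w in M. \<forall>t\<ge>0. Y t w = Inf {u. 0 < u \<and> t < L u w}"
    using Y unfolding inverse_stable_subordinator_def by blast
  have YL': "AE w in M. Y t w = Inf {u. 0 < u \<and> t < L u w}" if "0 \<le> t" for t
    using YL by eventually_elim (use that in blast)
  define \<mu> where "\<mu> = distr M borel (L 1)"
  interpret S: stable_law \<alpha> \<mu> unfolding \<mu>_def by (rule stable_law_of_subordinator(1)[OF \<alpha> L])
  have F: "prob {w\<in>space M. L u w \<le> t} = S.cdf (t * u powr (- 1 / \<alpha>))" if "0 < u" for t u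
    unfolding S.cdf_def unfolding \<mu>_def by (rule stable_law_of_subordinator(2)[OF \<alpha> L that])
  have [measurable]: "L u \<in> borel_measurable M" if "0 \<le> u" for u
    using L that by (simp add: stable_subordinator_def levy_process_def)
  have [measurable]: "Y t \<in> borel_measurable M" if "0 \<le> t" for t by (rule measurable_Y[OF that])
  have dist: "distr M lborel (Y t) = density lborel (\<lambda>u. ennreal (indicator {0<..} u * h t u))" if "0 < t" for t
    using h[OF that] by (simp add: distributed_def)
  have hm [measurable]: "(\<lambda>u. ennreal (indicator {0<..} u * h t u)) \<in> borel_measurable borel" if "0 < t" for t
    using distributed_borel_measurable[OF h[OF that]] by simp
  have le_eq: "prob {w\<in>space M. u \<le> Y t w} = prob {w\<in>space M. u < Y t w}" if t: "0 < t" for t u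
  proof (rule finite_measure_eq_AE)
    have "AE x in distr M lborel (Y t). x \<noteq> u"
      unfolding dist[OF t] using AE_lborel_singleton[of u] hm[OF t] by (subst AE_density) auto
    then have "AE w in M. Y t w \<noteq> u" using t by (subst (asm) AE_distr_iff) auto
    then show "AE w in M. w \<in> {w\<in>space M. u \<le> Y t w} \<longleftrightarrow> w \<in> {w\<in>space M. u < Y t w}"
      by eventually_elim auto
    have [measurable]: "Y t \<in> borel_measurable M" using t by (intro measurable_Y) simp
    show "{w\<in>space M. u \<le> Y t w} \<in> events" "{w\<in>space M. u < Y t w} \<in> events" by measurable
  qed
  have law: "prob {w\<in>space M. u \<le> Y t w} = S.cdf (t * u powr (- 1 / \<alpha>))" if t: "0 < t" and u: "0 < u" for t u
  proof -
    note b = inverse_subordinator_bounds[OF \<alpha> L less_imp_le[OF t] YL'[OF less_imp_le[OF t]] u]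
    have "prob {w\<in>space M. u < Y t w} \<le> prob {w\<in>space M. L u w \<le> t}"
      by (rule finite_measure_mono_AE, use b in eventually_elim) (use t u in auto)
    moreover have "prob {w\<in>space M. L u w \<le> t} \<le> prob {w\<in>space M. u \<le> Y t w}"
      by (rule finite_measure_mono_AE, use b in eventually_elim) (use t u in auto)
    ultimately show ?thesis using le_eq[OF t] F[OF u] by simp
  qed
  have dens: "AE u in lborel. 0 < u \<longrightarrow> h t u = S.inverse_dens t u" if t: "0 < t" for t
  proof -
    let ?d1 = "density lborel (\<lambda>u. ennreal (indicator {0<..} u * h t u))"
    let ?d2 = "density lborel (\<lambda>u. ennreal (indicator {0<..} u * S.inverse_dens t u))"
    have pos: "emeasure ?d1 {x<..} = emeasure ?d2 {x<..}" if x: "0 < x" for x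
    proof -
      have "emeasure ?d1 {x<..} = emeasure (distr M lborel (Y t)) {x<..}" by (simp add: dist[OF t])
      also have "\<dots> = ennreal (prob {w\<in>space M. x < Y t w})"
        using t by (simp add: emeasure_distr emeasure_eq_measure vimage_def Int_def conj_commute)
      also have "\<dots> = ennreal (S.cdf (t * x powr (- 1 / \<alpha>)))" using le_eq[OF t] law[OF t x] by simp
      also have "\<dots> = (\<integral>\<^sup>+u. ennreal (S.inverse_dens t u) * indicator {x..} u \<partial>lborel)"
        using S.nn_integral_inverse_dens[OF t x] by simp
      also have "\<dots> = (\<integral>\<^sup>+u. ennreal (indicator {0<..} u * S.inverse_dens t u) * indicator {x<..} u \<partial>lborel)"
        by (rule nn_integral_cong_AE, use AE_lborel_singleton[of x] in eventually_elim)
           (use x in \<open>auto simp: indicator_def\<close>)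
      also have "\<dots> = emeasure ?d2 {x<..}" by (rule emeasure_density[symmetric]) auto
      finally show ?thesis .
    qed
    have zero: "emeasure ?d1 {0<..} = emeasure ?d2 {0<..}"
    proof -
      have un: "{0<..} = (\<Union>n. {inverse (real (Suc n))<..})"
        using reals_Archimedean by (auto simp del: of_nat_Suc intro: less_trans[rotated])
      have inc: "incseq (\<lambda>n. {inverse (real (Suc n))<..})"
        by (rule incseq_SucI) (auto intro: le_less_trans[rotated] simp: le_imp_inverse_le)
      have "(SUP n. emeasure ?d1 {inverse (real (Suc n))<..}) = emeasure ?d1 {0<..}"
        unfolding un by (rule SUP_emeasure_incseq[OF _ inc]) auto
      moreover have "(SUP n. emeasure ?d2 {inverse (real (Suc n))<..}) = emeasure ?d2 {0<..}"
        unfolding un by (rule SUP_emeasure_incseq[OF _ inc]) auto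
      moreover have "emeasure ?d1 {inverse (real (Suc n))<..} = emeasure ?d2 {inverse (real (Suc n))<..}" for n
        by (rule pos) simp
      ultimately show ?thesis by simp
    qed
    have all: "emeasure ?d1 {x<..} = emeasure ?d2 {x<..}" for x
    proof (cases "0 < x")
      case False
      have *: "emeasure (density lborel (\<lambda>u. ennreal (indicator {0<..} u * d u))) {x<..}
          = emeasure (density lborel (\<lambda>u. ennreal (indicator {0<..} u * d u))) {0<..}"
        if [measurable]: "(\<lambda>u. ennreal (indicator {0<..} u * d u)) \<in> borel_measurable borel" for d :: "real \<Rightarrow> real"
      proof -
        have eq: "emeasure (density lborel (\<lambda>u. ennreal (indicator {0<..} u * d u))) {x<..}
            = (\<integral>\<^sup>+u. ennreal (indicator {0<..} u * d u) * indicator {x<..} u \<partial>lborel)" for x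
          by (rule emeasure_density) auto
        show ?thesis
          unfolding eq using False by (intro nn_integral_cong) (auto simp: indicator_def)
      qed
      show ?thesis using zero *[of "h t"] *[of "S.inverse_dens t"] hm[OF t] by simp
    qed (rule pos)
    have "?d1 = ?d2"
    proof (rule measure_eqI_lessThan)
      fix x
      have "emeasure ?d1 {x<..} = emeasure (distr M lborel (Y t)) {x<..}" by (simp add: dist[OF t])
      then show "emeasure ?d1 {x<..} < \<infinity>" using t by (simp add: emeasure_distr emeasure_eq_measure)
      show "emeasure ?d1 {x<..} = emeasure ?d2 {x<..}" by (rule all)
    qed auto
    then have "AE u in lborel. ennreal (indicator {0<..} u * h t u) = ennreal (indicator {0<..} u * S.inverse_dens t u)"
      by (subst (asm) sigma_finite_measure.density_unique_iff[OF sigma_finite_lborel]) (use hm[OF t] in auto)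
    then show ?thesis
      by eventually_elim (use h_nonneg[OF t] S.inverse_dens_nonneg in auto)
  qed
  have "AE w in M. Y 0 w = 0"
    by (rule inverse_subordinator_at_0[OF \<alpha> L YL']) simp
  with S.stable_law_axioms law dens show ?thesis by (rule that)
qed

lemma increment_prob_eq:
  assumes "0 \<le> v" "0 \<le> u"
  shows "f m u v
    = pa_prob k \<rho> m (cumulative_rate (\<lambda>u. lam (u + v)) u)"
  unfolding increment_prob_def rate_function_shift(2)[OF lam assms]
  by (rule polya_aeppli_increment_prob[OF k \<rho> N R.cum_nonneg])
     (use assms in \<open>auto intro!: monoD[OF R.mono_cum]\<close>)

abbreviation \<phi> :: "real \<Rightarrow> nat \<Rightarrow> real \<Rightarrow> real" where
  "\<phi> \<equiv> pa_increment_rate k \<rho> lam"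

lemma set_integrable_increment_rate:
  assumes v: "0 \<le> v" shows "set_integrable lborel {0..} (\<phi> v m)"
  unfolding pa_increment_rate_def
  using rate_function.time_change_integrable[OF rate_function_shift(1)[OF lam v]
      continuous_on_pa_deriv set_integrable_pa_deriv] by simp

text \<open>Write the conditional probability as the integral of its density up to \<open>Y(t)\<close> and exchange the
  integral with the expectation.\<close>

lemma subordinated_increment_prob_eq:
  assumes v: "0 \<le> v" and t: "0 < t"
  shows "p m t v
    = pa_prob k \<rho> m 0 + (LINT u:{0<..}|lborel. \<phi> v m u * prob {w\<in>space M. u \<le> Y t w})"
proof -
  interpret V: rate_function "\<lambda>u. lam (u + v)" by (rule rate_function_shift(1)[OF lam v])
  have [measurable]: "Y t \<in> borel_measurable M" using t by (intro measurable_Y) simp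
  define W where "W u = indicator {0<..} u * \<phi> v m u" for u
  have W: "integrable lborel W"
  proof -
    have "set_integrable lborel {0<..} (\<phi> v m)"
      by (rule set_integrable_subset[OF set_integrable_increment_rate[OF v]]) auto
    then show ?thesis by (simp add: W_def[abs_def] set_integrable_def)
  qed
  then have [measurable]: "W \<in> borel_measurable borel" by auto
  have rt: "(\<lambda>w. prob {w'\<in>space M. increment v (Y t w) w' = int m}) \<in> borel_measurable M"
    "prob {w\<in>space M. increment v (Y t w) w = int m} = (LINT w|M. prob {w'\<in>space M. increment v (Y t w) w' = int m})"
    by (rule prob_at_random_time[OF _ measurable_increment right_continuous_increment Y_pos[OF t] increment_indep]; use t in simp)+
  have meas: "(\<lambda>w. LINT u|lborel. indicator {..Y t w} u * W u) \<in> borel_measurable M"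
  proof -
    have "(\<lambda>w. LINT u|lborel. (if u \<le> Y t w then 1 else 0) * W u) \<in> borel_measurable M"
      by measurable
    also have "(\<lambda>w. LINT u|lborel. (if u \<le> Y t w then 1 else 0) * W u) = (\<lambda>w. LINT u|lborel. indicator {..Y t w} u * W u)"
      by (intro ext Bochner_Integration.integral_cong) (auto simp: indicator_def)
    finally show ?thesis .
  qed
  have "p m t v = prob {w\<in>space M. increment v (Y t w) w = int m}"
    by (simp add: subordinated_increment_prob_def increment_def)
  also have "\<dots> = (LINT w|M. prob {w'\<in>space M. increment v (Y t w) w' = int m})"
    by (rule rt(2))
  also have "\<dots> = (LINT w|M. pa_prob k \<rho> m 0 + (LINT u|lborel. indicator {..Y t w} u * W u))"
  proof (rule integral_cong_AE)
    have eq: "AE w in M. prob {w'\<in>space M. increment v (Y t w) w' = int m} = pa_prob k \<rho> m 0 + (LINT u|lborel. indicator {..Y t w} u * W u)"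
      using Y_pos[OF t]
    proof eventually_elim
      case (elim w)
      then have y: "0 \<le> Y t w" by simp
      have "prob {w'\<in>space M. increment v (Y t w) w' = int m} = pa_prob k \<rho> m (V.cum (Y t w))"
        using increment_prob_eq[OF v y, of m] by (simp add: increment_prob_def increment_def)
      also have "\<dots> = pa_prob k \<rho> m 0 + (LINT u:{0..Y t w}|lborel. lam (u + v) * pa_deriv k \<rho> m (V.cum u))"
        using V.time_change_integral[OF y continuous_on_pa_deriv pa_prob_derivative] by simp
      also have "(LINT u:{0..Y t w}|lborel. lam (u + v) * pa_deriv k \<rho> m (V.cum u)) = (LINT u|lborel. indicator {..Y t w} u * W u)"
        unfolding set_lebesgue_integral_def
      proof (rule integral_cong_AE)
        have "set_integrable lborel {0..Y t w} (\<phi> v m)"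
          by (rule set_integrable_subset[OF set_integrable_increment_rate[OF v]]) auto
        then show "(\<lambda>u. indicator {0..Y t w} u *\<^sub>R (lam (u + v) * pa_deriv k \<rho> m (V.cum u))) \<in> borel_measurable lborel"
          unfolding set_integrable_def pa_increment_rate_def by (rule borel_measurable_integrable)
        show "AE u in lborel. indicator {0..Y t w} u *\<^sub>R (lam (u + v) * pa_deriv k \<rho> m (V.cum u)) = indicator {..Y t w} u * W u"
          using AE_lborel_singleton[of 0] by eventually_elim (auto simp: W_def pa_increment_rate_def indicator_def)
      qed measurable
      finally show ?case .
    qed
    show "AE w in M. prob {w'\<in>space M. increment v (Y t w) w' = int m} = pa_prob k \<rho> m 0 + (LINT u|lborel. indicator {..Y t w} u * W u)"
      by (rule eq)
    show "(\<lambda>w. pa_prob k \<rho> m 0 + (LINT u|lborel. indicator {..Y t w} u * W u)) \<in> borel_measurable M"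
      using meas by measurable
    show "(\<lambda>w. prob {w'\<in>space M. increment v (Y t w) w' = int m}) \<in> borel_measurable M"
      by (rule rt(1))
  qed
  also have "\<dots> = pa_prob k \<rho> m 0 + (LINT w|M. LINT u|lborel. indicator {..Y t w} u * W u)"
  proof -
    have "integrable M (\<lambda>w. LINT u|lborel. indicator {..Y t w} u * W u)"
    proof (rule integrable_const_bound[where B="LINT u|lborel. \<bar>W u\<bar>"])
      show "AE w in M. norm (LINT u|lborel. indicator {..Y t w} u * W u) \<le> (LINT u|lborel. \<bar>W u\<bar>)"
      proof (rule AE_I2)
        fix w
        have "norm (LINT u|lborel. indicator {..Y t w} u * W u) \<le> (LINT u|lborel. norm (indicator {..Y t w} u * W u))"
          by (rule integral_norm_bound)
        also have "\<dots> \<le> (LINT u|lborel. \<bar>W u\<bar>)"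
          by (rule integral_mono')
             (use W in \<open>auto simp: indicator_def\<close>)
        finally show "norm (LINT u|lborel. indicator {..Y t w} u * W u) \<le> (LINT u|lborel. \<bar>W u\<bar>)" .
      qed
    qed (rule meas)
    then show ?thesis by (simp add: prob_space)
  qed
  also have "(LINT w|M. LINT u|lborel. indicator {..Y t w} u * W u) = (LINT u|lborel. W u * prob {w\<in>space M. u \<le> Y t w})"
    by (rule integral_up_to_random_time[OF _ W]) simp
  also have "\<dots> = (LINT u:{0<..}|lborel. \<phi> v m u * prob {w\<in>space M. u \<le> Y t w})"
    by (simp add: set_lebesgue_integral_def W_def mult.assoc)
  finally show ?thesis .
qed

lemma caputo_subordinated_increment_prob:
  assumes v: "0 \<le> v" and t: "0 < t"
  shows "caputo_differentiable \<alpha> (\<lambda>s. p m s v) t"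
    and "set_integrable lborel {0<..} (\<lambda>u. \<phi> v m u * h t u)"
    and "caputo_derivative \<alpha> (\<lambda>s. p m s v) t
      = (LINT u:{0<..}|lborel. \<phi> v m u * h t u)"
proof -
  obtain \<mu> where S: "stable_law \<alpha> \<mu>"
    and law: "\<And>t u. 0 < t \<Longrightarrow> 0 < u \<Longrightarrow> prob {w\<in>space M. u \<le> Y t w} = stable_law.cdf \<mu> (t * u powr (- 1 / \<alpha>))"
    and dens: "\<And>t. 0 < t \<Longrightarrow> AE u in lborel. 0 < u \<longrightarrow> h t u = stable_law.inverse_dens \<alpha> \<mu> t u"
    by (rule law_of_Y) blast
  interpret S: stable_law \<alpha> \<mu> by (rule S)
  have \<phi>: "set_integrable lborel {0<..} (\<phi> v m)"
    by (rule set_integrable_subset[OF set_integrable_increment_rate[OF v]]) auto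
  have P: "p m s v
      = pa_prob k \<rho> m 0 + (LINT u:{0<..}|lborel. \<phi> v m u * S.cdf (s * u powr (- 1 / \<alpha>)))" if s: "0 < s" for s
    unfolding subordinated_increment_prob_eq[OF v s]
    by (intro arg_cong2[where f="(+)"] refl set_lebesgue_integral_cong) (auto simp: law[OF s])
  show "caputo_differentiable \<alpha> (\<lambda>s. p m s v) t"
    by (rule S.caputo_mixture(1)[OF \<phi> t P])
  have H: "set_integrable lborel {0<..} (\<lambda>u. \<phi> v m u * S.inverse_dens t u)"
    by (rule S.set_integrable_mixture_inverse_dens[OF \<phi> t])
  have AE: "AE u in lborel. indicator {0<..} u *\<^sub>R (\<phi> v m u * S.inverse_dens t u) = indicator {0<..} u *\<^sub>R (\<phi> v m u * h t u)"
    using dens[OF t] by eventually_elim (auto simp: indicator_def)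
  have [measurable]: "(\<lambda>u. indicator {0<..} u * h t u) \<in> borel_measurable borel"
  proof -
    have "(\<lambda>u. ennreal (indicator {0<..} u * h t u)) \<in> borel_measurable borel"
      using distributed_borel_measurable[OF h[OF t]] by simp
    then have "(\<lambda>u. enn2real (ennreal (indicator {0<..} u * h t u))) \<in> borel_measurable borel" by measurable
    also have "(\<lambda>u. enn2real (ennreal (indicator {0<..} u * h t u))) = (\<lambda>u. indicator {0<..} u * h t u)"
      using h_nonneg[OF t] by (auto simp: fun_eq_iff indicator_def)
    finally show ?thesis .
  qed
  have [measurable]: "(\<lambda>u. indicator {0<..} u * \<phi> v m u) \<in> borel_measurable borel"
    using \<phi> by (auto simp: set_integrable_def)
  have "(\<lambda>u. (indicator {0<..} u * \<phi> v m u) * (indicator {0<..} u * h t u)) \<in> borel_measurable borel"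
    by measurable
  also have "(\<lambda>u. (indicator {0<..} u * \<phi> v m u) * (indicator {0<..} u * h t u)) = (\<lambda>u. indicator {0<..} u *\<^sub>R (\<phi> v m u * h t u))"
    by (auto simp: fun_eq_iff indicator_def)
  finally have meas: "(\<lambda>u. indicator {0<..} u *\<^sub>R (\<phi> v m u * h t u)) \<in> borel_measurable lborel" by simp
  show "set_integrable lborel {0<..} (\<lambda>u. \<phi> v m u * h t u)"
    unfolding set_integrable_def by (rule integrable_cong_AE_imp[OF H[unfolded set_integrable_def] meas AE])
  have "(LINT u:{0<..}|lborel. \<phi> v m u * S.inverse_dens t u) = (LINT u:{0<..}|lborel. \<phi> v m u * h t u)"
    unfolding set_lebesgue_integral_def
    by (rule integral_cong_AE[OF _ meas AE]) (use H in \<open>auto simp: set_integrable_def\<close>)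
  then show "caputo_derivative \<alpha> (\<lambda>s. p m s v) t
      = (LINT u:{0<..}|lborel. \<phi> v m u * h t u)"
    using S.caputo_mixture(2)[OF \<phi> t P] by simp
qed

lemma subordinated_increment_prob_0:
  "p m 0 v = (if m = 0 then 1 else 0)"
proof -
  have Y0: "AE w in M. Y 0 w = 0" by (rule law_of_Y) blast
  have "p m 0 v = prob {w\<in>space M. increment v (Y 0 w) w = int m}"
    by (simp add: subordinated_increment_prob_def increment_def)
  also have "\<dots> = prob {w\<in>space M. m = 0}"
  proof (rule finite_measure_eq_AE)
    show "AE w in M. w \<in> {w\<in>space M. increment v (Y 0 w) w = int m} \<longleftrightarrow> w \<in> {w\<in>space M. m = 0}"
      using Y0 by eventually_elim (auto simp: increment_def)
    show "{w\<in>space M. increment v (Y 0 w) w = int m} \<in> events"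
      by (rule measurable_at_random_time[OF measurable_Y measurable_increment right_continuous_increment]) auto
  qed auto
  also have "\<dots> = (if m = 0 then 1 else 0)" by (simp add: prob_space)
  finally show ?thesis .
qed

lemma increment_rate_eq:
  assumes "0 \<le> v" "0 \<le> u"
  shows "\<phi> v m u = lam (u + v) * (- f m u v
    + (1 - \<rho>) / (1 - \<rho> ^ k) * (\<Sum>j = 1..min m k. \<rho> ^ (j - 1) * f (m - j) u v))"
  unfolding pa_increment_rate_def pa_deriv_def increment_prob_eq[OF assms] geom_weight_def
  by (simp add: sum_distrib_left mult.assoc)

end




theorem theorem4p4:
  fixes M :: "'w measure"
    and \<alpha> \<rho> :: real and k :: nat
    and lam \<Lambda> :: "real \<Rightarrow> real"
    and N :: "real \<Rightarrow> 'w \<Rightarrow> nat"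
    and Y :: "real \<Rightarrow> 'w \<Rightarrow> real"
    and h :: "real \<Rightarrow> real \<Rightarrow> real"
    and f p :: "nat \<Rightarrow> real \<Rightarrow> real \<Rightarrow> real"
  assumes "prob_space M"
    and "0 < \<alpha>" "\<alpha> < 1"
    and "1 \<le> k"
    and "0 \<le> \<rho>" "\<rho> < 1"
    and "\<And>u. 0 \<le> u \<Longrightarrow> 0 \<le> lam u"
    and "\<And>t. 0 < t \<Longrightarrow> set_integrable lborel {0..t} lam"
    and "\<Lambda> = cumulative_rate lam"
    and "polya_aeppli_process M k \<rho> N"
    and "inverse_stable_subordinator M \<alpha> Y"
    and "prob_space.indep_set M
           (generated_events M (count_space UNIV) {0..} N)
           (generated_events M borel {0..} Y)"
    and "\<And>t u. 0 < t \<Longrightarrow> 0 < u \<Longrightarrow> 0 \<le> h t u"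
    and "\<And>t. 0 < t \<Longrightarrow> distributed M lborel (Y t) (\<lambda>u. ennreal (indicator {0<..} u * h t u))"
    and "f = increment_prob M N \<Lambda>"
    and "p = subordinated_increment_prob M N \<Lambda> Y"
  shows "\<forall>v\<ge>0.
    (\<forall>t>0.
       caputo_differentiable \<alpha> (\<lambda>s. p 0 s v) t \<and>
       set_integrable lborel {0<..} (\<lambda>u. lam (u + v) * f 0 u v * h t u) \<and>
       caputo_derivative \<alpha> (\<lambda>s. p 0 s v) t =
         - (LINT u:{0<..}|lborel. lam (u + v) * f 0 u v * h t u)) \<and>
    (\<forall>t>0. \<forall>m\<ge>1.
       caputo_differentiable \<alpha> (\<lambda>s. p m s v) t \<and>
       set_integrable lborel {0<..} (\<lambda>u. lam (u + v) *
         (- f m u v + (1 - \<rho>) / (1 - \<rho> ^ k) * (\<Sum>j = 1..min m k. \<rho> ^ (j - 1) * f (m - j) u v)) * h t u) \<and>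
       caputo_derivative \<alpha> (\<lambda>s. p m s v) t =
         (LINT u:{0<..}|lborel. lam (u + v) *
           (- f m u v + (1 - \<rho>) / (1 - \<rho> ^ k) * (\<Sum>j = 1..min m k. \<rho> ^ (j - 1) * f (m - j) u v)) * h t u)) \<and>
    (\<forall>m. p m 0 v = (if m = 0 then 1 else 0))"
proof -
  have lam: "rate_function lam" by unfold_locales (use assms in auto)
  note [simp] = \<open>f = increment_prob M N \<Lambda>\<close> \<open>p = subordinated_increment_prob M N \<Lambda> Y\<close> \<open>\<Lambda> = cumulative_rate lam\<close>
  have density: "\<forall>t>0. \<forall>u>0. 0 \<le> h t u"
    "\<forall>t>0. distributed M lborel (Y t) (\<lambda>u. ennreal (indicator {0<..} u * h t u))"
    using assms(13,14) by simp_all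
  note setting = \<open>prob_space M\<close> \<open>0 < \<alpha>\<close> \<open>\<alpha> < 1\<close> \<open>1 \<le> k\<close> \<open>0 \<le> \<rho>\<close> \<open>\<rho> < 1\<close> lam assms(10-12) density
  note caputo = caputo_subordinated_increment_prob[OF setting]
  have eq: "pa_increment_rate k \<rho> lam v m u * h t u = lam (u + v) * (- f m u v
      + (1 - \<rho>) / (1 - \<rho> ^ k) * (\<Sum>j = 1..min m k. \<rho> ^ (j - 1) * f (m - j) u v)) * h t u"
    if "0 \<le> v" "u \<in> {0<..}" for v m t u
    using increment_rate_eq[OF setting that(1), of u m] that(2) by simp
  \<comment> \<open>For \<open>m = 0\<close> the sum is empty and \<open>e 0 v u * h t u\<close> is minus the integrand of the first equation.\<close>
  define e where "e m v u = lam (u + v) * (- f m u v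
      + (1 - \<rho>) / (1 - \<rho> ^ k) * (\<Sum>j = 1..min m k. \<rho> ^ (j - 1) * f (m - j) u v))" for m v u
  have *: "caputo_differentiable \<alpha> (\<lambda>s. p m s v) t \<and>
      set_integrable lborel {0<..} (\<lambda>u. e m v u * h t u) \<and>
      caputo_derivative \<alpha> (\<lambda>s. p m s v) t = (LINT u:{0<..}|lborel. e m v u * h t u)"
    if v: "0 \<le> v" and t: "0 < t" for m v t
  proof -
    note cap = caputo[OF v t, of m]
    have eq': "pa_increment_rate k \<rho> lam v m u * h t u = e m v u * h t u" if "u \<in> {0<..}" for u
      unfolding e_def by (rule eq[OF v that])
    have "set_integrable lborel {0<..} (\<lambda>u. e m v u * h t u)"
      using cap(2) by (subst set_integrable_cong[OF refl refl eq'[symmetric]])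
    moreover have "(LINT u:{0<..}|lborel. pa_increment_rate k \<rho> lam v m u * h t u) = (LINT u:{0<..}|lborel. e m v u * h t u)"
      by (rule set_lebesgue_integral_cong) (use eq' in auto)
    ultimately show ?thesis using cap by simp
  qed
  have e0: "e 0 v u * h t u = - (lam (u + v) * f 0 u v * h t u)" for v u t
    by (simp add: e_def)
  show ?thesis
  proof (intro allI impI conjI)
    fix v t :: real assume v: "0 \<le> v" and t: "0 < t"
    note * = *[OF v t, of 0, unfolded e0]
    show "caputo_differentiable \<alpha> (\<lambda>s. p 0 s v) t" using * by blast
    show "set_integrable lborel {0<..} (\<lambda>u. lam (u + v) * f 0 u v * h t u)"
      using * unfolding set_integrable_def by simp
    show "caputo_derivative \<alpha> (\<lambda>s. p 0 s v) t = - (LINT u:{0<..}|lborel. lam (u + v) * f 0 u v * h t u)"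
      using * unfolding set_lebesgue_integral_def by simp
  next
    fix v t :: real and m :: nat assume v: "0 \<le> v" and t: "0 < t"
    note * = *[OF v t, of m, unfolded e_def]
    show "caputo_differentiable \<alpha> (\<lambda>s. p m s v) t" using * by blast
    show "set_integrable lborel {0<..} (\<lambda>u. lam (u + v) *
         (- f m u v + (1 - \<rho>) / (1 - \<rho> ^ k) * (\<Sum>j = 1..min m k. \<rho> ^ (j - 1) * f (m - j) u v)) * h t u)"
      using * by blast
    show "caputo_derivative \<alpha> (\<lambda>s. p m s v) t =
         (LINT u:{0<..}|lborel. lam (u + v) *
           (- f m u v + (1 - \<rho>) / (1 - \<rho> ^ k) * (\<Sum>j = 1..min m k. \<rho> ^ (j - 1) * f (m - j) u v)) * h t u)"
      using * by blast
  next
    fix v :: real and m :: nat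
    show "p m 0 v = (if m = 0 then 1 else 0)"
      using subordinated_increment_prob_0[OF setting, of m v] by simp
  qed
qed

end
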